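(* Let $AB$ be a given line and let $\Gamma$ be a circle with given centre $O$ and given point $S \in \Gamma$. Then, by a match-stick construction following Postulates i, ii and iii below, one can construct the intersection of the line $(AB)$ and $\Gamma$, respectively determine whether this intersection is empty.
   Context: We work in the Euclidean plane with a fixed unit of length. A match-stick (or stick) is a closed line segment of length exactly $1$; its endpoints are called its extremities. A match-stick construction is a finite sequence of steps, starting from given objects, each permitted by the following postulates ("given" means initially given or obtained in an earlier step): Postulate i. One may lay a match-stick through any two given points at distance equal to or less than the unit, where one or even two of the points may be chosen as extremity of the stick segment. This procedure also permits us to determine whether the distance of two given points is strictly less than, equal to, or strictly greater than the unit. Postulate ii. One may choose an arbitrary point on a given stick segment, and it can be chosen such that it is none of the extremities. Postulate iii. From a given point, one may use a match-stick as a unitary ruler. This ruler does not leave a trace, but can be used to determine a point with unit distance to the given point and relatively to a given set of match-sticks (for instance, the points of given sticks at distance exactly $1$ from the given point, or that there are none). No two match-sticks can be used as a compass at the same time. Intersection points of laid sticks count as constructed points. As usual for geometric constructions, "arbitrary" choices are auxiliary: the constructed object must not depend on them. A line is given when it is determined by a laid stick segment contained in it; such a segment may be extended along the line to any desired length. A circle is given by its centre and one of its points (the circle itself is not drawn); its radius is an arbitrary positive real number. Constructing the intersection means constructing each of its points. *)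

theory Defs
  imports "HOL-Analysis.Analysis"
begin

type_synonym point = "real^2"

text \<open>A stick is stored as the pair of its extremities. Given objects are referred to by their
  position in these lists; later steps only append, so positions remain valid.\<close>

record config =
  points :: "point list"
  sticks :: "(point \<times> point) list"

definition stick_segment :: "point \<times> point \<Rightarrow> point set" where
  "stick_segment s = closed_segment (fst s) (snd s)"

definition add_objects :: "config \<Rightarrow> point list \<Rightarrow> (point \<times> point) list \<Rightarrow> config" where
  "add_objects c ps ss = \<lparr>points = points c @ ps, sticks = sticks c @ ss\<rparr>"

text \<open>The flags of \<open>Lay\<close> say which of the two points are prescribed to be extremities; the flag
  of \<open>Choose\<close> asks for a point that is not an extremity. The unitary ruler finds all points at
  unit distance on the listed sticks (\<open>Ruler_on\<close>), or some point at unit distance lying on none of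
  them (\<open>Ruler_off\<close>); without the latter one could not leave a line. No instruction intersects
  two unit circles, since two sticks may not be used together as a compass.\<close>

datatype instr =
    Compare nat nat
  | Lay nat nat bool bool
  | Choose nat bool
  | Ruler_on nat "nat list"
  | Ruler_off nat "nat list"
  | Meet nat nat

text \<open>All that becomes known from a step: the result of a comparison with the unit, or the
  number of points obtained.\<close>

datatype observation = Shorter | Unit | Longer | Found nat

text \<open>All possible results of a step. The set is empty exactly if the step is not
  permitted. It has several elements if a choice is arbitrary; the order in which
  simultaneously found points are listed is arbitrary, too. Overlapping sticks (with infinitely
  many common points) yield no intersection point.\<close>

fun results :: "instr \<Rightarrow> config \<Rightarrow> (observation \<times> config) set" where
  "results (Compare i j) c =
    (if i < length (points c) \<and> j < length (points c) then
       {(let d = dist (points c ! i) (points c ! j) in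
           if d < 1 then Shorter else if d = 1 then Unit else Longer, c)}
     else {})"
| "results (Lay i j e f) c =
    {(Found 2, add_objects c [a, b] [(a, b)]) | a b.
       i < length (points c) \<and> j < length (points c) \<and> points c ! i \<noteq> points c ! j \<and>
       dist a b = 1 \<and> {points c ! i, points c ! j} \<subseteq> stick_segment (a, b) \<and>
       (e \<longrightarrow> a = points c ! i) \<and> (f \<longrightarrow> b = points c ! j)}"
| "results (Choose s b) c =
    {(Found 1, add_objects c [x] []) | x.
       s < length (sticks c) \<and> x \<in> stick_segment (sticks c ! s) \<and>
       (b \<longrightarrow> x \<noteq> fst (sticks c ! s) \<and> x \<noteq> snd (sticks c ! s))}"
| "results (Ruler_on i ss) c =
    {(Found (length xs), add_objects c xs []) | xs.
       i < length (points c) \<and> (\<forall>s\<in>set ss. s < length (sticks c)) \<and> distinct xs \<and>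
       set xs = {x \<in> (\<Union>s\<in>set ss. stick_segment (sticks c ! s)). dist (points c ! i) x = 1}}"
| "results (Ruler_off i ss) c =
    {(Found 1, add_objects c [x] []) | x.
       i < length (points c) \<and> (\<forall>s\<in>set ss. s < length (sticks c)) \<and>
       dist (points c ! i) x = 1 \<and> x \<notin> (\<Union>s\<in>set ss. stick_segment (sticks c ! s))}"
| "results (Meet s t) c =
    {(Found (length xs), add_objects c xs []) | xs.
       s < length (sticks c) \<and> t < length (sticks c) \<and> distinct xs \<and>
       set xs = (let I = stick_segment (sticks c ! s) \<inter> stick_segment (sticks c ! t) in
                   if finite I then I else {})}"

text \<open>A construction prescribes the next step depending only on what has been observed so
  far, and ends by naming the points constructed. It is a codatatype because the number of
  steps needed is not bounded independently of the given objects.\<close>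

codatatype construction =
    Finish "nat list"
  | Step instr "observation \<Rightarrow> construction"

text \<open>\<open>constructs T K c\<close>: started from the configuration \<open>c\<close>, and whatever arbitrary choices are
  made, \<open>K\<close> performs only permitted steps, ends after finitely many of them, and then names
  precisely the points of \<open>T\<close>. In particular it names no point if and only if \<open>T\<close> is empty.\<close>

inductive constructs :: "point set \<Rightarrow> construction \<Rightarrow> config \<Rightarrow> bool" for T :: "point set" where
  finish: "\<lbrakk>\<forall>n\<in>set ns. n < length (points c); (\<lambda>n. points c ! n) ` set ns = T\<rbrakk>
      \<Longrightarrow> constructs T (Finish ns) c"
| step: "\<lbrakk>results i c \<noteq> {}; \<forall>r c'. (r, c') \<in> results i c \<longrightarrow> constructs T (K r) c'\<rbrakk>
      \<Longrightarrow> constructs T (Step i K) c"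

end

theory Submission
  imports Defs
begin

text \<open>Coordinates turn the problem into arithmetic. In an orthonormal frame whose first axis is the given
line, let the centre be \<open>(z\<^sub>1, z\<^sub>2)\<close> and the point on the circle \<open>(s\<^sub>1, s\<^sub>2)\<close>. The points sought are
\<open>(x, 0)\<close> with \<open>x = z\<^sub>1 \<plusminus> sqrt D\<close>, where \<open>D = (s\<^sub>1 - z\<^sub>1)\<^sup>2 + (s\<^sub>2 - z\<^sub>2)\<^sup>2 - z\<^sub>2\<^sup>2\<close>, and there is none if
\<open>D < 0\<close>. So it suffices to add, multiply and extract square roots with match-sticks.

The difficulty is that a stick joins only points at distance at most \<open>1\<close>, so nothing can be done
directly with distant points. Two devices overcome it. First, once a square of side \<open>1/2\<close> is there,
every point with dyadic coordinates can be constructed (\<open>dyadic_lattice\<close>). A point close to a lattice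
point can be handled by short sticks next to it, and its offset can be carried to any other cell:
\<open>Col x\<close> says that all points \<open>(x, y)\<close> with \<open>y\<close> dyadic are available, and a point near the lattice
is available if and only if its column and its row are. Perpendiculars come from steep isosceles
triangles with unit legs, which remain non-degenerate for all offsets up to \<open>1/128\<close>; hence the
arithmetic needs no case distinctions on the sign or vanishing of its arguments. Secondly, all
numbers are divided by a large power of \<open>2\<close> before they are combined, and the results are
multiplied back at the end. Sums and products of small numbers are obtained from single lines across
the lattice (\<open>Col_average\<close>, \<open>Col_minus_product\<close>), roots from two such lines and a point of the axis at
distance \<open>1\<close> from a point of the other axis (\<open>Col_sqrt\<close>).

The scale and the lattice points near the centre, the given point and the two results are not
computed but guessed: countably many guesses are tried one after the other, each is verified by
comparing distances with the unit, and a correct one exists because the lattice is dense. This is the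
only unbounded loop (\<open>can_search\<close>).

It remains to find the frame. A point off the line at unit distance from a point of it can only be chosen
arbitrarily, as can points of a stick. From a point of height \<open>h \<le> 1/2\<close> above the line, the two
points of the line at distance \<open>1\<close> and their reflections in the given point form a rectangle with
a side of length \<open>2h \<le> 1\<close>, and laying a stick along that side gives a perpendicular. An arbitrary
point at distance \<open>t\<close> along a stick may be too high, but then \<open>1 - t\<close> is less than \<open>1/2\<close>; so one of the two
complementary choices works, and a comparison tells which
(\<open>can_frames\<close>). The same trick with the two axes gives the square of side \<open>1/2\<close>
(\<open>half_square\<close>).

Constructions are composed as follows. A world \<open>w\<close> stands for everything that is not under control:
the input and the arbitrary choices made so far. Points are functions of the world, and \<open>known G V f\<close>
states that one program constructs \<open>f w\<close> from the points \<open>G\<close> for every \<open>w \<in> V\<close>. An arbitrary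
choice enlarges the world, an observation restricts \<open>V\<close>. If \<open>f\<close> does not depend on the choices,
they have left no trace in the statement \<open>known G V f\<close>.\<close>

section \<open>Programs, and what they construct in all worlds\<close>

text \<open>A finite part of a construction that ends by handing over a value. Finite trees, unlike
constructions, can be sequenced by structural recursion; the values are typically indices of the points
constructed together with the current numbers of points and sticks.\<close>

datatype 'l tree = is_leaf: Leaf (outcome: 'l) | Node (first_step: instr) (rest: "observation \<Rightarrow> 'l tree")

primrec run :: "'l tree \<Rightarrow> ('l \<Rightarrow> config \<Rightarrow> bool) \<Rightarrow> config \<Rightarrow> bool" where
  "run (Leaf l) Q c = Q l c"
| "run (Node i f) Q c =
    (results i c \<noteq> {} \<and> (\<forall>r c'. (r, c') \<in> results i c \<longrightarrow> run (f r) Q c'))"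

primrec tbind :: "'l tree \<Rightarrow> ('l \<Rightarrow> 'k tree) \<Rightarrow> 'k tree" where
  "tbind (Leaf l) g = g l"
| "tbind (Node i f) g = Node i (\<lambda>r. tbind (f r) g)"

lemma run_mono:
  assumes "run t Q c" "\<And>l c'. Q l c' \<Longrightarrow> R l c'"
  shows "run t R c"
  using assms
proof (induction t arbitrary: c)
  case (Node i f)
  then show ?case by (metis rangeI run.simps(2))
qed simp

lemma run_tbind: "run (tbind t g) Q c = run t (\<lambda>l c'. run (g l) Q c') c"
  by (induction t arbitrary: c) auto

text \<open>Steps only append, hence indices obtained earlier keep their meaning.\<close>

definition extends :: "config \<Rightarrow> config \<Rightarrow> bool" where
  "extends c c' \<longleftrightarrow> (\<exists>ps ss. c' = add_objects c ps ss)"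

lemma extends_refl: "extends c c"
  unfolding extends_def by (rule exI[of _ "[]"], rule exI[of _ "[]"]) (simp add: add_objects_def)

lemma extends_trans: "extends a b \<Longrightarrow> extends b c \<Longrightarrow> extends a c"
  unfolding extends_def by (force simp: add_objects_def)

lemma results_extends: "(r, c') \<in> results i c \<Longrightarrow> extends c c'"
  using extends_refl by (cases i) (auto simp: extends_def split: if_splits)

lemma run_extends: "run t Q c \<Longrightarrow> run t (\<lambda>l c'. extends c c' \<and> Q l c') c"
proof (induction t arbitrary: c)
  case (Leaf l)
  then show ?case by (simp add: extends_refl)
next
  case (Node i f)
  show ?case
  proof (simp, intro conjI allI impI)
    show "results i c \<noteq> {}" using Node.prems by simp
  next
    fix r c' assume *: "(r, c') \<in> results i c"
    then have "run (f r) Q c'" using Node.prems by auto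
    then have "run (f r) (\<lambda>l d. extends c' d \<and> Q l d) c'"
      using Node.IH[of "f r"] by auto
    then show "run (f r) (\<lambda>l d. extends c d \<and> Q l d) c'"
      by (rule run_mono) (use results_extends[OF *] extends_trans in blast)
  qed
qed

definition has_size :: "nat \<Rightarrow> nat \<Rightarrow> config \<Rightarrow> bool" where
  "has_size n m c \<longleftrightarrow> length (points c) = n \<and> length (sticks c) = m"

definition holds :: "nat list \<Rightarrow> ('w \<Rightarrow> point) list \<Rightarrow> 'w \<Rightarrow> config \<Rightarrow> bool" where
  "holds I G w c \<longleftrightarrow> list_all2 (\<lambda>i f. i < length (points c) \<and> points c ! i = f w) I G"

lemma holds_extends: "holds I G w c \<Longrightarrow> extends c c' \<Longrightarrow> holds I G w c'"
  unfolding holds_def extends_def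
  by (auto simp: add_objects_def nth_append elim!: list_all2_mono)

text \<open>One program must serve all worlds \<open>w \<in> V\<close>. It may depend on the indices \<open>I\<close> of the given points and
on the numbers \<open>n\<close> and \<open>m\<close> of points and sticks, since these determine where new objects will be
found. Both numbers are known at any time: an observation tells how many points were added, and each
\<open>Lay\<close> adds one stick.\<close>

definition can :: "('w \<Rightarrow> point) list \<Rightarrow> 'w set \<Rightarrow> ('w \<Rightarrow> 'l \<Rightarrow> config \<Rightarrow> bool) \<Rightarrow> bool" where
  "can G V Q \<longleftrightarrow> (\<forall>I n m. \<exists>t. \<forall>w\<in>V. \<forall>c. has_size n m c \<and> holds I G w c \<longrightarrow> run t (Q w) c)"

definition known :: "('w \<Rightarrow> point) list \<Rightarrow> 'w set \<Rightarrow> ('w \<Rightarrow> point) \<Rightarrow> bool" where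
  "known G V f \<longleftrightarrow>
    can G V (\<lambda>w (k, n, m) c. has_size n m c \<and> k < n \<and> points c ! k = f w)"

lemma canI:
  assumes "\<And>I n m. length I = length G \<Longrightarrow>
    \<exists>t. \<forall>w\<in>V. \<forall>c. has_size n m c \<and> holds I G w c \<longrightarrow> run t (Q w) c"
  shows "can G V Q"
  unfolding can_def
proof (intro allI)
  fix I n m
  show "\<exists>t. \<forall>w\<in>V. \<forall>c. has_size n m c \<and> holds I G w c \<longrightarrow> run t (Q w) c"
  proof (cases "length I = length G")
    case True
    then show ?thesis by (rule assms)
  next
    case False
    then show ?thesis unfolding holds_def using list_all2_lengthD by blast
  qed
qed

text \<open>Whatever is known may be constructed first and then counts as given. Since this holds for every goal
\<open>Q\<close>, constructions can be composed without mentioning programs.\<close>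

lemma can_get:
  assumes f: "known G V f" and Q: "can (f # G) V Q"
  shows "can G V Q"
  unfolding can_def
proof (intro allI)
  fix I n m
  obtain t where t: "\<And>w c. w \<in> V \<Longrightarrow> has_size n m c \<Longrightarrow> holds I G w c \<Longrightarrow>
      run t (\<lambda>(k, n, m) c. has_size n m c \<and> k < n \<and> points c ! k = f w) c"
    using f unfolding known_def can_def by meson
  have "\<forall>k n m. \<exists>t. \<forall>w\<in>V. \<forall>c. has_size n m c \<and> holds (k # I) (f # G) w c \<longrightarrow> run t (Q w) c"
    using Q unfolding can_def by blast
  then obtain t' where t': "\<And>k n m w c. w \<in> V \<Longrightarrow> has_size n m c \<Longrightarrow>
      holds (k # I) (f # G) w c \<Longrightarrow> run (t' k n m) (Q w) c"
    by metis
  have "run (tbind t (\<lambda>(k, n, m). t' k n m)) (Q w) c"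
    if "w \<in> V" "has_size n m c" "holds I G w c" for w c
    unfolding run_tbind
  proof (rule run_mono[OF run_extends[OF t[OF that]]])
    fix l c' assume *: "extends c c' \<and> (case l of (k, n, m) \<Rightarrow>
       \<lambda>c. has_size n m c \<and> k < n \<and> points c ! k = f w) c'"
    obtain k n' m' where l: "l = (k, n', m')" by (cases l)
    have "holds (k # I) (f # G) w c'"
      using * that(3) holds_extends[of I G w c c'] by (simp add: l holds_def has_size_def)
    then show "run (case l of (k, n, m) \<Rightarrow> t' k n m) (Q w) c'"
      using t'[OF that(1)] * by (simp add: l)
  qed
  then show "\<exists>t. \<forall>w\<in>V. \<forall>c. has_size n m c \<and> holds I G w c \<longrightarrow> run t (Q w) c" by blast
qed

lemma can_subset: "can G V Q \<Longrightarrow> V' \<subseteq> V \<Longrightarrow> can G V' Q"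
  unfolding can_def by (meson subsetD)

lemma known_subset: "known G V f \<Longrightarrow> V' \<subseteq> V \<Longrightarrow> known G V' f"
  unfolding known_def by (rule can_subset)

lemma known_cong: "known G V f \<Longrightarrow> (\<And>w. w \<in> V \<Longrightarrow> f w = g w) \<Longrightarrow> known G V g"
  unfolding known_def can_def by simp

text \<open>The map \<open>g\<close> forgets part of a richer world. A program that works for all the poorer worlds works for
the richer ones, where the same points appear as functions composed with \<open>g\<close>.\<close>

lemma can_reindex:
  assumes Q: "can G V Q" and g: "\<And>w. w \<in> V' \<Longrightarrow> g w \<in> V"
    and G: "set (map (\<lambda>f w. f (g w)) G) \<subseteq> set G'"
  shows "can G' V' (\<lambda>w. Q (g w))"
proof (rule canI)
  fix I :: "nat list" and n m assume len: "length I = length G'"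
  have "\<forall>f\<in>set G. \<exists>j<length G'. G' ! j = (\<lambda>w. f (g w))"
    using G by (auto simp: in_set_conv_nth subset_iff)
  then obtain j where j: "\<And>f. f \<in> set G \<Longrightarrow> j f < length G' \<and> G' ! j f = (\<lambda>w. f (g w))"
    by metis
  define I' where "I' = map (\<lambda>f. I ! j f) G"
  obtain t where t: "\<And>w c. w \<in> V \<Longrightarrow> has_size n m c \<Longrightarrow> holds I' G w c \<Longrightarrow> run t (Q w) c"
    using Q unfolding can_def by meson
  have "holds I' G (g w) c" if "holds I G' w c" for w c
    using that j unfolding holds_def I'_def
    by (auto simp: list_all2_conv_all_nth len)
  then show "\<exists>t. \<forall>w\<in>V'. \<forall>c. has_size n m c \<and> holds I G' w c \<longrightarrow> run t (Q (g w)) c"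
    using t g by blast
qed

lemma can_weaken: "can G V Q \<Longrightarrow> set G \<subseteq> set G' \<Longrightarrow> can G' V Q"
  using can_reindex[of G V Q V "\<lambda>w. w" G'] by (simp add: image_def)

lemma known_weaken: "known G V f \<Longrightarrow> set G \<subseteq> set G' \<Longrightarrow> known G' V f"
  unfolding known_def by (rule can_weaken)

lemma can_gets:
  assumes "\<And>f. f \<in> set fs \<Longrightarrow> known G V f" and "can (fs @ G) V Q"
  shows "can G V Q"
  using assms
proof (induction fs arbitrary: G)
  case (Cons f fs)
  have "can (f # G) V Q"
  proof (rule Cons.IH)
    show "known (f # G) V f'" if "f' \<in> set fs" for f'
      by (rule known_weaken[of G]) (use Cons.prems that in auto)
    show "can (fs @ f # G) V Q"
      by (rule can_weaken[OF Cons.prems(2)]) auto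
  qed
  then show ?case using Cons.prems(1) by (auto intro: can_get)
qed simp

text \<open>A construction stated for an abstract type of worlds is applied to concrete points, which need not be
given but only known.\<close>

lemma can_subst:
  assumes Q: "can G V Q" and "\<And>w. w \<in> V' \<Longrightarrow> g w \<in> V"
    and G: "\<And>f. f \<in> set G \<Longrightarrow> known G' V' (\<lambda>w. f (g w))"
  shows "can G' V' (\<lambda>w. Q (g w))"
proof (rule can_gets)
  show "can (map (\<lambda>f w. f (g w)) G @ G') V' (\<lambda>w. Q (g w))"
    by (rule can_reindex[OF Q]) (use assms(2) in auto)
qed (use G in auto)

lemma known_subst:
  assumes "known G V f" "\<And>w. w \<in> V' \<Longrightarrow> g w \<in> V"
    and "\<And>f. f \<in> set G \<Longrightarrow> known G' V' (\<lambda>w. f (g w))"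
  shows "known G' V' (\<lambda>w. f (g w))"
  unfolding known_def by (rule can_subst[where g = g, OF assms(1)[unfolded known_def] assms(2,3)])

lemma known_get: "known G V f \<Longrightarrow> known (f # G) V g \<Longrightarrow> known G V g"
  unfolding known_def[of G V g] known_def[of "f # G" V g] by (rule can_get)

lemma known_mem: "f \<in> set G \<Longrightarrow> known G V f"
  unfolding known_def
proof (rule canI)
  fix I :: "nat list" and n m assume f: "f \<in> set G" and len: "length I = length G"
  obtain j where j: "j < length G" "G ! j = f" using f by (auto simp: in_set_conv_nth)
  have "run (Leaf (I ! j, n, m)) (\<lambda>(k, n, m) c. has_size n m c \<and> k < n \<and> points c ! k = f w) c"
    if "has_size n m c \<and> holds I G w c" for w c
    using that j len by (auto simp: holds_def has_size_def list_all2_conv_all_nth)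
  then show "\<exists>t. \<forall>w\<in>V. \<forall>c. has_size n m c \<and> holds I G w c \<longrightarrow>
      run t ((\<lambda>(k, n, m) c. has_size n m c \<and> k < n \<and> points c ! k = f w)) c"
    by blast
qed

section \<open>The permitted steps\<close>

primrec lays :: "(nat \<times> nat) list \<Rightarrow> 'l tree \<Rightarrow> 'l tree" where
  "lays [] t = t"
| "lays (ij # ijs) t = Node (Lay (fst ij) (snd ij) True True) (\<lambda>_. lays ijs t)"

lemma run_lays:
  assumes "\<forall>(i, j)\<in>set ijs. i < length (points c) \<and> j < length (points c) \<and>
      dist (points c ! i) (points c ! j) = 1"
  shows "run (lays ijs t) Q c \<longleftrightarrow>
    run t Q (add_objects c (concat (map (\<lambda>(i, j). [points c ! i, points c ! j]) ijs))
      (map (\<lambda>(i, j). (points c ! i, points c ! j)) ijs))"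
  using assms
proof (induction ijs arbitrary: c)
  case Nil
  show ?case by (cases c) (simp add: add_objects_def)
next
  case (Cons ij ijs)
  obtain i j where ij: "ij = (i, j)" by (cases ij)
  let ?c = "add_objects c [points c ! i, points c ! j] [(points c ! i, points c ! j)]"
  have ok: "i < length (points c)" "j < length (points c)" "dist (points c ! i) (points c ! j) = 1"
    using Cons.prems by (auto simp: ij)
  then have ne: "points c ! i \<noteq> points c ! j" by auto
  have "results (Lay i j True True) c = {(Found 2, ?c)}"
    using ok ne by (auto simp: stick_segment_def)
  then have 1: "run (lays (ij # ijs) t) Q c = run (lays ijs t) Q ?c"
    by (simp add: ij)
  have nth: "points ?c ! k = points c ! k" if "k < length (points c)" for k
    using that by (simp add: add_objects_def nth_append)
  have "run (lays ijs t) Q ?c = run t Q (add_objects ?c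
      (concat (map (\<lambda>(i, j). [points ?c ! i, points ?c ! j]) ijs))
      (map (\<lambda>(i, j). (points ?c ! i, points ?c ! j)) ijs))"
    by (rule Cons.IH) (use Cons.prems nth in \<open>force simp: add_objects_def\<close>)
  also have "map (\<lambda>(i, j). [points ?c ! i, points ?c ! j]) ijs =
      map (\<lambda>(i, j). [points c ! i, points c ! j]) ijs"
    using Cons.prems nth by auto
  also have "map (\<lambda>(i, j). (points ?c ! i, points ?c ! j)) ijs =
      map (\<lambda>(i, j). (points c ! i, points c ! j)) ijs"
    using Cons.prems nth by auto
  finally show ?case unfolding 1 by (simp add: ij add_objects_def)
qed

lemma holds_append:
  "length I = length F \<Longrightarrow> holds (I @ J) (F @ G) w c \<longleftrightarrow> holds I F w c \<and> holds J G w c"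
  by (simp add: holds_def list_all2_append)

lemma holds_nth:
  "holds I G w c \<Longrightarrow> j < length G \<Longrightarrow> I ! j < length (points c) \<and> points c ! (I ! j) = (G ! j) w"
  by (simp add: holds_def list_all2_conv_all_nth)

lemma run_single: "results i c = {(r, c')} \<Longrightarrow> run (f r) Q c' \<Longrightarrow> run (Node i f) Q c"
  by simp

text \<open>The steps that use a stick refer to it by its index. Laying the sticks anew immediately before
gives them consecutive indices, so that only points have to be remembered between steps.\<close>

lemma can_sticks:
  assumes known: "\<And>A B. (A, B) \<in> set prs \<Longrightarrow> known G V A \<and> known G V B"
    and unit: "\<And>A B w. (A, B) \<in> set prs \<Longrightarrow> w \<in> V \<Longrightarrow> dist (A w) (B w) = 1"
    and step: "\<And>I n m. length I = length G \<Longrightarrow> \<exists>t. \<forall>w\<in>V. \<forall>c.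
      has_size n (m + length prs) c \<and> holds I G w c \<and>
      (\<forall>j<length prs. sticks c ! (m + j) = (fst (prs ! j) w, snd (prs ! j) w)) \<longrightarrow> run t (Q w) c"
  shows "can G V Q"
proof (rule can_gets)
  let ?F = "map fst prs @ map snd prs"
  show "known G V f" if "f \<in> set ?F" for f
    using that known by force
  show "can (?F @ G) V Q"
  proof (rule canI)
    fix I :: "nat list" and n m :: nat assume "length I = length (?F @ G)"
    define k where "k = length prs"
    define A where "A = take k I"
    define B where "B = take k (drop k I)"
    define J where "J = drop k (drop k I)"
    have I: "I = A @ B @ J" unfolding A_def B_def J_def by (simp only: append_take_drop_id)
    have len: "length A = k" "length B = k" "length J = length G"
      using \<open>length I = _\<close> by (auto simp: A_def B_def J_def k_def)
    obtain t where t: "\<And>w c. w \<in> V \<Longrightarrow> has_size (n + 2 * k) (m + k) c \<Longrightarrow> holds J G w c \<Longrightarrow>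
        \<forall>j<k. sticks c ! (m + j) = (fst (prs ! j) w, snd (prs ! j) w) \<Longrightarrow> run t (Q w) c"
      using step[OF len(3), of "n + 2 * k" m] unfolding k_def by blast
    have "run (lays (zip A B) t) (Q w) c"
      if "w \<in> V" and sz: "has_size n m c" and "holds I (?F @ G) w c" for w c
    proof -
      have hA: "holds A (map fst prs) w c" and hB: "holds B (map snd prs) w c" and hJ: "holds J G w c"
        using that(3) unfolding I by (simp_all add: holds_append len k_def)
      have A: "A ! j < length (points c) \<and> points c ! (A ! j) = fst (prs ! j) w" if "j < k" for j
        using holds_nth[OF hA, of j] that by (simp add: k_def)
      have B: "B ! j < length (points c) \<and> points c ! (B ! j) = snd (prs ! j) w" if "j < k" for j
        using holds_nth[OF hB, of j] that by (simp add: k_def)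
      have prs: "dist (fst (prs ! j) w) (snd (prs ! j) w) = 1" if "j < k" for j
        using unit[of "fst (prs ! j)" "snd (prs ! j)" w] \<open>w \<in> V\<close> that by (simp add: k_def)
      let ?ps = "concat (map (\<lambda>(i, j). [points c ! i, points c ! j]) (zip A B))"
      let ?ss = "map (\<lambda>(i, j). (points c ! i, points c ! j)) (zip A B)"
      have lps: "length ?ps = 2 * length L" if "L = zip A B" for L
        unfolding that by (induction "zip A B") (auto simp: length_concat o_def split_def sum_list_triv)
      have "run t (Q w) (add_objects c ?ps ?ss)"
      proof (rule t[OF \<open>w \<in> V\<close>])
        show "has_size (n + 2 * k) (m + k) (add_objects c ?ps ?ss)"
          using sz lps by (simp add: has_size_def add_objects_def len)
        show "holds J G w (add_objects c ?ps ?ss)"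
          using hJ by (rule holds_extends) (auto simp: extends_def)
        show "\<forall>j<k. sticks (add_objects c ?ps ?ss) ! (m + j) = (fst (prs ! j) w, snd (prs ! j) w)"
          using sz A B by (simp add: has_size_def add_objects_def nth_append len)
      qed
      then show ?thesis
        by (subst run_lays) (auto simp: in_set_zip len A B prs)
    qed
    then show "\<exists>t. \<forall>w\<in>V. \<forall>c. has_size n m c \<and> holds I (?F @ G) w c \<longrightarrow> run t (Q w) c"
      by blast
  qed
qed

abbreviation sits :: "nat \<Rightarrow> point \<Rightarrow> config \<Rightarrow> bool" where
  "sits i p c \<equiv> i < length (points c) \<and> points c ! i = p"

lemma can_two:
  assumes "known G V f" "known G V g"
    and "\<And>i j I n m. \<exists>t. \<forall>w\<in>V. \<forall>c. has_size n m c \<and> sits i (f w) c \<and> sits j (g w) c \<and>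
      holds I G w c \<longrightarrow> run t (Q w) c"
  shows "can G V Q"
proof (rule can_gets[of "[f, g]"], use assms(1,2) in force, rule canI)
  fix I :: "nat list" and n m :: nat assume "length I = length ([f, g] @ G)"
  then obtain i j J where I: "I = i # j # J" by (auto simp: length_Suc_conv)
  show "\<exists>t. \<forall>w\<in>V. \<forall>c. has_size n m c \<and> holds I ([f, g] @ G) w c \<longrightarrow> run t (Q w) c"
    using assms(3)[of n m i j J] unfolding I by (simp add: holds_def conj_assoc)
qed

lemma can_compare:
  assumes A: "known G V A" and B: "known G V B"
    and near: "can G {w \<in> V. dist (A w) (B w) \<le> 1} Q"
    and far: "can G {w \<in> V. dist (A w) (B w) > 1} Q"
  shows "can G V Q"
proof (rule can_two[OF A B])
  fix i j :: nat and I :: "nat list" and n m :: nat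
  obtain t1 where t1: "\<And>w c. w \<in> V \<Longrightarrow> dist (A w) (B w) \<le> 1 \<Longrightarrow> has_size n m c \<Longrightarrow> holds I G w c \<Longrightarrow>
      run t1 (Q w) c"
    using near unfolding can_def by (simp add: conj_assoc) metis
  obtain t2 where t2: "\<And>w c. w \<in> V \<Longrightarrow> dist (A w) (B w) > 1 \<Longrightarrow> has_size n m c \<Longrightarrow> holds I G w c \<Longrightarrow>
      run t2 (Q w) c"
    using far unfolding can_def by (simp add: conj_assoc) metis
  have "run (Node (Compare i j) (\<lambda>r. if r = Longer then t2 else t1)) (Q w) c"
    if "w \<in> V" "has_size n m c \<and> sits i (A w) c \<and> sits j (B w) c \<and> holds I G w c" for w c
    using that t1[of w c] t2[of w c] by (auto simp: Let_def)
  then show "\<exists>t. \<forall>w\<in>V. \<forall>c. has_size n m c \<and> sits i (A w) c \<and> sits j (B w) c \<and>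
      holds I G w c \<longrightarrow> run t (Q w) c"
    by blast
qed

lemma known_compare:
  assumes "known G V A" "known G V B"
    and "known G {w \<in> V. dist (A w) (B w) \<le> 1} f" "known G {w \<in> V. dist (A w) (B w) > 1} f"
  shows "known G V f"
  using assms unfolding known_def[of _ _ f] by (rule can_compare)

text \<open>With one extremity prescribed at \<open>A\<close>, the stick through \<open>B\<close> is determined, and so is its other
end.\<close>

lemma known_lay:
  assumes A: "known G V A" and B: "known G V B"
    and d: "\<And>w. w \<in> V \<Longrightarrow> A w \<noteq> B w \<and> dist (A w) (B w) \<le> 1"
  shows "known G V (\<lambda>w. A w + (B w - A w) /\<^sub>R dist (A w) (B w))"
  unfolding known_def
proof (rule can_two[OF A B])
  fix i j :: nat and I :: "nat list" and n m :: nat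
  let ?E = "\<lambda>w. A w + (B w - A w) /\<^sub>R dist (A w) (B w)"
  let ?Q = "\<lambda>w (k, n, m) c. has_size n m c \<and> k < n \<and> points c ! k = ?E w"
  have "run (Node (Lay i j True False) (\<lambda>_. Leaf (n + 1, n + 2, m + 1))) (?Q w) c"
    if "w \<in> V" and c: "has_size n m c \<and> sits i (A w) c \<and> sits j (B w) c \<and> holds I G w c" for w c
  proof -
    define a b where "a = A w" "b = B w"
    have ab: "a \<noteq> b" "dist a b \<le> 1" using d[OF \<open>w \<in> V\<close>] by (auto simp: a_b_def)
    let ?e = "a + (b - a) /\<^sub>R dist a b"
    have e1: "dist a ?e = 1"
      using ab(1) by (simp add: dist_norm norm_minus_commute)
    have "(1 - dist a b) *\<^sub>R a + dist a b *\<^sub>R ?e = a + (dist a b * inverse (dist a b)) *\<^sub>R (b - a)"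
      by (simp only: scaleR_add_right scaleR_scaleR scaleR_left_diff_distrib scaleR_one) simp
    also have "\<dots> = b" using ab(1) by simp
    finally have e2: "b \<in> closed_segment a ?e"
      unfolding in_segment using ab(2) by (intro exI[of _ "dist a b"]) simp
    have e3: "y = ?e" if y: "dist a y = 1" "b \<in> closed_segment a y" for y
    proof -
      obtain u where u: "0 \<le> u" "u \<le> 1" "b = (1 - u) *\<^sub>R a + u *\<^sub>R y"
        using y(2) by (auto simp: in_segment)
      then have bu: "b - a = u *\<^sub>R (y - a)" by (simp add: algebra_simps)
      then have "dist a b = u" using y(1) u(1) by (simp add: dist_norm norm_minus_commute[of a])
      with bu ab(1) show ?thesis by auto
    qed
    have P: "points c ! i = a" "points c ! j = b" "i < length (points c)" "j < length (points c)"
      using c by (auto simp: a_b_def)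
    have "results (Lay i j True False) c = {(Found 2, add_objects c [a', b'] [(a', b')]) | a' b'.
        dist a' b' = 1 \<and> {a, b} \<subseteq> closed_segment a' b' \<and> a' = a}"
      using P ab(1) by (simp add: stick_segment_def conj_ac)
    also have "\<dots> = {(Found 2, add_objects c [a, ?e] [(a, ?e)])}"
      using e1 e2 by (auto dest: e3)
    finally have R: "results (Lay i j True False) c = {(Found 2, add_objects c [a, ?e] [(a, ?e)])}" .
    have "?Q w (n + 1, n + 2, m + 1) (add_objects c [a, ?e] [(a, ?e)])"
      using c by (simp add: has_size_def add_objects_def nth_append a_b_def)
    then show ?thesis by (intro run_single[OF R]) simp
  qed
  then show "\<exists>t. \<forall>w\<in>V. \<forall>c. has_size n m c \<and> sits i (A w) c \<and> sits j (B w) c \<and>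
      holds I G w c \<longrightarrow> run t (?Q w) c"
    by blast
qed

lemma distinct_set_singleton: "distinct xs \<and> set xs = {x} \<longleftrightarrow> xs = [x]"
proof
  assume *: "distinct xs \<and> set xs = {x}"
  then obtain y ys where xs: "xs = y # ys" by (cases xs) auto
  have "y = x" using * xs by auto
  moreover have "ys = []" using * xs by (cases ys) auto
  ultimately show "xs = [x]" using xs by simp
qed simp

lemma known_meet:
  assumes "known G V A" "known G V B" "known G V C" "known G V D"
    and "\<And>w. w \<in> V \<Longrightarrow> dist (A w) (B w) = 1 \<and> dist (C w) (D w) = 1"
    and X: "\<And>w. w \<in> V \<Longrightarrow> closed_segment (A w) (B w) \<inter> closed_segment (C w) (D w) = {X w}"
  shows "known G V X"
  unfolding known_def
proof (rule can_sticks[of "[(A, B), (C, D)]"])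
  fix I :: "nat list" and n m :: nat
  let ?Q = "\<lambda>w (k, n, m) c. has_size n m c \<and> k < n \<and> points c ! k = X w"
  have "run (Node (Meet m (m + 1)) (\<lambda>_. Leaf (n, n + 1, m + 2))) (?Q w) c"
    if "w \<in> V" and c: "has_size n (m + 2) c" "sticks c ! m = (A w, B w)"
      "sticks c ! (m + 1) = (C w, D w)" for w c
  proof -
    have R: "results (Meet m (m + 1)) c = {(Found 1, add_objects c [X w] [])}"
      using c X[OF \<open>w \<in> V\<close>]
      by (auto simp: stick_segment_def has_size_def distinct_set_singleton)
    have "?Q w (n, n + 1, m + 2) (add_objects c [X w] [])"
      using c by (simp add: has_size_def add_objects_def nth_append)
    then show ?thesis by (intro run_single[OF R]) simp
  qed
  then show "\<exists>t. \<forall>w\<in>V. \<forall>c. has_size n (m + length [(A, B), (C, D)]) c \<and> holds I G w c \<and>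
      (\<forall>j<length [(A, B), (C, D)]. sticks c ! (m + j) =
        (fst ([(A, B), (C, D)] ! j) w, snd ([(A, B), (C, D)] ! j) w)) \<longrightarrow> run t (?Q w) c"
    by (intro exI[of _ "Node (Meet m (m + 1)) (\<lambda>_. Leaf (n, n + 1, m + 2))"])
      (simp add: All_less_Suc2 numeral_2_eq_2 del: run.simps)
qed (use assms in auto)

lemma known_ruler:
  assumes M: "known G V M" and "known G V A" "known G V B"
    and "\<And>w. w \<in> V \<Longrightarrow> dist (A w) (B w) = 1"
    and X: "\<And>w. w \<in> V \<Longrightarrow> {x \<in> closed_segment (A w) (B w). dist (M w) x = 1} = {X w}"
  shows "known G V X"
proof (rule known_get[OF M])
  let ?G = "M # G"
  show "known ?G V X"
    unfolding known_def
  proof (rule can_sticks[of "[(A, B)]"])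
    fix I :: "nat list" and n m :: nat assume "length I = length ?G"
    let ?Q = "\<lambda>w (k, n, m) c. has_size n m c \<and> k < n \<and> points c ! k = X w"
    let ?t = "Node (Ruler_on (I ! 0) [m]) (\<lambda>_. Leaf (n, n + 1, m + 1))"
    have "run ?t (?Q w) c"
      if "w \<in> V" and c: "has_size n (m + 1) c" "sticks c ! m = (A w, B w)" "holds I ?G w c" for w c
    proof -
      have i: "I ! 0 < length (points c)" "points c ! (I ! 0) = M w"
        using holds_nth[OF c(3), of 0] by auto
      have R: "results (Ruler_on (I ! 0) [m]) c = {(Found 1, add_objects c [X w] [])}"
        using c i X[OF \<open>w \<in> V\<close>]
        by (auto simp: stick_segment_def has_size_def distinct_set_singleton)
      have "?Q w (n, n + 1, m + 1) (add_objects c [X w] [])"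
        using c by (simp add: has_size_def add_objects_def nth_append)
      then show ?thesis by (intro run_single[OF R]) simp
    qed
    then show "\<exists>t. \<forall>w\<in>V. \<forall>c. has_size n (m + length [(A, B)]) c \<and> holds I ?G w c \<and>
        (\<forall>j<length [(A, B)]. sticks c ! (m + j) =
          (fst ([(A, B)] ! j) w, snd ([(A, B)] ! j) w)) \<longrightarrow> run t (?Q w) c"
      by (intro exI[of _ ?t]) (simp del: run.simps)
  qed (use assms(2-4) in \<open>auto intro: known_weaken[of G]\<close>)
qed

abbreviation lift :: "('w \<Rightarrow> point) list \<Rightarrow> ('w \<times> 'x \<Rightarrow> point) list" where
  "lift G \<equiv> map (\<lambda>f v. f (fst v)) G"

lemma known_lift:
  assumes "known G V f" "set (lift G) \<subseteq> set G'" "fst ` V' \<subseteq> V"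
  shows "known G' V' (\<lambda>v. f (fst v))"
  by (rule known_subst[OF assms(1)]) (use assms(2,3) in \<open>auto intro!: known_mem\<close>)

text \<open>An arbitrary choice makes the world richer by the point chosen. The goal \<open>Q\<close> refers to the old world
only, so that the final result cannot depend on the choice.\<close>

lemma can_arbitrary:
  assumes "can (snd # lift G) {(w, x). w \<in> V \<and> P w x} (\<lambda>v. Q (fst v))"
  shows "\<exists>t. \<forall>w\<in>V. \<forall>x. P w x \<longrightarrow> (\<forall>c. has_size n m c \<and> sits i x c \<and> holds I G w c \<longrightarrow> run t (Q w) c)"
proof -
  obtain t where t: "\<And>w x c. w \<in> V \<Longrightarrow> P w x \<Longrightarrow> has_size n m c \<Longrightarrow>
      holds (i # I) (snd # lift G) (w, x) c \<Longrightarrow> run t (Q w) c"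
    using assms unfolding can_def by (metis (mono_tags, lifting) case_prodI fst_conv mem_Collect_eq)
  have "holds (i # I) (snd # lift G) (w, x) c" if "sits i x c" "holds I G w c" for w x c
    using that by (simp add: holds_def list_all2_map2)
  then show ?thesis using t by blast
qed

lemma can_choose:
  assumes A: "known G V A" and B: "known G V B" and d: "\<And>w. w \<in> V \<Longrightarrow> dist (A w) (B w) = 1"
    and Q: "can (snd # lift G) {(w, x). w \<in> V \<and> x \<in> open_segment (A w) (B w)} (\<lambda>v. Q (fst v))"
  shows "can G V Q"
proof (rule can_sticks[of "[(A, B)]"])
  fix I :: "nat list" and n m :: nat
  obtain t where t: "\<And>w x c. w \<in> V \<Longrightarrow> x \<in> open_segment (A w) (B w) \<Longrightarrow> has_size (n + 1) (m + 1) c \<Longrightarrow>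
      sits n x c \<Longrightarrow> holds I G w c \<Longrightarrow> run t (Q w) c"
    using can_arbitrary[OF Q, of "n + 1" "m + 1" n I] by blast
  let ?t = "Node (Choose m True) (\<lambda>_. t)"
  have "run ?t (Q w) c"
    if "w \<in> V" and c: "has_size n (m + 1) c" "sticks c ! m = (A w, B w)" "holds I G w c" for w c
  proof -
    have R: "results (Choose m True) c =
        {(Found 1, add_objects c [x] []) | x. x \<in> open_segment (A w) (B w)}"
      using c by (auto simp: stick_segment_def has_size_def open_segment_def)
    have "A w \<noteq> B w" using d[OF \<open>w \<in> V\<close>] by auto
    then have ne: "open_segment (A w) (B w) \<noteq> {}" by simp
    have "run t (Q w) (add_objects c [x] [])" if "x \<in> open_segment (A w) (B w)" for x
      by (rule t[OF \<open>w \<in> V\<close> that])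
        (use c in \<open>auto simp: has_size_def add_objects_def nth_append extends_def
          intro: holds_extends[OF c(3), unfolded add_objects_def extends_def]\<close>)
    then show ?thesis using ne by (auto simp: R simp del: results.simps)
  qed
  then show "\<exists>t. \<forall>w\<in>V. \<forall>c. has_size n (m + length [(A, B)]) c \<and> holds I G w c \<and>
      (\<forall>j<length [(A, B)]. sticks c ! (m + j) =
        (fst ([(A, B)] ! j) w, snd ([(A, B)] ! j) w)) \<longrightarrow> run t (Q w) c"
    by (intro exI[of _ ?t]) (simp del: run.simps)
qed (use assms in auto)

text \<open>Prolonging a stick beyond its end: a stick laid from an arbitrary interior point \<open>x\<close> through \<open>M\<close> ends
at \<open>x + (M - A)\<close>, and a stick from \<open>M\<close> through that point ends at the reflection of \<open>A\<close> in \<open>M\<close>, no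
matter which \<open>x\<close> was chosen.\<close>

lemma known_extend:
  assumes A: "known G V A" and M: "known G V M" and d: "\<And>w. w \<in> V \<Longrightarrow> dist (A w) (M w) = 1"
  shows "known G V (\<lambda>w. M w + (M w - A w))"
  unfolding known_def
proof (rule can_choose[OF A M d])
  let ?V = "{(w, x). w \<in> V \<and> x \<in> open_segment (A w) (M w)}"
  let ?G = "snd # lift G"
  have x: "known ?G ?V snd" by (rule known_mem) simp
  have A': "known ?G ?V (\<lambda>v. A (fst v))" and M': "known ?G ?V (\<lambda>v. M (fst v))"
    by (rule known_lift[OF A] known_lift[OF M]; force)+
  have s: "\<exists>s. 0 < s \<and> s < 1 \<and> snd v = A (fst v) + s *\<^sub>R (M (fst v) - A (fst v))" if "v \<in> ?V" for v
    using that by (auto simp: in_segment algebra_simps)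
  have unit: "norm (M (fst v) - A (fst v)) = 1" if "v \<in> ?V" for v
    using that d by (auto simp: dist_norm norm_minus_commute)
  have E: "known ?G ?V (\<lambda>v. snd v + (M (fst v) - A (fst v)))"
  proof (rule known_cong[OF known_lay[OF x M']])
    fix v assume v: "v \<in> ?V"
    obtain s where s: "0 < s" "s < 1" "snd v = A (fst v) + s *\<^sub>R (M (fst v) - A (fst v))"
      using s[OF v] by blast
    have eq: "M (fst v) - snd v = (1 - s) *\<^sub>R (M (fst v) - A (fst v))"
      unfolding s(3) by (simp add: algebra_simps)
    have "dist (snd v) (M (fst v)) = norm (M (fst v) - snd v)"
      by (simp add: dist_norm norm_minus_commute)
    then have dist: "dist (snd v) (M (fst v)) = 1 - s"
      unfolding eq using s(1,2) unit[OF v] by simp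
    then show "snd v \<noteq> M (fst v) \<and> dist (snd v) (M (fst v)) \<le> 1"
      using s by auto
    show "snd v + (M (fst v) - snd v) /\<^sub>R dist (snd v) (M (fst v)) = snd v + (M (fst v) - A (fst v))"
      unfolding dist unfolding eq using s by simp
  qed
  have "known ?G ?V (\<lambda>v. M (fst v) + (M (fst v) - A (fst v)))"
  proof (rule known_cong[OF known_lay[OF M' E]])
    fix v assume v: "v \<in> ?V"
    obtain s where s: "0 < s" "s < 1" "snd v = A (fst v) + s *\<^sub>R (M (fst v) - A (fst v))"
      using s[OF v] by blast
    have eq: "snd v + (M (fst v) - A (fst v)) - M (fst v) = s *\<^sub>R (M (fst v) - A (fst v))"
      unfolding s(3) by (simp add: algebra_simps)
    have "dist (M (fst v)) (snd v + (M (fst v) - A (fst v))) =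
        norm (snd v + (M (fst v) - A (fst v)) - M (fst v))"
      by (simp only: dist_norm norm_minus_commute)
    then have dist: "dist (M (fst v)) (snd v + (M (fst v) - A (fst v))) = s"
      unfolding eq using s(1,2) unit[OF v] by simp
    then show "M (fst v) \<noteq> snd v + (M (fst v) - A (fst v)) \<and>
        dist (M (fst v)) (snd v + (M (fst v) - A (fst v))) \<le> 1"
      using s by auto
    show "M (fst v) + (snd v + (M (fst v) - A (fst v)) - M (fst v)) /\<^sub>R
        dist (M (fst v)) (snd v + (M (fst v) - A (fst v))) = M (fst v) + (M (fst v) - A (fst v))"
      unfolding dist unfolding eq using s by simp
  qed
  then show "can ?G ?V (\<lambda>v. (\<lambda>(k, n, m) c. has_size n m c \<and> k < n \<and>
      points c ! k = M (fst v) + (M (fst v) - A (fst v))))"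
    unfolding known_def .
qed

lemma can_ruler_off:
  assumes P: "known G V P" and sticks: "\<And>A B. (A, B) \<in> set prs \<Longrightarrow> known G V A \<and> known G V B"
    "\<And>A B w. (A, B) \<in> set prs \<Longrightarrow> w \<in> V \<Longrightarrow> dist (A w) (B w) = 1"
    and ne: "\<And>w. w \<in> V \<Longrightarrow> \<exists>x. dist (P w) x = 1 \<and>
      x \<notin> (\<Union>j<length prs. closed_segment (fst (prs ! j) w) (snd (prs ! j) w))"
    and Q: "can (snd # lift G) {(w, x). w \<in> V \<and> dist (P w) x = 1 \<and>
      x \<notin> (\<Union>j<length prs. closed_segment (fst (prs ! j) w) (snd (prs ! j) w))} (\<lambda>v. Q (fst v))"
  shows "can G V Q"
proof (rule can_get[OF P], rule can_sticks[of prs])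
  fix I :: "nat list" and n m :: nat assume "length I = length (P # G)"
  then obtain i J where I: "I = i # J" by (cases I) auto
  define S where "S = (\<lambda>w. \<Union>j<length prs. closed_segment (fst (prs ! j) w) (snd (prs ! j) w))"
  have Q': "can (snd # lift G) {(w, x). w \<in> V \<and> (dist (P w) x = 1 \<and> x \<notin> S w)} (\<lambda>v. Q (fst v))"
    using Q unfolding S_def .
  obtain t where t: "\<And>w x c. w \<in> V \<Longrightarrow> dist (P w) x = 1 \<and> x \<notin> S w \<Longrightarrow>
      has_size (n + 1) (m + length prs) c \<Longrightarrow> sits n x c \<Longrightarrow> holds J G w c \<Longrightarrow> run t (Q w) c"
    using can_arbitrary[OF Q', of "n + 1" "m + length prs" n J] by blast
  let ?t = "Node (Ruler_off i [m..<m + length prs]) (\<lambda>_. t)"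
  have "run ?t (Q w) c"
    if "w \<in> V" and c: "has_size n (m + length prs) c" "holds I (P # G) w c"
      "\<forall>j<length prs. sticks c ! (m + j) = (fst (prs ! j) w, snd (prs ! j) w)" for w c
  proof -
    have i: "i < length (points c)" "points c ! i = P w" and J: "holds J G w c"
      using c(2) by (auto simp: I holds_def)
    have "{m..<m + length prs} = (\<lambda>j. m + j) ` {..<length prs}"
      by (simp add: lessThan_atLeast0 image_add_atLeastLessThan add.commute)
    then have "(\<Union>s\<in>set [m..<m + length prs]. stick_segment (sticks c ! s)) = S w"
      using c(3) by (auto simp: S_def stick_segment_def)
    then have R: "results (Ruler_off i [m..<m + length prs]) c =
        {(Found 1, add_objects c [x] []) | x. dist (P w) x = 1 \<and> x \<notin> S w}"
      using i c(1) by (auto simp: has_size_def)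
    have "run t (Q w) (add_objects c [x] [])" if "dist (P w) x = 1 \<and> x \<notin> S w" for x
      by (rule t[OF \<open>w \<in> V\<close> that])
        (use c(1) in \<open>auto simp: has_size_def add_objects_def nth_append extends_def
          intro: holds_extends[OF J, unfolded add_objects_def extends_def]\<close>)
    then show ?thesis using ne[OF \<open>w \<in> V\<close>] by (auto simp: R S_def simp del: results.simps)
  qed
  then show "\<exists>t. \<forall>w\<in>V. \<forall>c. has_size n (m + length prs) c \<and> holds I (P # G) w c \<and>
      (\<forall>j<length prs. sticks c ! (m + j) = (fst (prs ! j) w, snd (prs ! j) w)) \<longrightarrow> run t (Q w) c"
    by blast
qed (use sticks in \<open>auto intro: known_weaken[of G]\<close>)

text \<open>The two points come in an unspecified order, which is therefore part of the new world.\<close>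

lemma can_ruler_two:
  fixes prs :: "(('w \<Rightarrow> point) \<times> ('w \<Rightarrow> point)) list"
  defines "S \<equiv> (\<lambda>M w. {x \<in> (\<Union>j<length prs. closed_segment (fst (prs ! j) w) (snd (prs ! j) w)). dist (M w) x = 1})"
  assumes M: "known G V M" and sticks: "\<And>A B. (A, B) \<in> set prs \<Longrightarrow> known G V A \<and> known G V B"
    "\<And>A B w. (A, B) \<in> set prs \<Longrightarrow> w \<in> V \<Longrightarrow> dist (A w) (B w) = 1"
    and two: "\<And>w. w \<in> V \<Longrightarrow> \<exists>a b. a \<noteq> b \<and> S M w = {a, b}"
    and Q: "can ((\<lambda>v. fst (snd v)) # (\<lambda>v. snd (snd v)) # lift G)
      {(w, a, b). w \<in> V \<and> a \<noteq> b \<and> S M w = {a, b}} (\<lambda>v. Q (fst v))"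
  shows "can G V Q"
proof (rule can_get[OF M], rule can_sticks[of prs])
  fix I :: "nat list" and n m :: nat assume "length I = length (M # G)"
  then obtain i J where I: "I = i # J" by (cases I) auto
  let ?G = "(\<lambda>v. fst (snd v)) # (\<lambda>v. snd (snd v)) # lift G"
  obtain t where t0: "\<forall>v\<in>{(w, a, b). w \<in> V \<and> a \<noteq> b \<and> S M w = {a, b}}. \<forall>c.
      has_size (n + 2) (m + length prs) c \<and> holds (n # (n + 1) # J) ?G v c \<longrightarrow> run t (Q (fst v)) c"
    using Q unfolding can_def by blast
  have t: "run t (Q w) c" if "w \<in> V" "a \<noteq> b" "S M w = {a, b}"
    "has_size (n + 2) (m + length prs) c" "holds (n # (n + 1) # J) ?G (w, a, b) c" for w a b c
    using bspec[OF t0, of "(w, a, b)"] that by simp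
  let ?i = "Ruler_on i [m..<m + length prs]"
  have "run (Node ?i (\<lambda>_. t)) (Q w) c"
    if "w \<in> V" and c: "has_size n (m + length prs) c" "holds I (M # G) w c"
      "\<forall>j<length prs. sticks c ! (m + j) = (fst (prs ! j) w, snd (prs ! j) w)" for w c
  proof -
    have i: "i < length (points c)" "points c ! i = M w" and J: "holds J G w c"
      using c(2) by (auto simp: I holds_def)
    obtain a b where ab: "a \<noteq> b" "S M w = {a, b}" using two[OF \<open>w \<in> V\<close>] by blast
    have "{m..<m + length prs} = (\<lambda>j. m + j) ` {..<length prs}"
      by (simp add: lessThan_atLeast0 image_add_atLeastLessThan add.commute)
    then have "{x \<in> (\<Union>s\<in>set [m..<m + length prs]. stick_segment (sticks c ! s)).
        dist (points c ! i) x = 1} = S M w"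
      using c(3) i by (auto simp: S_def stick_segment_def)
    then have R: "results ?i c = {(Found (length xs), add_objects c xs []) | xs. distinct xs \<and> set xs = {a, b}}"
      using i c(1) ab(2) by (auto simp: has_size_def)
    have xs: "\<exists>x y. xs = [x, y] \<and> x \<noteq> y \<and> {x, y} = {a, b}" if "distinct xs" "set xs = {a, b}" for xs
    proof -
      have "length xs = 2" using that ab(1) distinct_card[OF that(1)] by simp
      then show ?thesis using that by (auto simp: length_Suc_conv numeral_2_eq_2)
    qed
    have "run t (Q w) (add_objects c [x, y] [])" if "x \<noteq> y" "{x, y} = {a, b}" for x y
    proof (rule t[OF \<open>w \<in> V\<close>])
      show "x \<noteq> y" "S M w = {x, y}" using that ab by auto
      show "has_size (n + 2) (m + length prs) (add_objects c [x, y] [])"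
        using c(1) by (simp add: has_size_def add_objects_def)
      have "holds J G w (add_objects c [x, y] [])"
        by (rule holds_extends[OF J]) (auto simp: extends_def)
      then show "holds (n # (n + 1) # J) ?G (w, x, y)
          (add_objects c [x, y] [])"
        using c(1) by (simp add: holds_def list_all2_map2 add_objects_def has_size_def nth_append)
    qed
    note t' = this
    show ?thesis unfolding run.simps
    proof (intro conjI allI impI)
      show "results ?i c \<noteq> {}"
        unfolding R using ab(1) by (intro notI) (auto dest!: spec[of _ "[a, b]"])
    next
      fix r c' assume "(r, c') \<in> results ?i c"
      then obtain zs where zs: "distinct zs" "set zs = {a, b}" "c' = add_objects c zs []"
        unfolding R by blast
      then show "run t (Q w) c'" using xs[OF zs(1,2)] t' by blast
    qed
  qed
  then show "\<exists>t. \<forall>w\<in>V. \<forall>c. has_size n (m + length prs) c \<and> holds I (M # G) w c \<and>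
      (\<forall>j<length prs. sticks c ! (m + j) = (fst (prs ! j) w, snd (prs ! j) w)) \<longrightarrow> run t (Q w) c"
    by blast
qed (use sticks in \<open>auto intro: known_weaken[of G]\<close>)

section \<open>Searching through countably many guesses\<close>

primrec glue :: "construction tree \<Rightarrow> construction" where
  "glue (Leaf K) = K"
| "glue (Node i f) = Step i (\<lambda>r. glue (f r))"

lemma constructs_glue: "run t (\<lambda>K c'. constructs T K c') c \<Longrightarrow> constructs T (glue t) c"
  by (induction t arbitrary: c) (auto intro: constructs.step)

type_synonym answer = "nat list + nat \<times> nat"

text \<open>The outcome of trying one guess: either the indices of the points to be named, or the request for
the next guess, which is not allowed if the present one is good for the world.\<close>

definition answers :: "('w \<Rightarrow> point set) \<Rightarrow> ('w \<Rightarrow> bool) \<Rightarrow> 'w \<Rightarrow> answer \<Rightarrow> config \<Rightarrow> bool" where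
  "answers T good w l c \<longleftrightarrow> (case l of
      Inl ns \<Rightarrow> (\<forall>n\<in>set ns. n < length (points c)) \<and> (\<lambda>n. points c ! n) ` set ns = T w
    | Inr (n, m) \<Rightarrow> has_size n m c \<and> \<not> good w)"

text \<open>The comparison of a point with itself between two attempts has no effect; it makes the definition
productive even if an attempt consists of no step at all.\<close>

primcorec search :: "(nat \<Rightarrow> nat \<times> nat \<Rightarrow> answer tree) \<Rightarrow> nat \<Rightarrow> answer tree \<Rightarrow> construction" where
  "search B g t = (case t of
      Leaf l \<Rightarrow> (case l of
          Inl ns \<Rightarrow> Finish ns
        | Inr nm \<Rightarrow> Step (Compare 0 0) (\<lambda>_. search B (Suc g) (B (Suc g) nm)))
    | Node i f \<Rightarrow> Step i (\<lambda>r. search B g (f r)))"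

lemma search_Inl: "search B g (Leaf (Inl ns)) = Finish ns"
  and search_Inr: "search B g (Leaf (Inr nm)) =
    Step (Compare 0 0) (\<lambda>_. search B (Suc g) (B (Suc g) nm))"
  and search_Node: "search B g (Node i f) = Step i (\<lambda>r. search B g (f r))"
  by (subst search.code; simp)+

lemma constructs_search:
  assumes B: "\<And>g n m c. has_size n m c \<Longrightarrow> holds I G w c \<Longrightarrow> run (B g (n, m)) (answers T (good g) w) c"
    and I: "G \<noteq> []" and good: "good g0 w"
  shows "g \<le> g0 \<Longrightarrow> holds I G w c \<Longrightarrow> run t (answers T (good g) w) c \<Longrightarrow>
    constructs (T w) (search B g t) c"
proof (induction "g0 - g" arbitrary: g t c)
  case (0 g t c)
  then have [simp]: "g = g0" by simp
  \<comment> \<open>The present guess is good, so no leaf can ask for the next one.\<close>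
  from 0(3,4) show ?case
  proof (induction t arbitrary: c)
    case (Leaf l)
    then show ?case using good
      by (auto simp: answers_def search_Inl split: sum.splits intro: constructs.finish)
  next
    case (Node i f)
    show ?case unfolding search_Node
      by (rule constructs.step) (use Node in \<open>auto intro: holds_extends results_extends\<close>)
  qed
next
  case (Suc k g t c)
  from Suc(4,5) show ?case
  proof (induction t arbitrary: c)
    case (Leaf l)
    show ?case
    proof (cases l)
      case (Inl ns)
      then show ?thesis using Leaf
        by (auto simp: answers_def search_Inl intro: constructs.finish)
    next
      case (Inr nm)
      obtain n m where nm: "nm = (n, m)" by (cases nm)
      have sz: "has_size n m c" using Leaf by (simp add: Inr nm answers_def)
      have "0 < length G" using I by simp
      then have "points c \<noteq> []" using holds_nth[OF Leaf(1), of 0] by auto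
      then have R: "results (Compare 0 0) c = {(Shorter, c)}" by simp
      have "constructs (T w) (search B (Suc g) (B (Suc g) (n, m))) c"
        by (rule Suc.hyps(1)) (use Suc.hyps(2) Leaf(1) B[OF sz] in auto)
      then show ?thesis unfolding Inr search_Inr nm
        by (intro constructs.step) (auto simp: R simp del: results.simps)
    qed
  next
    case (Node i f)
    show ?case unfolding search_Node
      by (rule constructs.step) (use Node in \<open>auto intro: holds_extends results_extends\<close>)
  qed
qed

text \<open>The only source of unbounded constructions. In the world \<open>w\<close> the search ends not later than with the
first guess that is good for \<open>w\<close>, but no bound holds for all worlds together.\<close>

theorem can_search:
  assumes B: "\<And>g. can G V (answers T (good g))"
    and G: "G \<noteq> []" and good: "\<And>w. w \<in> V \<Longrightarrow> \<exists>g::nat. good g w"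
  shows "can G V (\<lambda>w K c. constructs (T w) K c)"
proof (rule canI)
  fix I :: "nat list" and n m :: nat
  have "\<forall>g nm. \<exists>t. \<forall>w\<in>V. \<forall>c. has_size (fst nm) (snd nm) c \<and> holds I G w c \<longrightarrow>
      run t (answers T (good g) w) c"
    using B unfolding can_def by blast
  then obtain t where t: "\<And>g nm w c. w \<in> V \<Longrightarrow> has_size (fst nm) (snd nm) c \<Longrightarrow> holds I G w c \<Longrightarrow>
      run (t g nm) (answers T (good g) w) c"
    by metis
  have "constructs (T w) (search t 0 (t 0 (n, m))) c"
    if w: "w \<in> V" and c: "has_size n m c" "holds I G w c" for w c
  proof -
    obtain g where g: "good g w" using good[OF w] by blast
    show ?thesis
      by (rule constructs_search[of I G w t T good g]) (use t[OF w] c G g in auto)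
  qed
  then show "\<exists>t. \<forall>w\<in>V. \<forall>c. has_size n m c \<and> holds I G w c \<longrightarrow>
      run t (\<lambda>K c. constructs (T w) K c) c"
    by (intro exI[of _ "Leaf (search t 0 (t 0 (n, m)))"]) simp
qed

lemma can_give_up:
  assumes "\<And>w. w \<in> V \<Longrightarrow> \<not> good w"
  shows "can G V (answers T good)"
proof (rule canI)
  fix I :: "nat list" and n m :: nat
  show "\<exists>t. \<forall>w\<in>V. \<forall>c. has_size n m c \<and> holds I G w c \<longrightarrow> run t (answers T good w) c"
    by (rule exI[of _ "Leaf (Inr (n, m))"]) (use assms in \<open>auto simp: answers_def\<close>)
qed

lemma can_answer_empty:
  assumes "\<And>w. w \<in> V \<Longrightarrow> T w = {}"
  shows "can G V (answers T good)"
proof (rule canI)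
  fix I :: "nat list" and n m :: nat
  show "\<exists>t. \<forall>w\<in>V. \<forall>c. has_size n m c \<and> holds I G w c \<longrightarrow> run t (answers T good w) c"
    by (rule exI[of _ "Leaf (Inl [])"]) (use assms in \<open>auto simp: answers_def\<close>)
qed

lemma can_answer_two:
  assumes "known G V f" "known G V g" and "\<And>w. w \<in> V \<Longrightarrow> T w = {f w, g w}"
  shows "can G V (answers T good)"
proof (rule can_two[OF assms(1,2)])
  fix i j :: nat and I :: "nat list" and n m :: nat
  show "\<exists>t. \<forall>w\<in>V. \<forall>c. has_size n m c \<and> sits i (f w) c \<and> sits j (g w) c \<and> holds I G w c \<longrightarrow>
      run t (answers T good w) c"
    by (rule exI[of _ "Leaf (Inl [i, j])"]) (use assms(3) in \<open>auto simp: answers_def\<close>)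
qed

section \<open>Coordinates\<close>

text \<open>The stick laid from \<open>(a, b)\<close> through \<open>(c, d)\<close> reaches the point \<open>(x, y)\<close>: the factor \<open>s\<close> is
measured in units of the distance from \<open>(a, b)\<close> to \<open>(c, d)\<close>, and the point may lie beyond \<open>(c, d)\<close>.\<close>

definition reaches :: "real \<Rightarrow> real \<Rightarrow> real \<Rightarrow> real \<Rightarrow> real \<Rightarrow> real \<Rightarrow> real \<Rightarrow> bool" where
  "reaches a b c d x y s \<longleftrightarrow> 0 \<le> s \<and> x = a + s * (c - a) \<and> y = b + s * (d - b) \<and>
    s\<^sup>2 * ((c - a)\<^sup>2 + (d - b)\<^sup>2) \<le> 1"

text \<open>Used for a stick from \<open>(a, b)\<close> to \<open>(c, d)\<close> and a point \<open>(x, y)\<close> on it that lies on the unit circle about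
\<open>(p, q)\<close>. The line meets that circle for the second time at the parameter \<open>s + 2 * k\<close>, where \<open>k\<close> is the
projection of the radius onto the stick. The condition says that this second point either coincides
with the first (tangency) or misses the stick.\<close>

definition only_hit ::
  "real \<Rightarrow> real \<Rightarrow> real \<Rightarrow> real \<Rightarrow> real \<Rightarrow> real \<Rightarrow> real \<Rightarrow> real \<Rightarrow> real \<Rightarrow> bool" where
  "only_hit p q a b c d x y s \<longleftrightarrow> 0 \<le> s \<and> s \<le> 1 \<and> x = a + s * (c - a) \<and> y = b + s * (d - b) \<and>
    (let k = (p - x) * (c - a) + (q - y) * (d - b) in k = 0 \<or> s + 2 * k < 0 \<or> s + 2 * k > 1)"

locale frame =
  fixes G :: "('w \<Rightarrow> point) list" and V :: "'w set" and Or u v :: "'w \<Rightarrow> point"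
  assumes norm_u: "w \<in> V \<Longrightarrow> norm (u w) = 1"
    and norm_v: "w \<in> V \<Longrightarrow> norm (v w) = 1"
    and orth: "w \<in> V \<Longrightarrow> inner (u w) (v w) = 0"
begin

text \<open>The point with coordinates \<open>x\<close> and \<open>y\<close> in the frame of the world \<open>w\<close>; \<open>Pt x y\<close> says that it is
known, where the coordinates may themselves depend on the world.\<close>

definition F :: "'w \<Rightarrow> real \<Rightarrow> real \<Rightarrow> point" where
  "F w x y = Or w + x *\<^sub>R u w + y *\<^sub>R v w"

definition Pt :: "('w \<Rightarrow> real) \<Rightarrow> ('w \<Rightarrow> real) \<Rightarrow> bool" where
  "Pt x y \<longleftrightarrow> known G V (\<lambda>w. F w (x w) (y w))"

abbreviation Point :: "real \<Rightarrow> real \<Rightarrow> bool" where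
  "Point a b \<equiv> Pt (\<lambda>_. a) (\<lambda>_. b)"

lemma dist_F: "w \<in> V \<Longrightarrow> dist (F w x y) (F w x' y') = sqrt ((x - x')\<^sup>2 + (y - y')\<^sup>2)"
proof -
  assume w: "w \<in> V"
  have "F w x y - F w x' y' = (x - x') *\<^sub>R u w + (y - y') *\<^sub>R v w"
    by (simp add: F_def algebra_simps)
  then have "dist (F w x y) (F w x' y') = sqrt (inner ((x - x') *\<^sub>R u w + (y - y') *\<^sub>R v w) ((x - x') *\<^sub>R u w + (y - y') *\<^sub>R v w))"
    by (simp only: dist_norm norm_eq_sqrt_inner)
  moreover have "inner (u w) (u w) = 1" "inner (v w) (v w) = 1" "inner (v w) (u w) = 0"
    using norm_u[OF w] norm_v[OF w] orth[OF w] by (simp_all add: norm_eq_1 inner_commute)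
  ultimately show ?thesis
    using orth[OF w] by (simp add: inner_add_left inner_add_right power2_eq_square)
qed

lemma dist_F_1: "w \<in> V \<Longrightarrow> dist (F w x y) (F w x' y') = 1 \<longleftrightarrow> (x - x')\<^sup>2 + (y - y')\<^sup>2 = 1"
  by (simp add: dist_F)

lemma F_inj: "w \<in> V \<Longrightarrow> F w x y = F w x' y' \<longleftrightarrow> x = x' \<and> y = y'"
proof -
  assume w: "w \<in> V"
  have "F w x y = F w x' y' \<longleftrightarrow> (x - x')\<^sup>2 + (y - y')\<^sup>2 = 0"
    using dist_F[OF w, of x y x' y'] by (metis dist_eq_0_iff real_sqrt_eq_zero_cancel_iff)
  then show ?thesis by (simp add: sum_power2_eq_zero_iff)
qed

lemma F_affine:
  "F w a b + s *\<^sub>R (F w c d - F w a b) = F w (a + s * (c - a)) (b + s * (d - b))"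
  by (simp add: F_def algebra_simps)

lemma mem_segment_F:
  "p \<in> closed_segment (F w a b) (F w c d) \<longleftrightarrow>
    (\<exists>s. 0 \<le> s \<and> s \<le> 1 \<and> p = F w (a + s * (c - a)) (b + s * (d - b)))"
proof -
  have "(1 - s) *\<^sub>R F w a b + s *\<^sub>R F w c d = F w (a + s * (c - a)) (b + s * (d - b))" for s
    by (simp add: F_def algebra_simps)
  then show ?thesis by (simp add: in_segment)
qed

lemma Pt_cong: "Pt x y \<Longrightarrow> (\<And>w. w \<in> V \<Longrightarrow> x w = x' w \<and> y w = y' w) \<Longrightarrow> Pt x' y'"
  unfolding Pt_def by (erule known_cong) simp

lemma Pt_lay:
  assumes A: "Pt a b" and B: "Pt c d"
    and r: "\<And>w. w \<in> V \<Longrightarrow> 0 < r w \<and> r w \<le> 1 \<and> (c w - a w)\<^sup>2 + (d w - b w)\<^sup>2 = (r w)\<^sup>2"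
  shows "Pt (\<lambda>w. a w + (c w - a w) / r w) (\<lambda>w. b w + (d w - b w) / r w)"
proof -
  have D: "dist (F w (a w) (b w)) (F w (c w) (d w)) = r w" if "w \<in> V" for w
    using r[OF that] by (simp add: dist_F[OF that] power2_commute[of "a w"] power2_commute[of "b w"])
  show ?thesis
    unfolding Pt_def
  proof (rule known_cong[OF known_lay[OF A[unfolded Pt_def] B[unfolded Pt_def]]])
    fix w assume w: "w \<in> V"
    show "F w (a w) (b w) \<noteq> F w (c w) (d w) \<and> dist (F w (a w) (b w)) (F w (c w) (d w)) \<le> 1"
      using D[OF w] r[OF w] by auto
    show "F w (a w) (b w) + (F w (c w) (d w) - F w (a w) (b w)) /\<^sub>R dist (F w (a w) (b w)) (F w (c w) (d w))
       = F w (a w + (c w - a w) / r w) (b w + (d w - b w) / r w)"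
      unfolding D[OF w] F_affine by (simp add: divide_inverse mult.commute)
  qed
qed

lemma Pt_extend:
  assumes A: "Pt a b" and M: "Pt c d"
    and r: "\<And>w. w \<in> V \<Longrightarrow> (a w - c w)\<^sup>2 + (b w - d w)\<^sup>2 = 1"
  shows "Pt (\<lambda>w. 2 * c w - a w) (\<lambda>w. 2 * d w - b w)"
  unfolding Pt_def
proof (rule known_cong[OF known_extend[OF A[unfolded Pt_def] M[unfolded Pt_def]]])
  fix w assume w: "w \<in> V"
  show "dist (F w (a w) (b w)) (F w (c w) (d w)) = 1" using r[OF w] by (simp add: dist_F_1[OF w])
  have "2 * c w - a w = c w + (c w - a w)" "2 * d w - b w = d w + (d w - b w)" by simp_all
  then show "F w (c w) (d w) + (F w (c w) (d w) - F w (a w) (b w)) = F w (2 * c w - a w) (2 * d w - b w)"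
    by (simp only: F_def scaleR_add_left scaleR_diff_left) simp
qed

text \<open>The ruler returns all hits on a stick in unknown order; a point is determined if it is the only
one.\<close>

lemma Pt_ruler:
  assumes M: "Pt p q" and A: "Pt a b" and B: "Pt c d"
    and unit: "\<And>w. w \<in> V \<Longrightarrow> (c w - a w)\<^sup>2 + (d w - b w)\<^sup>2 = 1"
    and on_circle: "\<And>w. w \<in> V \<Longrightarrow> (x w - p w)\<^sup>2 + (y w - q w)\<^sup>2 = 1"
    and on_stick: "\<And>w. w \<in> V \<Longrightarrow>
      \<exists>s. only_hit (p w) (q w) (a w) (b w) (c w) (d w) (x w) (y w) s"
  shows "Pt x y"
  unfolding Pt_def
proof (rule known_ruler[OF M[unfolded Pt_def] A[unfolded Pt_def] B[unfolded Pt_def]])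
  fix w assume w: "w \<in> V"
  show "dist (F w (a w) (b w)) (F w (c w) (d w)) = 1"
    using unit[OF w] by (simp add: dist_F_1[OF w] power2_commute[of "a w"] power2_commute[of "b w"])
  obtain s where s: "0 \<le> s" "s \<le> 1" "x w = a w + s * (c w - a w)" "y w = b w + s * (d w - b w)"
    and k: "let k = (p w - x w) * (c w - a w) + (q w - y w) * (d w - b w) in
        k = 0 \<or> s + 2 * k < 0 \<or> s + 2 * k > 1"
    using on_stick[OF w] unfolding only_hit_def by blast
  have uniq: "s' = s" if s': "0 \<le> s'" "s' \<le> 1"
    "dist (F w (p w) (q w)) (F w (a w + s' * (c w - a w)) (b w + s' * (d w - b w))) = 1" for s'
  proof -
    define e f where "e = c w - a w" and "f = d w - b w"
    define X Y where "X = p w - x w" and "Y = q w - y w"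
    have ef: "e\<^sup>2 + f\<^sup>2 = 1" using unit[OF w] by (simp add: e_def f_def)
    have XY: "X\<^sup>2 + Y\<^sup>2 = 1"
      using on_circle[OF w] by (simp add: X_def Y_def power2_commute)
    have "(p w - (a w + s' * e))\<^sup>2 + (q w - (b w + s' * f))\<^sup>2 = 1"
      using s'(3) by (simp add: dist_F_1[OF w] e_def f_def)
    moreover have "p w - (a w + s' * e) = X - (s' - s) * e" "q w - (b w + s' * f) = Y - (s' - s) * f"
      using s(3,4) by (simp_all add: X_def Y_def e_def f_def algebra_simps)
    ultimately have "(X - (s' - s) * e)\<^sup>2 + (Y - (s' - s) * f)\<^sup>2 = 1" by simp
    then have "(s' - s) * ((s' - s) * (e\<^sup>2 + f\<^sup>2) - 2 * (X * e + Y * f)) = 1 - (X\<^sup>2 + Y\<^sup>2)"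
      by (simp add: power2_eq_square algebra_simps)
    then have "s' = s \<or> s' = s + 2 * (X * e + Y * f)"
      unfolding ef XY by auto
    moreover have "X * e + Y * f = 0 \<or> s + 2 * (X * e + Y * f) < 0 \<or> s + 2 * (X * e + Y * f) > 1"
      using k by (simp add: Let_def X_def Y_def e_def f_def)
    ultimately show ?thesis using s'(1,2) by auto
  qed
  have on: "dist (F w (p w) (q w)) (F w (x w) (y w)) = 1"
    using on_circle[OF w] by (simp add: dist_F_1[OF w] power2_commute)
  show "{z \<in> closed_segment (F w (a w) (b w)) (F w (c w) (d w)). dist (F w (p w) (q w)) z = 1} =
      {F w (x w) (y w)}"
  proof (intro set_eqI iffI)
    fix z assume "z \<in> {z \<in> closed_segment (F w (a w) (b w)) (F w (c w) (d w)). dist (F w (p w) (q w)) z = 1}"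
    then obtain s' where "0 \<le> s'" "s' \<le> 1" "z = F w (a w + s' * (c w - a w)) (b w + s' * (d w - b w))"
      "dist (F w (p w) (q w)) z = 1"
      unfolding mem_segment_F by blast
    with uniq s(3,4) show "z \<in> {F w (x w) (y w)}" by simp
  next
    fix z assume "z \<in> {F w (x w) (y w)}"
    then have z: "z = F w (x w) (y w)" by simp
    then have "z = F w (a w + s * (c w - a w)) (b w + s * (d w - b w))" unfolding s(3,4) .
    then have "z \<in> closed_segment (F w (a w) (b w)) (F w (c w) (d w))"
      unfolding mem_segment_F using s(1,2) by blast
    then show "z \<in> {z \<in> closed_segment (F w (a w) (b w)) (F w (c w) (d w)). dist (F w (p w) (q w)) z = 1}"
      using on z by simp
  qed
qed

lemma Pt_cross:
  assumes A: "Pt a1 a2" and B: "Pt b1 b2" and C: "Pt c1 c2" and D: "Pt d1 d2"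
    and len: "\<And>w. w \<in> V \<Longrightarrow> (b1 w - a1 w)\<^sup>2 + (b2 w - a2 w)\<^sup>2 \<le> 1"
      "\<And>w. w \<in> V \<Longrightarrow> (d1 w - c1 w)\<^sup>2 + (d2 w - c2 w)\<^sup>2 \<le> 1"
    and not_parallel:
      "\<And>w. w \<in> V \<Longrightarrow> (b1 w - a1 w) * (d2 w - c2 w) \<noteq> (b2 w - a2 w) * (d1 w - c1 w)"
    and cond: "\<And>w. w \<in> V \<Longrightarrow> \<exists>s t. reaches (a1 w) (a2 w) (b1 w) (b2 w) (x w) (y w) s \<and>
      reaches (c1 w) (c2 w) (d1 w) (d2 w) (x w) (y w) t"
  shows "Pt x y"
proof -
  define r where "r = (\<lambda>w. sqrt ((b1 w - a1 w)\<^sup>2 + (b2 w - a2 w)\<^sup>2))"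
  define r' where "r' = (\<lambda>w. sqrt ((d1 w - c1 w)\<^sup>2 + (d2 w - c2 w)\<^sup>2))"
  have r: "0 < r w \<and> r w \<le> 1 \<and> (b1 w - a1 w)\<^sup>2 + (b2 w - a2 w)\<^sup>2 = (r w)\<^sup>2" if "w \<in> V" for w
  proof -
    have "b1 w - a1 w \<noteq> 0 \<or> b2 w - a2 w \<noteq> 0"
      using not_parallel[OF that] by (metis mult_zero_left)
    then have "0 < (b1 w - a1 w)\<^sup>2 + (b2 w - a2 w)\<^sup>2"
      by (simp only: sum_power2_gt_zero_iff)
    with len(1)[OF that] show ?thesis unfolding r_def by simp
  qed
  have r': "0 < r' w \<and> r' w \<le> 1 \<and> (d1 w - c1 w)\<^sup>2 + (d2 w - c2 w)\<^sup>2 = (r' w)\<^sup>2" if "w \<in> V" for w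
  proof -
    have "d1 w - c1 w \<noteq> 0 \<or> d2 w - c2 w \<noteq> 0"
      using not_parallel[OF that] by (metis mult_zero_right)
    then have "0 < (d1 w - c1 w)\<^sup>2 + (d2 w - c2 w)\<^sup>2"
      by (simp only: sum_power2_gt_zero_iff)
    with len(2)[OF that] show ?thesis unfolding r'_def by simp
  qed
  note E = Pt_lay[OF A B r] and E' = Pt_lay[OF C D r']
  show ?thesis
    unfolding Pt_def
  proof (rule known_meet[OF A[unfolded Pt_def] E[unfolded Pt_def] C[unfolded Pt_def] E'[unfolded Pt_def]])
    fix w assume w: "w \<in> V"
    define e1 e2 f1 f2 where "e1 = (b1 w - a1 w) / r w" and "e2 = (b2 w - a2 w) / r w"
      and "f1 = (d1 w - c1 w) / r' w" and "f2 = (d2 w - c2 w) / r' w"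
    have e: "e1\<^sup>2 + e2\<^sup>2 = 1"
      using r[OF w] by (simp add: e1_def e2_def power_divide add_divide_distrib[symmetric])
    have f: "f1\<^sup>2 + f2\<^sup>2 = 1"
      using r'[OF w] by (simp add: f1_def f2_def power_divide add_divide_distrib[symmetric])
    show "dist (F w (a1 w) (a2 w)) (F w (a1 w + (b1 w - a1 w) / r w) (a2 w + (b2 w - a2 w) / r w)) = 1 \<and>
        dist (F w (c1 w) (c2 w)) (F w (c1 w + (d1 w - c1 w) / r' w) (c2 w + (d2 w - c2 w) / r' w)) = 1"
      using e f by (simp add: dist_F_1[OF w] e1_def e2_def f1_def f2_def)
    obtain s t where st: "0 \<le> s" "0 \<le> t"
      "x w = a1 w + s * (b1 w - a1 w)" "y w = a2 w + s * (b2 w - a2 w)"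
      "x w = c1 w + t * (d1 w - c1 w)" "y w = c2 w + t * (d2 w - c2 w)"
      "s\<^sup>2 * (r w)\<^sup>2 \<le> 1" "t\<^sup>2 * (r' w)\<^sup>2 \<le> 1"
      using cond[OF w] unfolding reaches_def conjunct2[OF conjunct2[OF r[OF w]]] conjunct2[OF conjunct2[OF r'[OF w]]]
      by blast
    define S T where "S = s * r w" and "T = t * r' w"
    have "S\<^sup>2 \<le> 1" "T\<^sup>2 \<le> 1" using st(7,8) by (simp_all add: S_def T_def power_mult_distrib)
    moreover have "0 \<le> S" "0 \<le> T" using st(1,2) r[OF w] r'[OF w] by (simp_all add: S_def T_def)
    ultimately have ST: "0 \<le> S" "0 \<le> T" "S \<le> 1" "T \<le> 1"
      by (simp_all add: abs_square_le_1)
    have X: "x w = a1 w + S * e1" "y w = a2 w + S * e2" "x w = c1 w + T * f1" "y w = c2 w + T * f2"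
      using st r[OF w] r'[OF w] by (simp_all add: S_def T_def e1_def e2_def f1_def f2_def)
    have "e1 * f2 - e2 * f1 =
        ((b1 w - a1 w) * (d2 w - c2 w) - (b2 w - a2 w) * (d1 w - c1 w)) / (r w * r' w)"
      by (simp only: e1_def e2_def f1_def f2_def times_divide_times_eq diff_divide_distrib[symmetric])
    then have cross: "e1 * f2 - e2 * f1 \<noteq> 0"
      using not_parallel[OF w] r[OF w] r'[OF w] by simp
    have uniq: "S' = S" if "a1 w + S' * e1 = c1 w + T' * f1" "a2 w + S' * e2 = c2 w + T' * f2" for S' T'
    proof -
      have 1: "(S' - S) * e1 = (T' - T) * f1" "(S' - S) * e2 = (T' - T) * f2"
        using that X unfolding left_diff_distrib by linarith+
      have "(S' - S) * (e1 * f2 - e2 * f1) = (S' - S) * e1 * f2 - (S' - S) * e2 * f1"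
        by (simp add: algebra_simps)
      also have "\<dots> = 0" unfolding 1 by simp
      finally show ?thesis using cross by simp
    qed
    show "closed_segment (F w (a1 w) (a2 w)) (F w (a1 w + (b1 w - a1 w) / r w) (a2 w + (b2 w - a2 w) / r w)) \<inter>
        closed_segment (F w (c1 w) (c2 w)) (F w (c1 w + (d1 w - c1 w) / r' w) (c2 w + (d2 w - c2 w) / r' w)) =
        {F w (x w) (y w)}"
    proof (rule set_eqI)
      fix p
      show "p \<in> closed_segment (F w (a1 w) (a2 w)) (F w (a1 w + (b1 w - a1 w) / r w) (a2 w + (b2 w - a2 w) / r w)) \<inter>
        closed_segment (F w (c1 w) (c2 w)) (F w (c1 w + (d1 w - c1 w) / r' w) (c2 w + (d2 w - c2 w) / r' w)) \<longleftrightarrow>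
        p \<in> {F w (x w) (y w)}"
        unfolding e1_def[symmetric] e2_def[symmetric] f1_def[symmetric] f2_def[symmetric]
          Int_iff mem_segment_F add_diff_cancel_left'
      proof
        assume "(\<exists>s\<ge>0. s \<le> 1 \<and> p = F w (a1 w + s * e1) (a2 w + s * e2)) \<and>
          (\<exists>s\<ge>0. s \<le> 1 \<and> p = F w (c1 w + s * f1) (c2 w + s * f2))"
        then obtain S' T' where p: "p = F w (a1 w + S' * e1) (a2 w + S' * e2)"
          "p = F w (c1 w + T' * f1) (c2 w + T' * f2)" by blast
        then have "S' = S" using uniq[of S' T'] by (simp add: F_inj[OF w])
        then show "p \<in> {F w (x w) (y w)}" using p X by simp
      next
        assume "p \<in> {F w (x w) (y w)}"
        then have p: "p = F w (x w) (y w)" by simp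
        have "p = F w (a1 w + S * e1) (a2 w + S * e2)" using p unfolding X(1,2) .
        moreover have "p = F w (c1 w + T * f1) (c2 w + T * f2)" using p unfolding X(3,4) .
        ultimately show "(\<exists>s\<ge>0. s \<le> 1 \<and> p = F w (a1 w + s * e1) (a2 w + s * e2)) \<and>
          (\<exists>s\<ge>0. s \<le> 1 \<and> p = F w (c1 w + s * f1) (c2 w + s * f2))"
          using ST by blast
      qed
    qed
  qed
qed

lemma Pt_compare:
  assumes "Pt a b" "Pt c d"
    and "can G {w \<in> V. (a w - c w)\<^sup>2 + (b w - d w)\<^sup>2 \<le> 1} Q"
    and "can G {w \<in> V. (a w - c w)\<^sup>2 + (b w - d w)\<^sup>2 > 1} Q"
  shows "can G V Q"
proof (rule can_compare[OF assms(1,2)[unfolded Pt_def]])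
  show "can G {w \<in> V. dist (F w (a w) (b w)) (F w (c w) (d w)) \<le> 1} Q"
    by (rule can_subset[OF assms(3)]) (auto simp: dist_F)
  show "can G {w \<in> V. 1 < dist (F w (a w) (b w)) (F w (c w) (d w))} Q"
    by (rule can_subset[OF assms(4)]) (auto simp: dist_F)
qed

text \<open>Exchanging or reversing the axes yields a frame again. Results for the second axis, or for the opposite
side of the first one, follow from this.\<close>

lemma frame_swap: "frame V v u"
  by unfold_locales (use norm_u norm_v orth in \<open>auto simp: inner_commute\<close>)

lemma frame_flip: "frame V u (\<lambda>w. - v w)"
  by unfold_locales (use norm_u norm_v orth in auto)

lemma frame_subset: "V' \<subseteq> V \<Longrightarrow> frame V' u v"
  by unfold_locales (use norm_u norm_v orth in auto)

end

section \<open>A square of side one half\<close>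

lemma known_choose:
  assumes "known G V A" "known G V B" "\<And>w. w \<in> V \<Longrightarrow> dist (A w) (B w) = 1"
    and "known (snd # lift G) {(w, x). w \<in> V \<and> x \<in> open_segment (A w) (B w)} (\<lambda>v. f (fst v))"
  shows "known G V f"
  unfolding known_def
  by (rule can_choose[OF assms(1,2)], erule assms(3)) (rule assms(4)[unfolded known_def])

context frame
begin

lemma Pt_shift:
  assumes A: "Pt x y" and B: "Pt (\<lambda>w. x w + r w) y" and r: "\<And>w. w \<in> V \<Longrightarrow> 0 < r w \<and> r w \<le> 1"
  shows "Pt (\<lambda>w. x w + of_int k) y"
proof -
  have 1: "Pt (\<lambda>w. x w + 1) y"
    by (rule Pt_cong[OF Pt_lay[OF A B, of r]]) (use r in force)+
  have "Pt (\<lambda>w. x w + of_int k) y \<and> Pt (\<lambda>w. x w + of_int k + 1) y"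
  proof (induction k rule: int_induct[of _ 0])
    case base
    show ?case using A 1 by simp
  next
    case (step1 i)
    have "Pt (\<lambda>w. x w + of_int (i + 1) + 1) y"
      by (rule Pt_cong[OF Pt_extend[OF conjunct1[OF step1(2)] conjunct2[OF step1(2)]]]) simp_all
    then show ?case using step1(2) by (simp add: add.assoc)
  next
    case (step2 i)
    have "Pt (\<lambda>w. x w + of_int (i - 1)) y"
      by (rule Pt_cong[OF Pt_extend[OF conjunct2[OF step2(2)] conjunct1[OF step2(2)]]]) simp_all
    then show ?case using step2(2) by simp
  qed
  then show ?thesis by simp
qed

lemma flip_Pt: "frame.Pt G V Or u (\<lambda>w. - v w) x y \<longleftrightarrow> Pt x (\<lambda>w. - y w)"
proof -
  interpret f: frame G V Or u "\<lambda>w. - v w" by (rule frame_flip)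
  show ?thesis by (simp add: f.Pt_def Pt_def f.F_def F_def)
qed

lemma swap_Pt: "frame.Pt G V Or v u x y \<longleftrightarrow> Pt y x"
proof -
  interpret s: frame G V Or v u by (rule frame_swap)
  show ?thesis by (simp add: s.Pt_def Pt_def s.F_def F_def add_ac)
qed

text \<open>With \<open>c\<^sup>2 + n\<^sup>2 = 1\<close>, the unit sticks from \<open>(0, n)\<close> end at \<open>(c, 0)\<close> and \<open>(-c, 0)\<close>. Prolonging the stick
that comes from \<open>(-c, 0)\<close> leads to a point vertically above \<open>(c, 0)\<close>, at twice the height of
\<open>(0, n)\<close>.\<close>

lemma half_column_ladder:
  assumes O: "Point 0 0" and U: "Point 1 0" and N: "Pt (\<lambda>_. 0) n"
    and n: "\<And>w. w \<in> V \<Longrightarrow> 0 < n w \<and> n w < 1"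
  shows "Pt (\<lambda>w. sqrt (1 - (n w)\<^sup>2)) (\<lambda>_. 0)" "Pt (\<lambda>w. sqrt (1 - (n w)\<^sup>2)) (\<lambda>w. 2 * n w)"
proof -
  define c where "c = (\<lambda>w. sqrt (1 - (n w)\<^sup>2))"
  have c: "(c w)\<^sup>2 + (n w)\<^sup>2 = 1" "0 < c w" "c w \<le> 1" if "w \<in> V" for w
  proof -
    have "(n w)\<^sup>2 < 1" using n[OF that] by (simp add: power_less_one_iff)
    then show "(c w)\<^sup>2 + (n w)\<^sup>2 = 1" "0 < c w" "c w \<le> 1" by (simp_all add: c_def)
  qed
  have U': "Point (-1) 0"
    by (rule Pt_cong[OF Pt_extend[OF U O]]) simp_all
  show C: "Pt c (\<lambda>_. 0)"
  proof (rule Pt_ruler[OF N O U])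
    fix w assume w: "w \<in> V"
    show "\<exists>s. only_hit 0 (n w) 0 0 1 0 (c w) 0 s"
      unfolding only_hit_def
      by (rule exI[of _ "c w"]) (use c[OF w] in simp)
  qed (use c in simp_all)
  have C': "Pt (\<lambda>w. - c w) (\<lambda>_. 0)"
  proof (rule Pt_ruler[OF N O U'])
    fix w assume w: "w \<in> V"
    show "\<exists>s. only_hit 0 (n w) 0 0 (-1) 0 (- c w) 0 s"
      unfolding only_hit_def
      by (rule exI[of _ "c w"]) (use c[OF w] in simp)
  qed (use c in simp_all)
  show "Pt c (\<lambda>w. 2 * n w)"
    by (rule Pt_cong[OF Pt_extend[OF C' N]]) (use c in simp_all)
qed

text \<open>If \<open>n \<le> 1/2\<close>, a stick can be laid along the vertical through \<open>(c, 0)\<close> just found. It carries the points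
\<open>(c, \<plusminus>n)\<close> at distance \<open>1\<close> from the origin. Their mirror images \<open>(1 - c, \<plusminus>n)\<close> in the line \<open>x = 1/2\<close> are the
points of the horizontal sticks at distance \<open>1\<close> from \<open>(1, 0)\<close>. By symmetry the sticks
from \<open>(0, 0)\<close> and \<open>(1, 0)\<close> cross on that line, above and below the axis.\<close>

lemma half_column_low:
  assumes O: "Point 0 0" and U: "Point 1 0" and N: "Pt (\<lambda>_. 0) n"
    and n: "\<And>w. w \<in> V \<Longrightarrow> 0 < n w \<and> n w \<le> 1 / 2"
  shows "Point (1 / 2) 0" "Point (1 / 2) 1"
proof -
  define c where "c = (\<lambda>w. sqrt (1 - (n w)\<^sup>2))"
  have c: "(c w)\<^sup>2 + (n w)\<^sup>2 = 1" "4 / 5 \<le> c w" "c w \<le> 1" "0 < n w" "n w \<le> 1 / 2" if "w \<in> V" for w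
  proof -
    have n2: "(n w)\<^sup>2 \<le> (1 / 2)\<^sup>2" by (rule power_mono) (use n[OF that] in auto)
    then show "(c w)\<^sup>2 + (n w)\<^sup>2 = 1" "c w \<le> 1" by (simp_all add: c_def power_divide)
    show "4 / 5 \<le> c w" unfolding c_def by (rule real_le_rsqrt) (use n2 in \<open>simp add: power_divide\<close>)
    show "0 < n w" "n w \<le> 1 / 2" using n[OF that] by auto
  qed
  have C: "Pt c (\<lambda>_. 0)" and C2: "Pt c (\<lambda>w. 2 * n w)"
    unfolding c_def by (rule half_column_ladder[OF O U N]; use n in force)+
  have C1: "Pt c (\<lambda>_. 1)"
    by (rule Pt_cong[OF Pt_lay[OF C C2, of "\<lambda>w. 2 * n w"]]) (use c in force)+
  have C1': "Pt c (\<lambda>_. -1)"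
    by (rule Pt_cong[OF Pt_extend[OF C1 C]]) simp_all
  have W: "Point 0 1"
    by (rule Pt_cong[OF Pt_lay[OF O N, of n]]) (use c in force)+
  have W': "Point 0 (-1)"
    by (rule Pt_cong[OF Pt_extend[OF W O]]) simp_all
  have E: "Pt c n"
  proof (rule Pt_ruler[OF O C C1])
    fix w assume w: "w \<in> V"
    show "\<exists>s. only_hit 0 0 (c w) 0 (c w) 1 (c w) (n w) s"
      unfolding only_hit_def
      by (rule exI[of _ "n w"]) (use c[OF w] in simp)
  qed (use c in simp_all)
  have E': "Pt c (\<lambda>w. - n w)"
  proof (rule Pt_ruler[OF O C C1'])
    fix w assume w: "w \<in> V"
    show "\<exists>s. only_hit 0 0 (c w) 0 (c w) (-1) (c w) (- n w) s"
      unfolding only_hit_def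
      by (rule exI[of _ "n w"]) (use c[OF w] in simp)
  qed (use c in simp_all)
  have N': "Pt (\<lambda>_. 0) (\<lambda>w. - n w)"
  proof (rule Pt_ruler[OF C O W'])
    fix w assume w: "w \<in> V"
    show "\<exists>s. only_hit (c w) 0 0 0 0 (-1) 0 (- n w) s"
      unfolding only_hit_def
      by (rule exI[of _ "n w"]) (use c[OF w] in simp)
  qed (use c in simp_all)
  \<comment> \<open>The level \<open>m\<close> is \<open>n\<close> above and \<open>- n\<close> below the axis.\<close>
  have mirror: "Pt (\<lambda>w. 1 - c w) m"
    if E: "Pt c m" and N: "Pt (\<lambda>_. 0) m" and m: "\<And>w. w \<in> V \<Longrightarrow> (m w)\<^sup>2 = (n w)\<^sup>2" for m
  proof -
    have R: "Pt (\<lambda>w. c w - 1) m"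
      by (rule Pt_cong[OF Pt_lay[OF E N, of c]]) (use c in force)+
    show ?thesis
    proof (rule Pt_ruler[OF U E R])
      fix w assume w: "w \<in> V"
      show "\<exists>s. only_hit 1 0 (c w) (m w) (c w - 1) (m w) (1 - c w) (m w) s"
      unfolding only_hit_def
        by (rule exI[of _ "2 * c w - 1"]) (use c[OF w] in simp)
    qed (use c m in simp_all)
  qed
  have D: "Pt (\<lambda>_. 1 / 2) (\<lambda>w. m w / (2 * c w))"
    if E: "Pt c m" and K: "Pt (\<lambda>w. 1 - c w) m" and m: "\<And>w. w \<in> V \<Longrightarrow> (m w)\<^sup>2 = (n w)\<^sup>2" for m
  proof (rule Pt_cross[OF O E U K])
    fix w assume w: "w \<in> V"
    have "m w \<noteq> 0" using m[OF w] c(4)[OF w] by auto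
    then show "(c w - 0) * (m w - 0) \<noteq> (m w - 0) * (1 - c w - 1)"
      using c(2)[OF w] by simp
    have "(1 / (2 * c w))\<^sup>2 \<le> 1\<^sup>2" by (rule power_mono) (use c(2)[OF w] in \<open>simp_all add: field_simps\<close>)
    then show "\<exists>s t. reaches 0 0 (c w) (m w) (1 / 2) (m w / (2 * c w)) s \<and>
        reaches 1 0 (1 - c w) (m w) (1 / 2) (m w / (2 * c w)) t"
      unfolding reaches_def
      using c(1,2)[OF w] m[OF w] by (intro exI[of _ "1 / (2 * c w)"]) (simp add: power_divide)
  qed (use c m in simp_all)
  define m where "m = (\<lambda>w. n w / (2 * c w))"
  have m: "0 < m w" "m w \<le> 1 / 2" if "w \<in> V" for w
    using c[OF that] by (simp_all add: m_def field_simps)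
  have D1: "Pt (\<lambda>_. 1 / 2) m" unfolding m_def by (rule D[OF E mirror[OF E N]]) auto
  have D2: "Pt (\<lambda>_. 1 / 2) (\<lambda>w. - m w)"
    using D[OF E' mirror[OF E' N']] by (simp add: m_def)
  show H: "Point (1 / 2) 0"
  proof (rule Pt_cross[OF D2 D1 O U])
    fix w assume w: "w \<in> V"
    have "(2 * m w)\<^sup>2 \<le> 1\<^sup>2" by (rule power_mono) (use m[OF w] in auto)
    then have 1: "(m w - - m w)\<^sup>2 \<le> 1" by simp
    then show "(1 / 2 - 1 / 2)\<^sup>2 + (m w - - m w)\<^sup>2 \<le> 1" by simp
    show "(1 / 2 - 1 / 2) * (0 - 0) \<noteq> (m w - - m w) * (1 - 0)"
      using m(1)[OF w] by simp
    show "\<exists>s t. reaches (1 / 2) (- m w) (1 / 2) (m w) (1 / 2) 0 s \<and>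
        reaches 0 0 1 0 (1 / 2) 0 t"
      unfolding reaches_def
      using 1 by (intro exI[of _ "1 / 2"]) (simp add: power_divide)
  qed simp_all
  show "Point (1 / 2) 1"
    by (rule Pt_cong[OF Pt_lay[OF H D1, of m]]) (use m in force)+
qed

text \<open>The number \<open>n\<close> comes from an arbitrary point of the second axis. If it exceeds \<open>1/2\<close>, the point at height
\<open>n - 1\<close>, which is the end of the stick laid from \<open>(0, n)\<close> through the origin, takes its place in the
reflected frame.\<close>

lemma half_column:
  assumes O: "Point 0 0" and U: "Point 1 0" and W: "Point 0 1"
  shows "Point (1 / 2) 0" "Point (1 / 2) 1"
proof -
  define V' where "V' = {(w, x). w \<in> V \<and> x \<in> open_segment (F w 0 0) (F w 0 1)}"
  define G' :: "('w \<times> point \<Rightarrow> point) list" where "G' = snd # lift G"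
  interpret E: frame G' V' "\<lambda>p. Or (fst p)" "\<lambda>p. u (fst p)" "\<lambda>p. v (fst p)"
    by unfold_locales (auto simp: V'_def norm_u norm_v orth)
  have E_F: "E.F p x y = F (fst p) x y" for p x y by (simp add: E.F_def F_def)
  have lift: "E.Point x y" if "Point x y" for x y
    using that unfolding E.Pt_def Pt_def E_F
    by (rule known_lift) (auto simp: G'_def V'_def)
  have "\<exists>n. \<forall>p\<in>V'. snd p = F (fst p) 0 (n p) \<and> 0 < n p \<and> n p < 1"
  proof (rule bchoice, rule ballI)
    fix p assume p: "p \<in> V'"
    then have "snd p \<in> open_segment (F (fst p) 0 0) (F (fst p) 0 1)" by (auto simp: V'_def)
    then obtain s where s: "0 < s" "s < 1" "snd p = (1 - s) *\<^sub>R F (fst p) 0 0 + s *\<^sub>R F (fst p) 0 1"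
      by (auto simp: in_segment)
    have "snd p = F (fst p) 0 s" unfolding s(3) by (simp add: F_def algebra_simps)
    then show "\<exists>n. snd p = F (fst p) 0 n \<and> 0 < n \<and> n < 1" using s by blast
  qed
  then obtain n where n: "\<And>p. p \<in> V' \<Longrightarrow> snd p = F (fst p) 0 (n p) \<and> 0 < n p \<and> n p < 1" by blast
  have N: "E.Pt (\<lambda>_. 0) n"
    unfolding E.Pt_def by (rule known_cong[OF known_mem[of snd]]) (use n in \<open>auto simp: G'_def E_F\<close>)
  note O' = lift[OF O] and U' = lift[OF U] and W' = lift[OF W]
  note ladder = E.half_column_ladder[OF O' U' N conjunct2[OF n]]
  have "E.Point (1 / 2) 0 \<and> E.Point (1 / 2) 1"
  proof -
    define near where "near = {p \<in> V'. dist (E.F p (sqrt (1 - (n p)\<^sup>2)) 0) (E.F p (sqrt (1 - (n p)\<^sup>2)) (2 * n p)) \<le> 1}"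
    define far where "far = {p \<in> V'. dist (E.F p (sqrt (1 - (n p)\<^sup>2)) 0) (E.F p (sqrt (1 - (n p)\<^sup>2)) (2 * n p)) > 1}"
    have near: "p \<in> V' \<and> n p \<le> 1 / 2" if "p \<in> near" for p
      using that n[of p] by (clarsimp simp: near_def E.dist_F real_le_lsqrt real_sqrt_mult simp del: real_sqrt_le_1_iff)
    have far: "p \<in> V' \<and> 1 / 2 < n p" if "p \<in> far" for p
      using that n[of p] by (clarsimp simp: far_def E.dist_F real_sqrt_mult simp del: real_sqrt_gt_1_iff)
    interpret N: frame G' near "\<lambda>p. Or (fst p)" "\<lambda>p. u (fst p)" "\<lambda>p. v (fst p)"
      by (rule E.frame_subset) (use near in blast)
    interpret R: frame G' far "\<lambda>p. Or (fst p)" "\<lambda>p. u (fst p)" "\<lambda>p. v (fst p)"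
      by (rule E.frame_subset) (use far in blast)
    interpret R': frame G' far "\<lambda>p. Or (fst p)" "\<lambda>p. u (fst p)" "\<lambda>p. - v (fst p)"
      by (rule R.frame_flip)
    note flip = R.flip_Pt[THEN iffD2] and unflip = R.flip_Pt[THEN iffD1]
    have sub: "near \<subseteq> V'" "far \<subseteq> V'" using near far by blast+
    have to_near: "N.Pt x y" if "E.Pt x y" for x y
      using that unfolding N.Pt_def E.Pt_def by (rule known_subset[OF _ sub(1)])
    have to_far: "R.Pt x y" if "E.Pt x y" for x y
      using that unfolding R.Pt_def E.Pt_def by (rule known_subset[OF _ sub(2)])
    have N1: "N.Point (1 / 2) 0" "N.Point (1 / 2) 1"
      by (rule N.half_column_low[OF to_near[OF O'] to_near[OF U'] to_near[OF N]]; use n near in blast)+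
    \<comment> \<open>In the reflected frame this point has the height \<open>1 - n\<close>, which is less than \<open>1/2\<close> here.\<close>
    have D: "E.Pt (\<lambda>_. 0) (\<lambda>p. n p - 1)"
      by (rule E.Pt_cong[OF E.Pt_lay[OF N O', of n]]) (use n in force)+
    have "R'.Pt (\<lambda>_. 0) (\<lambda>p. 1 - n p)" by (rule flip) (use to_far[OF D] in simp)
    moreover have "R'.Point 0 0" by (rule flip) (use to_far[OF O'] in simp)
    moreover have "R'.Point 1 0" by (rule flip) (use to_far[OF U'] in simp)
    moreover have "0 < 1 - n p \<and> 1 - n p \<le> 1 / 2" if "p \<in> far" for p
      using far[OF that] n[of p] by simp
    ultimately have "R'.Point (1 / 2) 0" "R'.Point (1 / 2) 1"
      using R'.half_column_low[of "\<lambda>p. 1 - n p"] by blast+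
    from this[THEN unflip] have R1: "R.Point (1 / 2) 0" "R.Point (1 / 2) (-1)"
      by simp_all
    have R2: "R.Point (1 / 2) 1"
      by (rule R.Pt_cong[OF R.Pt_extend[OF R1(2,1)]]) simp_all
    have "E.Pt x y" if "N.Pt x y" "R.Pt x y" for x y
      unfolding E.Pt_def
      by (rule known_compare[OF ladder[unfolded E.Pt_def], folded near_def far_def])
        (use that in \<open>simp_all add: N.Pt_def R.Pt_def\<close>)
    then show ?thesis using N1 R1 R2 by blast
  qed
  moreover have unit: "dist (F w 0 0) (F w 0 1) = 1" if "w \<in> V" for w
    using that by (simp add: dist_F)
  moreover have "Point x y" if "E.Point x y" for x y
    unfolding Pt_def
  proof (rule known_choose[OF O[unfolded Pt_def] W[unfolded Pt_def] unit])
    show "known (snd # lift G) {(w, x). w \<in> V \<and> x \<in> open_segment (F w 0 0) (F w 0 1)}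
        (\<lambda>p. F (fst p) x y)"
      using that unfolding E.Pt_def E_F unfolding G'_def V'_def .
  qed
  ultimately show "Point (1 / 2) 0" "Point (1 / 2) 1"
    by blast+
qed

lemma half_square:
  assumes O: "Point 0 0" and U: "Point 1 0" and W: "Point 0 1"
  shows "Point (1 / 2) 0" "Point 0 (1 / 2)" "Point (1 / 2) (1 / 2)"
proof -
  interpret s: frame G V Or v u by (rule frame_swap)
  show x: "Point (1 / 2) 0" by (rule half_column[OF O U W])
  have x1: "Point (1 / 2) 1" by (rule half_column[OF O U W])
  have y: "Point 0 (1 / 2)" and y1: "Point 1 (1 / 2)"
    using s.half_column[unfolded swap_Pt, OF O W U] .
  show "Point 0 (1 / 2)" by (rule y)
  show "Point (1 / 2) (1 / 2)"
    by (rule Pt_cross[OF x x1 y y1]) (auto simp: reaches_def power2_eq_square intro!: exI[of _ "1 / 2"])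
qed

end

section \<open>The dyadic lattice\<close>

definition dyadic :: "real \<Rightarrow> bool" where
  "dyadic x \<longleftrightarrow> (\<exists>(i::int) (k::nat). x = of_int i / 2 ^ k)"

lemma dyadic_common:
  assumes "dyadic x" "dyadic y"
  obtains i j :: int and k :: nat where "x = of_int i / 2 ^ k" "y = of_int j / 2 ^ k" "k \<ge> 1"
proof -
  obtain i k j l where "x = of_int i / 2 ^ k" "y = of_int j / 2 ^ l"
    using assms unfolding dyadic_def by blast
  then have "x = of_int (i * 2 ^ (l + 1)) / 2 ^ (k + l + 1)" "y = of_int (j * 2 ^ (k + 1)) / 2 ^ (k + l + 1)"
    by (simp_all add: power_add)
  then show thesis by (rule that) simp
qed

lemma dyadic_of_int [simp]: "dyadic (of_int i)"
  unfolding dyadic_def by (intro exI[of _ i] exI[of _ 0]) simp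

lemma dyadic_numeral [simp]: "dyadic 0" "dyadic 1" "dyadic (numeral n)"
  using dyadic_of_int[of 0] dyadic_of_int[of 1] dyadic_of_int[of "numeral n"] by simp_all

lemma dyadic_add [simp]: assumes "dyadic x" "dyadic y" shows "dyadic (x + y)"
proof -
  obtain i j k where "x = of_int i / 2 ^ k" "y = of_int j / 2 ^ k"
    using assms by (rule dyadic_common)
  then have "x + y = of_int (i + j) / 2 ^ k" by (simp add: add_divide_distrib)
  then show ?thesis unfolding dyadic_def by blast
qed

lemma dyadic_minus [simp]: "dyadic x \<Longrightarrow> dyadic (- x)"
  unfolding dyadic_def by (metis minus_divide_left of_int_minus)

lemma dyadic_diff [simp]: "dyadic x \<Longrightarrow> dyadic y \<Longrightarrow> dyadic (x - y)"
  using dyadic_add[of x "- y"] by simp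

lemma dyadic_mult [simp]: assumes "dyadic x" "dyadic y" shows "dyadic (x * y)"
proof -
  obtain i j k where "x = of_int i / 2 ^ k" "y = of_int j / 2 ^ k"
    using assms by (rule dyadic_common)
  then have "x * y = of_int (i * j) / 2 ^ (k + k)" by (simp add: power_add)
  then show ?thesis unfolding dyadic_def by blast
qed

lemma dyadic_divide_power [simp]: assumes "dyadic x" shows "dyadic (x / 2 ^ k)"
proof -
  have "1 / 2 ^ k = of_int 1 / (2::real) ^ k" by simp
  then have "dyadic (1 / 2 ^ k)" unfolding dyadic_def by blast
  then show ?thesis using dyadic_mult[OF assms, of "1 / 2 ^ k"] by simp
qed

lemma dyadic_half [simp]: "dyadic x \<Longrightarrow> dyadic (x / 2)"
  using dyadic_divide_power[of x 1] by simp

lemma dyadic_dense: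
  assumes "0 < e" shows "\<exists>y. dyadic y \<and> \<bar>x - y\<bar> \<le> e"
proof -
  obtain k where k: "1 / 2 ^ k < e"
    using real_arch_pow_inv[OF assms, of "1 / 2"] by (auto simp: power_one_over)
  define y where "y = of_int \<lfloor>x * 2 ^ k\<rfloor> / (2::real) ^ k"
  have "y \<le> x" "x \<le> y + 1 / 2 ^ k"
    unfolding y_def by (simp_all add: field_simps) linarith
  then show ?thesis using k by (intro exI[of _ y]) (auto simp: y_def dyadic_def)
qed

lemma countable_dyadic: "\<exists>g :: nat \<Rightarrow> real. range g = {x. dyadic x}"
proof -
  have "{x. dyadic x} = (\<lambda>(i, k). of_int i / 2 ^ k) ` (UNIV :: (int \<times> nat) set)"
    by (auto simp: dyadic_def)
  then have "countable {x. dyadic x}" by simp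
  moreover have "{x. dyadic x} \<noteq> {}" using dyadic_numeral(1) by blast
  ultimately show ?thesis using range_from_nat_into by metis
qed

context frame
begin

lemma half_line:
  assumes A: "Pt x y" and B: "Pt (\<lambda>w. x w + 1 / 2) y"
  shows "Pt (\<lambda>w. x w + of_int i / 2) y"
proof -
  have even: "Pt (\<lambda>w. x w + of_int k) y" for k
    by (rule Pt_shift[OF A B]) simp
  have odd: "Pt (\<lambda>w. (x w + 1 / 2) + of_int k) y" for k
  proof (rule Pt_shift[OF B])
    show "Pt (\<lambda>w. x w + 1 / 2 + 1 / 2) y" using even[of 1] by (simp add: add.assoc)
  qed simp
  obtain k where "i = 2 * k \<or> i = 2 * k + 1" by (metis evenE oddE)
  then show ?thesis using even[of k] odd[of k] by (auto simp: add_ac add_divide_distrib)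
qed

text \<open>Halving the mesh of a square lattice: the diagonals give the centres of the cells, and the
  lines between adjacent centres halve the sides.\<close>

lemma cell_centre:
  assumes "Point a b" "Point (a + d) b" "Point a (b + d)" "Point (a + d) (b + d)"
    and d: "0 < d" "d \<le> 1 / 2"
  shows "Point (a + d / 2) (b + d / 2)"
proof (rule Pt_cross[OF assms(1,4,2,3)])
  have "d\<^sup>2 \<le> (1 / 2)\<^sup>2" by (rule power_mono) (use d in auto)
  then have d2: "d\<^sup>2 + d\<^sup>2 \<le> 1" by (simp add: power_divide)
  then show "(a + d - a)\<^sup>2 + (b + d - b)\<^sup>2 \<le> 1" "(a - (a + d))\<^sup>2 + (b + d - b)\<^sup>2 \<le> 1" by simp_all
  show "(a + d - a) * (b + d - b) \<noteq> (b + d - b) * (a - (a + d))" using d by simp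
  show "\<exists>s t. reaches a b (a + d) (b + d) (a + d / 2) (b + d / 2) s \<and>
        reaches (a + d) b a (b + d) (a + d / 2) (b + d / 2) t"
      unfolding reaches_def
    using d2 by (intro exI[of _ "1 / 2"]) (simp add: power_divide)
qed

lemma side_midpoint:
  assumes "Point a b" "Point (a + d) b"
    "Point (a + d / 2) (b - d / 2)" "Point (a + d / 2) (b + d / 2)"
    and d: "0 < d" "d \<le> 1 / 2"
  shows "Point (a + d / 2) b"
proof (rule Pt_cross[OF assms(1-4)])
  have d2: "d\<^sup>2 \<le> 1" by (rule power_le_one) (use d in auto)
  then show "(a + d - a)\<^sup>2 + (b - b)\<^sup>2 \<le> 1" "(a + d / 2 - (a + d / 2))\<^sup>2 + (b + d / 2 - (b - d / 2))\<^sup>2 \<le> 1"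
    by simp_all
  show "(a + d - a) * (b + d / 2 - (b - d / 2)) \<noteq> (b - b) * (a + d / 2 - (a + d / 2))" using d by simp
  show "\<exists>s t. reaches a b (a + d) b (a + d / 2) b s \<and>
        reaches (a + d / 2) (b - d / 2) (a + d / 2) (b + d / 2) (a + d / 2) b t"
      unfolding reaches_def
    using d2 by (intro exI[of _ "1 / 2"]) (simp add: power_divide)
qed

lemma lattice_level:
  assumes O: "Point 0 0" and U: "Point 1 0" and W: "Point 0 1"
  shows "Point (of_int i / 2 ^ Suc k) (of_int j / 2 ^ Suc k)"
proof (induction k arbitrary: i j)
  case 0
  interpret s: frame G V Or v u by (rule frame_swap)
  note sq = half_square[OF O U W]
  have "Point (of_int i / 2) 0" "Point (of_int i / 2) (1 / 2)" for i
    using half_line[OF O, of i] half_line[OF sq(2), of i] sq by simp_all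
  then show ?case
    using s.half_line[of "\<lambda>_. 0" "\<lambda>_. of_int i / 2" j] by (simp add: swap_Pt)
next
  case (Suc k)
  interpret s: frame G V Or v u by (rule frame_swap)
  define d :: real where "d = 1 / 2 ^ Suc k"
  have d: "0 < d" "d \<le> 1 / 2" by (simp_all add: d_def field_simps)
  have corner: "Point (of_int i * d) (of_int j * d)" for i j
    using Suc.IH[of i j] by (simp add: d_def)
  have centre: "Point (of_int i * d + d / 2) (of_int j * d + d / 2)" for i j
    using cell_centre[OF corner[of i j] _ _ _ d] corner[of "i + 1" j] corner[of i "j + 1"] corner[of "i + 1" "j + 1"]
    by (simp add: algebra_simps)
  have side: "Point (of_int i * d + d / 2) (of_int j * d)" for i j
    using side_midpoint[OF corner[of i j] _ _ _ d] corner[of "i + 1" j] centre[of i j] centre[of i "j - 1"]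
    by (simp add: algebra_simps)
  have side': "Point (of_int i * d) (of_int j * d + d / 2)" for i j
    using s.side_midpoint[OF corner[of i j, folded swap_Pt] _ _ _ d] corner[of i "j + 1"] centre[of i j] centre[of "i - 1" j]
    by (simp add: algebra_simps swap_Pt)
  obtain i' j' where ij: "i = 2 * i' \<or> i = 2 * i' + 1" "j = 2 * j' \<or> j = 2 * j' + 1"
    by (metis evenE oddE)
  have eq: "of_int (2 * l) / 2 ^ Suc (Suc k) = of_int l * d"
    "of_int (2 * l + 1) / 2 ^ Suc (Suc k) = of_int l * d + d / 2" for l
    by (simp_all add: d_def add_divide_distrib)
  show ?case using ij corner[of i' j'] centre[of i' j'] side[of i' j'] side'[of i' j']
    by (elim disjE) (simp_all only: eq)
qed

text \<open>The lattice gives constructed points arbitrarily close to any point of the plane. In particular it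
bridges distances greater than the unit.\<close>

lemma dyadic_lattice:
  assumes O: "Point 0 0" and U: "Point 1 0" and W: "Point 0 1"
    and "dyadic x" "dyadic y"
  shows "Point x y"
proof -
  obtain i j k where "x = of_int i / 2 ^ k" "y = of_int j / 2 ^ k" "k \<ge> 1"
    using assms(4,5) by (rule dyadic_common)
  then show ?thesis using lattice_level[OF O U W, of i "k - 1" j] by simp
qed

end

section \<open>Columns and rows\<close>

locale grid = frame G V Or u v
  for G :: "('w \<Rightarrow> point) list" and V :: "'w set" and Or u v :: "'w \<Rightarrow> point" +
  assumes lattice: "dyadic x \<Longrightarrow> dyadic y \<Longrightarrow> Point x y"
begin

lemma grid_swap: "grid G V Or v u"
proof -
  interpret s: frame G V Or v u by (rule frame_swap)
  show ?thesis by unfold_locales (simp add: swap_Pt lattice)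
qed

lemma grid_subset: assumes "V' \<subseteq> V" shows "grid G V' Or u v"
proof -
  interpret s: frame G V' Or u v by (rule frame_subset[OF assms])
  show ?thesis
    by unfold_locales (use lattice in \<open>auto simp: s.Pt_def Pt_def intro: known_subset[OF _ assms]\<close>)
qed

text \<open>The bound \<open>1/128\<close> is adapted to the isosceles triangles below: with the base column at distance \<open>63/64\<close>,
their heights lie between \<open>1/9\<close> and \<open>1/4\<close> for all offsets up to this bound. The lattice point
\<open>l\<close> is the same in all worlds, since programs refer to it.\<close>

definition near :: "('w \<Rightarrow> real) \<Rightarrow> real \<Rightarrow> bool" where
  "near x l \<longleftrightarrow> dyadic l \<and> (\<forall>w\<in>V. \<bar>x w - l\<bar> \<le> 1 / 128)"

text \<open>The number \<open>x\<close> is available in every dyadic row. This makes it independent of the place where it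
was found.\<close>

definition Col :: "('w \<Rightarrow> real) \<Rightarrow> bool" where
  "Col x \<longleftrightarrow> (\<forall>y. dyadic y \<longrightarrow> Pt x (\<lambda>_. y))"

definition Row :: "('w \<Rightarrow> real) \<Rightarrow> bool" where
  "Row y \<longleftrightarrow> (\<forall>x. dyadic x \<longrightarrow> Pt (\<lambda>_. x) y)"

lemma Col_dyadic: "dyadic l \<Longrightarrow> Col (\<lambda>_. l)"
  by (simp add: Col_def lattice)

lemma near_bounds: "near x l \<Longrightarrow> w \<in> V \<Longrightarrow> l - 1 / 128 \<le> x w" "near x l \<Longrightarrow> w \<in> V \<Longrightarrow> x w \<le> l + 1 / 128"
  unfolding near_def by (drule conjunct2, drule (1) bspec, linarith)+

lemma near_dyadic: "near x l \<Longrightarrow> dyadic l"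
  by (simp add: near_def)

text \<open>The unit circle about a point near \<open>(l, m)\<close> meets the column \<open>x = l - 63/64\<close> at two points whose
distance is twice this number. Being at least \<open>1/9\<close>, it exceeds the offset from the row \<open>y = m\<close>, so the two
points lie on different sides of that row. Being at most \<open>1/4\<close>, it leaves the points obtained by
prolonging the radii, which are four times this number apart, within reach of one stick.\<close>

definition h :: "('w \<Rightarrow> real) \<Rightarrow> real \<Rightarrow> 'w \<Rightarrow> real" where
  "h x l w = sqrt (1 - (x w - l + 63 / 64)\<^sup>2)"

lemma h:
  assumes "near x l" "w \<in> V"
  shows "(x w - l + 63 / 64)\<^sup>2 + (h x l w)\<^sup>2 = 1" "1 / 9 \<le> h x l w" "h x l w \<le> 1 / 4"
proof -
  have b: "125 / 128 \<le> x w - l + 63 / 64" "x w - l + 63 / 64 \<le> 127 / 128"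
    using near_bounds[OF assms] by auto
  have "(125 / 128)\<^sup>2 \<le> (x w - l + 63 / 64)\<^sup>2" "(x w - l + 63 / 64)\<^sup>2 \<le> (127 / 128)\<^sup>2"
    by (rule power_mono; use b in simp)+
  then have *: "(1 / 9)\<^sup>2 \<le> 1 - (x w - l + 63 / 64)\<^sup>2" "1 - (x w - l + 63 / 64)\<^sup>2 \<le> (1 / 4)\<^sup>2"
    by (simp_all add: power_divide)
  show "1 / 9 \<le> h x l w" unfolding h_def by (rule real_le_rsqrt) (rule *)
  show "h x l w \<le> 1 / 4" unfolding h_def by (rule real_le_lsqrt) (use * in auto)
  show "(x w - l + 63 / 64)\<^sup>2 + (h x l w)\<^sup>2 = 1"
    using * order_trans[OF _ *(1), of 0] by (simp add: h_def)
qed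

lemma on_column:
  assumes P: "Pt x y" and x: "near x l" and y: "near y m"
  shows "Pt (\<lambda>_. l - 63 / 64) (\<lambda>w. y w + h x l w)" "Pt (\<lambda>_. l - 63 / 64) (\<lambda>w. y w - h x l w)"
proof -
  have [simp]: "dyadic l" "dyadic m" using x y by (simp_all add: near_def)
  have k [simp]: "dyadic (63 / 64)" using dyadic_divide_power[of 63 6] by simp
  have A: "Point (l - 63 / 64) m" and B: "Point (l - 63 / 64) (m + 1)"
    and C: "Point (l - 63 / 64) (m - 1)" by (simp_all add: lattice)
  show "Pt (\<lambda>_. l - 63 / 64) (\<lambda>w. y w + h x l w)"
  proof (rule Pt_ruler[OF P A B])
    fix w assume w: "w \<in> V"
    show "(l - 63 / 64 - x w)\<^sup>2 + (y w + h x l w - y w)\<^sup>2 = 1"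
      using h(1)[OF x w] by (simp add: power2_eq_square algebra_simps)
    show "\<exists>s. only_hit (x w) (y w) (l - 63 / 64) m (l - 63 / 64) (m + 1) (l - 63 / 64) (y w + h x l w) s"
      unfolding only_hit_def
      using near_bounds[OF y w] h(2,3)[OF x w]
      by (intro exI[of _ "y w + h x l w - m"]) simp
  qed simp
  show "Pt (\<lambda>_. l - 63 / 64) (\<lambda>w. y w - h x l w)"
  proof (rule Pt_ruler[OF P A C])
    fix w assume w: "w \<in> V"
    show "(l - 63 / 64 - x w)\<^sup>2 + (y w - h x l w - y w)\<^sup>2 = 1"
      using h(1)[OF x w] by (simp add: power2_eq_square algebra_simps)
    show "\<exists>s. only_hit (x w) (y w) (l - 63 / 64) m (l - 63 / 64) (m - 1) (l - 63 / 64) (y w - h x l w) s"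
      unfolding only_hit_def
      using near_bounds[OF y w] h(2,3)[OF x w]
      by (intro exI[of _ "m - (y w - h x l w)"]) simp
  qed simp
qed

lemma near_const: "dyadic m \<Longrightarrow> near (\<lambda>_. m) m"
  by (simp add: near_def)

text \<open>Prolonging the legs of the isosceles triangle beyond the column gives two points on a common vertical,
the mirror image of the vertical through the given point. They lie on both sides of the row
\<open>y = m\<close>, which the stick between them therefore meets. Reflecting the intersection back in the column
yields the foot of the given point on that row. The offset from the row may have either sign or
vanish.\<close>

lemma project_row:
  assumes P: "Pt x y" and x: "near x l" and y: "near y m"
  shows "Pt x (\<lambda>_. m)"
proof -
  have [simp]: "dyadic l" "dyadic m" using x y by (simp_all add: near_def)
  have k [simp]: "dyadic (63 / 64)" using dyadic_divide_power[of 63 6] by simp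
  note up = on_column(1)[OF P x y] and down = on_column(2)[OF P x y]
  let ?X = "\<lambda>w. 2 * (l - 63 / 64) - x w"
  have on_circle: "(x w - (l - 63 / 64))\<^sup>2 + (h x l w)\<^sup>2 = 1" if "w \<in> V" for w
    using h(1)[OF x that] by (simp add: algebra_simps)
  have B1: "Pt ?X (\<lambda>w. y w + 2 * h x l w)"
    by (rule Pt_cong[OF Pt_extend[OF P up]]) (use on_circle in \<open>simp_all add: algebra_simps\<close>)
  have B2: "Pt ?X (\<lambda>w. y w - 2 * h x l w)"
    by (rule Pt_cong[OF Pt_extend[OF P down]]) (use on_circle in \<open>simp_all add: algebra_simps\<close>)
  have R1: "Point (l - 2) m" and R2: "Point (l - 1) m" by (simp_all add: lattice)
  have X: "Pt ?X (\<lambda>_. m)"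
  proof (rule Pt_cross[OF B2 B1 R1 R2])
    fix w assume w: "w \<in> V"
    note b = near_bounds[OF x w] near_bounds[OF y w] h(2,3)[OF x w]
    have "(4 * h x l w)\<^sup>2 \<le> 1" by (rule power_le_one) (use b in auto)
    then show "(?X w - ?X w)\<^sup>2 + (y w + 2 * h x l w - (y w - 2 * h x l w))\<^sup>2 \<le> 1" by simp
    show "(?X w - ?X w) * (m - m) \<noteq> (y w + 2 * h x l w - (y w - 2 * h x l w)) * (l - 1 - (l - 2))"
      using b by simp
    define s t where "s = (m - y w + 2 * h x l w) / (4 * h x l w)" and "t = ?X w - (l - 2)"
    have s: "0 \<le> s" "s * (4 * h x l w) = m - y w + 2 * h x l w"
      using b by (simp_all add: s_def)
    have "(s * (4 * h x l w))\<^sup>2 \<le> 1" unfolding s(2) by (rule power_le_one) (use b in auto)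
    then have s2: "s\<^sup>2 * ((?X w - ?X w)\<^sup>2 + (y w + 2 * h x l w - (y w - 2 * h x l w))\<^sup>2) \<le> 1"
      by (simp add: power_mult_distrib)
    have t: "0 \<le> t" "t\<^sup>2 \<le> 1" unfolding t_def by (simp, use b in simp) (rule power_le_one; use b in simp)
    show "\<exists>s t. reaches (?X w) (y w - 2 * h x l w) (?X w) (y w + 2 * h x l w) (?X w) m s \<and>
        reaches (l - 2) m (l - 1) m (?X w) m t"
      unfolding reaches_def
      by (rule exI[of _ s], rule exI[of _ t], intro conjI s2)
        (use s t in \<open>simp_all add: algebra_simps t_def\<close>)
  qed simp
  have A: "Point (l - 63 / 64) m" and B: "Point (l - 63 / 64) (m + 1)"
    by (simp_all add: lattice)
  have M: "Pt (\<lambda>_. l - 63 / 64) (\<lambda>w. m + h x l w)"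
  proof (rule Pt_ruler[OF X A B])
    fix w assume w: "w \<in> V"
    show "(l - 63 / 64 - ?X w)\<^sup>2 + (m + h x l w - m)\<^sup>2 = 1"
      using on_circle[OF w] by (simp add: power2_eq_square algebra_simps)
    show "\<exists>s. only_hit (?X w) m (l - 63 / 64) m (l - 63 / 64) (m + 1) (l - 63 / 64) (m + h x l w) s"
      unfolding only_hit_def
      using h(2,3)[OF x w] by (intro exI[of _ "h x l w"]) simp
  qed simp
  have C: "Point (l - 1 / 2) m" and D: "Point (l + 1 / 2) m" by (simp_all add: lattice)
  show ?thesis
  proof (rule Pt_ruler[OF M C D])
    fix w assume w: "w \<in> V"
    show "(x w - (l - 63 / 64))\<^sup>2 + (m - (m + h x l w))\<^sup>2 = 1" using on_circle[OF w] by simp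
    show "\<exists>s. only_hit (l - 63 / 64) (m + h x l w) (l - 1 / 2) m (l + 1 / 2) m (x w) m s"
      unfolding only_hit_def
      using near_bounds[OF x w] by (intro exI[of _ "x w - l + 1 / 2"]) simp
  qed simp
qed

text \<open>For a point on a row, the mirror image in the column \<open>x = l - 63/64\<close> is found first; prolonging its upper
leg then leads to a second point on the vertical through the given point, at a distance of at
most \<open>1/2\<close>.\<close>

lemma column:
  assumes P: "Pt x (\<lambda>_. m)" and x: "near x l" and m: "dyadic m"
  shows "Col x"
proof -
  interpret s: grid G V Or v u by (rule grid_swap)
  have [simp]: "dyadic l" "dyadic m" using x m by (simp_all add: near_def)
  let ?X = "\<lambda>w. 2 * (l - 63 / 64) - x w"
  have on_circle: "(x w - (l - 63 / 64))\<^sup>2 + (h x l w)\<^sup>2 = 1" if "w \<in> V" for w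
    using h(1)[OF x that] by (simp add: algebra_simps)
  note up = on_column(1)[OF P x near_const[OF m]]
  have R1: "Point (l - 2) m" and R2: "Point (l - 1) m" by (simp_all add: lattice)
  have X: "Pt ?X (\<lambda>_. m)"
  proof (rule Pt_ruler[OF up R2 R1])
    fix w assume w: "w \<in> V"
    show "(?X w - (l - 63 / 64))\<^sup>2 + (m - (m + h x l w))\<^sup>2 = 1"
      using on_circle[OF w] by (simp add: power2_eq_square algebra_simps)
    show "\<exists>s. only_hit (l - 63 / 64) (m + h x l w) (l - 1) m (l - 2) m (?X w) m s"
      unfolding only_hit_def
      using near_bounds[OF x w] by (intro exI[of _ "l - 1 - ?X w"]) simp
  qed simp
  have top: "Pt x (\<lambda>w. m + 2 * h x l w)"
  proof (rule Pt_cong[OF Pt_extend[OF X up]])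
    fix w assume w: "w \<in> V"
    show "(?X w - (l - 63 / 64))\<^sup>2 + (m - (m + h x l w))\<^sup>2 = 1"
      using on_circle[OF w] by (simp add: power2_eq_square algebra_simps)
  qed simp
  have integer: "Pt x (\<lambda>w. m + of_int k)" for k
    using s.Pt_shift[of "\<lambda>_. m" x "\<lambda>w. 2 * h x l w" k] P top h[OF x] unfolding swap_Pt by fastforce
  show ?thesis
    unfolding Col_def
  proof (intro allI impI)
    fix y assume [simp]: "dyadic y"
    define k where "k = \<lfloor>y - m\<rfloor>"
    have k: "0 \<le> y - (m + of_int k)" "y - (m + of_int k) \<le> 1" unfolding k_def by linarith+
    have C: "Point (l - 1 / 2) y" and D: "Point (l + 1 / 2) y" by (simp_all add: lattice)
    show "Pt x (\<lambda>_. y)"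
    proof (rule Pt_cross[OF integer[of k] integer[of "k + 1"] C D])
      fix w assume w: "w \<in> V"
      define s t where "s = y - (m + of_int k)" and "t = x w - l + 1 / 2"
      have st: "0 \<le> s" "s\<^sup>2 \<le> 1" "0 \<le> t" "t\<^sup>2 \<le> 1"
        using k near_bounds[OF x w] by (auto simp: s_def t_def intro!: power_le_one)
      show "\<exists>s t. reaches (x w) (m + of_int k) (x w) (m + of_int (k + 1)) (x w) y s \<and>
        reaches (l - 1 / 2) y (l + 1 / 2) y (x w) y t"
      unfolding reaches_def
        by (rule exI[of _ s], rule exI[of _ t]) (use st in \<open>simp add: s_def[symmetric], simp add: s_def t_def\<close>)
    qed simp_all
  qed
qed

lemma swap_Col: "grid.Col G V Or v u x \<longleftrightarrow> Row x"
proof -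
  interpret s: grid G V Or v u by (rule grid_swap)
  show ?thesis by (simp add: s.Col_def Row_def swap_Pt)
qed

lemma swap_Row: "grid.Row G V Or v u x \<longleftrightarrow> Col x"
proof -
  interpret s: grid G V Or v u by (rule grid_swap)
  show ?thesis by (simp add: s.Row_def Col_def swap_Pt)
qed

text \<open>For points near the lattice, being known is the same as having a known column and a known row. The
converse is \<open>Pt_of_Col_Row\<close>.\<close>

lemma Col_of_Pt: "Pt x y \<Longrightarrow> near x l \<Longrightarrow> near y m \<Longrightarrow> Col x"
  using project_row column near_dyadic by blast

lemma Row_of_Pt:
  assumes "Pt x y" "near x l" "near y m" shows "Row y"
proof -
  interpret s: grid G V Or v u by (rule grid_swap)
  show ?thesis using s.Col_of_Pt[of y x m l] assms by (simp add: swap_Pt swap_Col s.near_def near_def)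
qed

lemma Pt_of_Col_Row:
  assumes x: "Col x" "near x l" and y: "Row y" "near y m"
  shows "Pt x y"
proof -
  have [simp]: "dyadic l" "dyadic m" using x y by (simp_all add: near_def)
  have A: "Pt x (\<lambda>_. m - 1 / 2)" and B: "Pt x (\<lambda>_. m + 1 / 2)" using x(1) by (simp_all add: Col_def)
  have C: "Pt (\<lambda>_. l - 1 / 2) y" and D: "Pt (\<lambda>_. l + 1 / 2) y" using y(1) by (simp_all add: Row_def)
  show ?thesis
  proof (rule Pt_cross[OF A B C D])
    fix w assume w: "w \<in> V"
    define s t where "s = y w - m + 1 / 2" and "t = x w - l + 1 / 2"
    have st: "0 \<le> s" "s\<^sup>2 \<le> 1" "0 \<le> t" "t\<^sup>2 \<le> 1"
      using near_bounds[OF x(2) w] near_bounds[OF y(2) w] by (auto simp: s_def t_def intro!: power_le_one)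
    show "\<exists>s t. reaches (x w) (m - 1 / 2) (x w) (m + 1 / 2) (x w) (y w) s \<and>
        reaches (l - 1 / 2) (y w) (l + 1 / 2) (y w) (x w) (y w) t"
      unfolding reaches_def
      by (rule exI[of _ s], rule exI[of _ t]) (use st in \<open>simp add: s_def[symmetric] t_def[symmetric], simp add: s_def t_def\<close>)
  qed simp_all
qed

end

section \<open>Arithmetic with small numbers\<close>

lemma abs_le_power2: "\<bar>x\<bar> \<le> a \<Longrightarrow> x\<^sup>2 \<le> (a::real)\<^sup>2"
  by (metis abs_ge_zero power2_abs power_mono)

context grid
begin

lemma near_zeroI: "(\<And>w. w \<in> V \<Longrightarrow> \<bar>x w\<bar> \<le> 1 / 128) \<Longrightarrow> near x 0"
  by (simp add: near_def)

lemma near_zeroD: "near x 0 \<Longrightarrow> w \<in> V \<Longrightarrow> \<bar>x w\<bar> \<le> 1 / 128"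
  by (simp add: near_def)

lemma unit_square_le: "0 \<le> (t::real) \<Longrightarrow> t \<le> 1 \<Longrightarrow> t\<^sup>2 \<le> 1"
  by (simp add: power_le_one)

text \<open>A line through \<open>(c, 1/4)\<close> takes the row \<open>y = 0\<close> to the row \<open>y = 1/2\<close> by a point reflection.\<close>

lemma Col_reflect:
  assumes x: "Col x" "near x l" and c: "dyadic c" "\<bar>c - l\<bar> \<le> 1 / 4"
  shows "Col (\<lambda>w. 2 * c - x w)"
proof -
  have [simp]: "dyadic l" "dyadic c" using x c by (simp_all add: near_def)
  have q [simp]: "dyadic (1 / 4)" using dyadic_divide_power[of 1 2] by simp
  have n: "near (\<lambda>w. 2 * c - x w) (2 * c - l)"
    using x(2) by (simp add: near_def abs_minus_commute)
  have A: "Pt x (\<lambda>_. 0)" using x(1) by (simp add: Col_def)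
  have B: "Point c (1 / 4)" and C: "Point (2 * c - l - 1 / 2) (1 / 2)"
    and D: "Point (2 * c - l + 1 / 2) (1 / 2)" by (simp_all add: lattice)
  have "Pt (\<lambda>w. 2 * c - x w) (\<lambda>_. 1 / 2)"
  proof (rule Pt_cross[OF A B C D])
    fix w assume w: "w \<in> V"
    have "\<bar>c - x w\<bar> \<le> 3 / 8" using near_bounds[OF x(2) w] c(2) by linarith
    then have "(c - x w)\<^sup>2 \<le> (3 / 8)\<^sup>2" by (rule abs_le_power2)
    then have len: "4 * ((c - x w)\<^sup>2 + (1 / 4 - 0)\<^sup>2) \<le> 1" by (simp add: power_divide)
    then show "(c - x w)\<^sup>2 + (1 / 4 - 0)\<^sup>2 \<le> 1" by simp
    define t where "t = l - x w + 1 / 2"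
    have t: "0 \<le> t" "t\<^sup>2 \<le> 1"
      using near_bounds[OF x(2) w] by (auto simp: t_def intro!: unit_square_le)
    show "\<exists>s t. reaches (x w) 0 c (1 / 4) (2 * c - x w) (1 / 2) s \<and>
        reaches (2 * c - l - 1 / 2) (1 / 2) (2 * c - l + 1 / 2) (1 / 2) (2 * c - x w) (1 / 2) t"
      unfolding reaches_def
      by (rule exI[of _ 2], rule exI[of _ t]) (use t len in \<open>simp, simp add: t_def\<close>)
  qed simp_all
  then show ?thesis by (rule column[OF _ n]) simp
qed

lemma Col_minus:
  assumes "Col x" "near x 0" shows "Col (\<lambda>w. - x w)"
  using Col_reflect[OF assms, of 0] by simp

text \<open>Translations by integers are made with sticks along the row; a remaining translation by at most
\<open>1/2\<close> is the composition of two reflections whose centres are half as far apart.\<close>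

lemma Col_shift:
  assumes x: "Col x" "near x l" and d: "dyadic d"
  shows "Col (\<lambda>w. x w + d)"
proof -
  have [simp]: "dyadic l" using x by (simp add: near_def)
  define k where "k = round d"
  have k: "\<bar>d - of_int k\<bar> \<le> 1 / 2"
    unfolding k_def using of_int_round_abs_le[of d] by (simp add: abs_minus_commute)
  have A: "Pt x (\<lambda>_. 0)" using x(1) by (simp add: Col_def)
  have B: "Pt (\<lambda>w. x w + (l + 1 / 2 - x w)) (\<lambda>_. 0)" by (simp add: lattice)
  have "Pt (\<lambda>w. x w + of_int k) (\<lambda>_. 0)"
    by (rule Pt_shift[OF A B]) (use near_bounds[OF x(2)] in force)
  moreover have n: "near (\<lambda>w. x w + of_int k) (l + of_int k)" using x(2) by (simp add: near_def)
  ultimately have "Col (\<lambda>w. x w + of_int k)" by (rule column) simp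
  then have "Col (\<lambda>w. 2 * (l + of_int k) - (x w + of_int k))" by (rule Col_reflect[OF _ n]) simp_all
  moreover have "near (\<lambda>w. 2 * (l + of_int k) - (x w + of_int k)) (l + of_int k)"
    using x(2) by (simp add: near_def abs_minus_commute)
  ultimately have "Col (\<lambda>w. 2 * (l + of_int k + (d - of_int k) / 2) - (2 * (l + of_int k) - (x w + of_int k)))"
    by (rule Col_reflect) (use k d in simp_all)
  then show ?thesis by (simp add: algebra_simps diff_divide_distrib)
qed

text \<open>The line from \<open>(x, 0)\<close> to \<open>(y, 1/2)\<close> crosses the middle row at the average. Together with doubling this
is addition.\<close>

lemma Col_average:
  assumes x: "Col x" "near x 0" and y: "Col y" "near y 0"
  shows "Col (\<lambda>w. (x w + y w) / 2)"
proof -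
  have q [simp]: "dyadic (1 / 4)" using dyadic_divide_power[of 1 2] by simp
  have A: "Pt x (\<lambda>_. 0)" and B: "Pt y (\<lambda>_. 1 / 2)" using x(1) y(1) by (simp_all add: Col_def)
  have C: "Point (- (1 / 2)) (1 / 4)" and D: "Point (1 / 2) (1 / 4)" by (simp_all add: lattice)
  have "Pt (\<lambda>w. (x w + y w) / 2) (\<lambda>_. 1 / 4)"
  proof (rule Pt_cross[OF A B C D])
    fix w assume w: "w \<in> V"
    note b = near_zeroD[OF x(2) w] near_zeroD[OF y(2) w]
    have "\<bar>y w - x w\<bar> \<le> 1 / 2" using b by linarith
    then have "(y w - x w)\<^sup>2 \<le> (1 / 2)\<^sup>2" by (rule abs_le_power2)
    then show len: "(y w - x w)\<^sup>2 + (1 / 2 - 0)\<^sup>2 \<le> 1" by (simp add: power_divide)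
    define t where "t = (x w + y w) / 2 + 1 / 2"
    have t: "0 \<le> t" "t \<le> 1"
      unfolding t_def using b unfolding abs_le_iff by (simp_all add: field_simps)
    then have "t\<^sup>2 \<le> 1" by (rule unit_square_le)
    note t = t(1) this
    show "\<exists>s t. reaches (x w) 0 (y w) (1 / 2) ((x w + y w) / 2) (1 / 4) s \<and>
        reaches (- (1 / 2)) (1 / 4) (1 / 2) (1 / 4) ((x w + y w) / 2) (1 / 4) t"
      unfolding reaches_def
      by (rule exI[of _ "1 / 2"], rule exI[of _ t])
        (use t len in \<open>simp add: power_divide, simp add: t_def field_simps\<close>)
  qed simp_all
  moreover have "near (\<lambda>w. (x w + y w) / 2) 0"
  proof (rule near_zeroI)
    fix w assume w: "w \<in> V"
    show "\<bar>(x w + y w) / 2\<bar> \<le> 1 / 128"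
      using near_zeroD[OF x(2) w] near_zeroD[OF y(2) w] unfolding abs_le_iff by (simp add: field_simps)
  qed
  ultimately show ?thesis by (rule column) simp
qed

lemma Col_half: "Col x \<Longrightarrow> near x 0 \<Longrightarrow> Col (\<lambda>w. x w / 2)"
  using Col_average[of x "\<lambda>_. 0"] by (simp add: Col_dyadic near_const)

lemma Col_double:
  assumes x: "Col x" and d: "near (\<lambda>w. 2 * x w) 0"
  shows "Col (\<lambda>w. 2 * x w)"
proof -
  have q [simp]: "dyadic (1 / 4)" using dyadic_divide_power[of 1 2] by simp
  have B: "Pt x (\<lambda>_. 1 / 4)" using x(1) by (simp add: Col_def)
  have A: "Point 0 (1 / 2)" and C: "Point (- (1 / 2)) 0" and D: "Point (1 / 2) 0"
    by (simp_all add: lattice)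
  have "Pt (\<lambda>w. 2 * x w) (\<lambda>_. 0)"
  proof (rule Pt_cross[OF A B C D])
    fix w assume w: "w \<in> V"
    have b: "\<bar>x w\<bar> \<le> 1 / 4" using near_zeroD[OF d w] by linarith
    then have "(x w)\<^sup>2 \<le> (1 / 4)\<^sup>2" by (rule abs_le_power2)
    then have len: "4 * ((x w - 0)\<^sup>2 + (1 / 4 - 1 / 2)\<^sup>2) \<le> 1" by (simp add: power2_eq_square)
    then show "(x w - 0)\<^sup>2 + (1 / 4 - 1 / 2)\<^sup>2 \<le> 1" by simp
    define t where "t = 2 * x w + 1 / 2"
    have t: "0 \<le> t" "t\<^sup>2 \<le> 1" unfolding t_def using b by (auto intro!: unit_square_le)
    show "\<exists>s t. reaches 0 (1 / 2) (x w) (1 / 4) (2 * x w) 0 s \<and>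
        reaches (- (1 / 2)) 0 (1 / 2) 0 (2 * x w) 0 t"
      unfolding reaches_def
      by (rule exI[of _ 2], rule exI[of _ t]) (use t len in \<open>simp, simp add: t_def\<close>)
  qed simp_all
  then show ?thesis by (rule column[OF _ d]) simp
qed

text \<open>The diagonal of the lattice exchanges columns and rows.\<close>

lemma Row_of_Col:
  assumes x: "Col x" "near x 0" shows "Row x"
proof -
  have q [simp]: "dyadic (1 / 4)" using dyadic_divide_power[of 1 2] by simp
  have A: "Point (- (1 / 4)) (- (1 / 4))" and B: "Point (1 / 4) (1 / 4)"
    by (simp_all add: lattice)
  have C: "Pt x (\<lambda>_. - (1 / 2))" and D: "Pt x (\<lambda>_. 1 / 2)" using x(1) by (simp_all add: Col_def)
  have "Pt x x"
  proof (rule Pt_cross[OF A B C D])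
    fix w assume w: "w \<in> V"
    define s t where "s = 2 * x w + 1 / 2" and "t = x w + 1 / 2"
    have st: "0 \<le> s" "s\<^sup>2 \<le> 1" "0 \<le> t" "t\<^sup>2 \<le> 1"
      unfolding s_def t_def using near_zeroD[OF x(2) w] by (auto intro!: unit_square_le)
    show "\<exists>s t. reaches (- (1 / 4)) (- (1 / 4)) (1 / 4) (1 / 4) (x w) (x w) s \<and>
        reaches (x w) (- (1 / 2)) (x w) (1 / 2) (x w) (x w) t"
      unfolding reaches_def
      by (rule exI[of _ s], rule exI[of _ t])
        (use st in \<open>simp add: power2_eq_square[of "1 / 2"], simp add: s_def t_def field_simps\<close>)
  qed (simp_all add: power2_eq_square)
  then show ?thesis using Row_of_Pt x(2) by blast
qed

lemma Col_of_Row: "Row x \<Longrightarrow> near x 0 \<Longrightarrow> Col x"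
proof -
  interpret s: grid G V Or v u by (rule grid_swap)
  show "Row x \<Longrightarrow> near x 0 \<Longrightarrow> Col x"
    using s.Row_of_Col[of x] by (simp add: swap_Col swap_Row s.near_def near_def)
qed

lemma Row_shift: "Row x \<Longrightarrow> near x l \<Longrightarrow> dyadic d \<Longrightarrow> Row (\<lambda>w. x w + d)"
proof -
  interpret s: grid G V Or v u by (rule grid_swap)
  show "Row x \<Longrightarrow> near x l \<Longrightarrow> dyadic d \<Longrightarrow> Row (\<lambda>w. x w + d)"
    using s.Col_shift[of x l d] by (simp add: swap_Col s.near_def near_def)
qed

text \<open>The line from \<open>(0, 1/2)\<close> to \<open>(x, 0)\<close> meets the row at height \<open>y\<close> at \<open>x * (1 - 2 * y)\<close>, whose average with
\<open>- x\<close> is \<open>- x * y\<close>.\<close>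

lemma Col_minus_product:
  assumes x: "Col x" "\<And>w. w \<in> V \<Longrightarrow> \<bar>x w\<bar> \<le> 1 / 256"
    and y: "Col y" "\<And>w. w \<in> V \<Longrightarrow> \<bar>y w\<bar> \<le> 1 / 256"
  shows "Col (\<lambda>w. - (x w * y w))"
proof -
  have nx: "near x 0" and ny: "near y 0" by (rule near_zeroI; use x(2) y(2) in force)+
  have Ry: "Row y" by (rule Row_of_Col[OF y(1) ny])
  have A: "Point 0 (1 / 2)" by (simp add: lattice)
  have B: "Pt x (\<lambda>_. 0)" using x(1) by (simp add: Col_def)
  have C: "Pt (\<lambda>_. - (1 / 2)) y" and D: "Pt (\<lambda>_. 1 / 2) y" using Ry by (simp_all add: Row_def)
  have b: "\<bar>x w * (1 - 2 * y w)\<bar> \<le> 1 / 128" if "w \<in> V" for w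
  proof -
    have "\<bar>x w\<bar> * \<bar>1 - 2 * y w\<bar> \<le> 1 / 256 * 2"
      by (rule mult_mono) (use x(2)[OF that] y(2)[OF that] in auto)
    then show ?thesis by (simp add: abs_mult)
  qed
  have "Pt (\<lambda>w. x w * (1 - 2 * y w)) y"
  proof (rule Pt_cross[OF A B C D])
    fix w assume w: "w \<in> V"
    have "(x w)\<^sup>2 \<le> (1 / 2)\<^sup>2" by (rule abs_le_power2) (use x(2)[OF w] in simp)
    then have len: "(x w - 0)\<^sup>2 + (0 - 1 / 2)\<^sup>2 \<le> 1 / 2" by (simp add: power2_eq_square)
    then show "(x w - 0)\<^sup>2 + (0 - 1 / 2)\<^sup>2 \<le> 1" by simp
    have s: "0 \<le> 1 - 2 * y w" "1 - 2 * y w \<le> 5 / 4" using y(2)[OF w] by (auto simp: abs_le_iff)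
    have "(1 - 2 * y w)\<^sup>2 \<le> (5 / 4)\<^sup>2" by (rule power_mono) (use s in auto)
    then have "(1 - 2 * y w)\<^sup>2 * ((x w - 0)\<^sup>2 + (0 - 1 / 2)\<^sup>2) \<le> (5 / 4)\<^sup>2 * (1 / 2)"
      by (rule mult_mono) (use len in auto)
    then have s2: "(1 - 2 * y w)\<^sup>2 * ((x w - 0)\<^sup>2 + (0 - 1 / 2)\<^sup>2) \<le> 1" by (simp add: power_divide)
    define t where "t = x w * (1 - 2 * y w) + 1 / 2"
    have t: "0 \<le> t" "t\<^sup>2 \<le> 1" unfolding t_def using b[OF w] by (auto simp: abs_le_iff intro!: unit_square_le)
    show "\<exists>s t. reaches 0 (1 / 2) (x w) 0 (x w * (1 - 2 * y w)) (y w) s \<and>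
        reaches (- (1 / 2)) (y w) (1 / 2) (y w) (x w * (1 - 2 * y w)) (y w) t"
      unfolding reaches_def
      by (rule exI[of _ "1 - 2 * y w"], rule exI[of _ t], intro conjI s s2)
        (use t in \<open>simp_all add: t_def diff_divide_distrib\<close>)
  qed simp_all
  moreover have n: "near (\<lambda>w. x w * (1 - 2 * y w)) 0" by (rule near_zeroI) (rule b)
  ultimately have "Col (\<lambda>w. x w * (1 - 2 * y w))" using Col_of_Pt ny by blast
  moreover have "near (\<lambda>w. - x w) 0" using nx by (simp add: near_def)
  ultimately have "Col (\<lambda>w. (x w * (1 - 2 * y w) + - x w) / 2)"
    using Col_average[OF _ n Col_minus[OF x(1) nx]] by blast
  then show ?thesis by (simp add: algebra_simps)
qed

lemma Col_product:
  assumes "Col x" "\<And>w. w \<in> V \<Longrightarrow> \<bar>x w\<bar> \<le> 1 / 256"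
    and "Col y" "\<And>w. w \<in> V \<Longrightarrow> \<bar>y w\<bar> \<le> 1 / 256"
  shows "Col (\<lambda>w. x w * y w)"
proof -
  have "near (\<lambda>w. - (x w * y w)) 0"
  proof (rule near_zeroI)
    fix w assume w: "w \<in> V"
    have "\<bar>x w\<bar> * \<bar>y w\<bar> \<le> 1 / 256 * (1 / 256)"
      by (rule mult_mono) (use assms(2,4)[OF w] in auto)
    then show "\<bar>- (x w * y w)\<bar> \<le> 1 / 128" by (simp add: abs_mult)
  qed
  from Col_minus[OF Col_minus_product[OF assms] this] show ?thesis by simp
qed

text \<open>Comparing the distance from \<open>(c - 1, 0)\<close> with the unit decides \<open>x \<le> c\<close>.\<close>

lemma can_Col_le:
  assumes x: "Col x" "near x 0" and c: "dyadic c" "\<bar>c\<bar> \<le> 1 / 2"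
    and le: "can G {w \<in> V. x w \<le> c} Q" and gt: "can G {w \<in> V. x w > c} Q"
  shows "can G V Q"
proof (rule Pt_compare)
  show "Pt x (\<lambda>_. 0)" "Point (c - 1) 0" using x(1) c by (simp_all add: Col_def lattice)
  have eq: "(x w - (c - 1))\<^sup>2 + (0 - 0)\<^sup>2 \<le> 1 \<longleftrightarrow> x w \<le> c" if "w \<in> V" for w
    using near_zeroD[OF x(2) that] c(2) by (simp add: abs_square_le_1 abs_le_iff)
  show "can G {w \<in> V. (x w - (c - 1))\<^sup>2 + (0 - 0)\<^sup>2 \<le> 1} Q"
    by (rule can_subset[OF le]) (use eq in blast)
  show "can G {w \<in> V. (x w - (c - 1))\<^sup>2 + (0 - 0)\<^sup>2 > 1} Q"
    by (rule can_subset[OF gt]) (use eq in \<open>auto simp: not_le[symmetric]\<close>)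
qed

text \<open>The unit circle computes \<open>sqrt (1 - n\<^sup>2)\<close>, and \<open>n = (1 - q) / (1 + q)\<close> gives
\<open>sqrt (1 - n\<^sup>2) = 2 * sqrt q / (1 + q)\<close>. Both the division in \<open>n = 1 - 2 * q / (1 + q)\<close> and the
multiplication by \<open>1 + q\<close> afterwards are made with lines through the point \<open>(0, (1 + q) / 4)\<close>.
All numbers stay near the lattice: \<open>n\<close> is near \<open>1\<close>, and the bound on \<open>q\<close> makes the root at most
\<open>1/256\<close>.\<close>

lemma Col_sqrt:
  assumes q: "Col q" "\<And>w. w \<in> V \<Longrightarrow> 0 \<le> q w \<and> q w \<le> 1 / 65536"
  shows "Col (\<lambda>w. 2 * sqrt (q w))"
proof -
  have [simp]: "dyadic (1 / 4)" using dyadic_divide_power[of 1 2] by simp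
  have q': "0 \<le> q w" "q w \<le> 1 / 65536" "0 < 1 + q w" if "w \<in> V" for w
    using q(2)[OF that] by auto
  have n: "near q 0" "near (\<lambda>w. q w / 2) 0" "near (\<lambda>w. q w / 4) 0" "near (\<lambda>w. - q w) 0"
    by (rule near_zeroI; use q' in force)+
  have q4: "Col (\<lambda>w. q w / 4)"
    using Col_half[OF Col_half[OF q(1) n(1)] n(2)] by simp
  have R0: "Row (\<lambda>w. q w / 4)" by (rule Row_of_Col[OF q4 n(3)])
  have R1: "Row (\<lambda>w. q w / 4 + 1 / 4)" by (rule Row_shift[OF R0 n(3)]) simp
  have R2: "Row (\<lambda>w. q w / 4 - 1 / 4)" using Row_shift[OF R0 n(3), of "- (1 / 4)"] by simp
  have A: "Pt (\<lambda>_. 0) (\<lambda>w. q w / 4 + 1 / 4)" using R1 by (simp add: Row_def)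
  have B: "Pt (\<lambda>w. - q w) (\<lambda>_. 0)" using Col_minus[OF q(1) n(1)] by (simp add: Col_def)
  have C: "Pt (\<lambda>_. - (1 / 2)) (\<lambda>w. q w / 4 - 1 / 4)" and D: "Pt (\<lambda>_. 1 / 2) (\<lambda>w. q w / 4 - 1 / 4)"
    using R2 by (simp_all add: Row_def)
  define s where "s = (\<lambda>w. 2 * q w / (1 + q w))"
  have s: "0 \<le> s w" "s w \<le> 1 / 128" "s w * (1 + q w) = 2 * q w" if "w \<in> V" for w
    using q'[OF that] by (simp_all add: s_def field_simps)
  \<comment> \<open>Heights \<open>(1 + q) / 4\<close> and \<open>(q - 1) / 4\<close> differ by \<open>1/2\<close>, so the offset \<open>- q\<close> on the axis grows by the factor \<open>2 / (1 + q)\<close>.\<close>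
  have "Pt (\<lambda>w. - s w) (\<lambda>w. q w / 4 - 1 / 4)"
  proof (rule Pt_cross[OF A B C D])
    fix w assume w: "w \<in> V"
    have len: "(- q w - 0)\<^sup>2 + (0 - (q w / 4 + 1 / 4))\<^sup>2 = (q w)\<^sup>2 + ((1 + q w) / 4)\<^sup>2"
      by (simp add: power2_eq_square field_simps)
    have "(q w)\<^sup>2 \<le> (1 / 2)\<^sup>2" "((1 + q w) / 4)\<^sup>2 \<le> (1 / 2)\<^sup>2"
      by (rule power_mono; use q'[OF w] in simp)+
    then show "(- q w - 0)\<^sup>2 + (0 - (q w / 4 + 1 / 4))\<^sup>2 \<le> 1" unfolding len by (simp add: power_divide)
    show "(- q w - 0) * (q w / 4 - 1 / 4 - (q w / 4 - 1 / 4)) \<noteq>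
        (0 - (q w / 4 + 1 / 4)) * (1 / 2 - - (1 / 2))"
      using q'[OF w] by simp
    define r where "r = 2 / (1 + q w)"
    have r: "0 \<le> r" "r * (1 + q w) = 2" "r * q w = s w" using q'[OF w] by (simp_all add: r_def s_def field_simps)
    have "r\<^sup>2 * ((q w)\<^sup>2 + ((1 + q w) / 4)\<^sup>2) = (r * q w)\<^sup>2 + (r * (1 + q w))\<^sup>2 / 16"
      by (simp only: power_mult_distrib power_divide distrib_left[of "r\<^sup>2"] times_divide_eq_right) simp
    also have "\<dots> \<le> (1 / 128)\<^sup>2 + 1 / 4"
      unfolding r(2,3) using power_mono[OF s(2,1)[OF w], of 2] by simp
    finally have r2: "r\<^sup>2 * ((- q w - 0)\<^sup>2 + (0 - (q w / 4 + 1 / 4))\<^sup>2) \<le> 1"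
      unfolding len by (simp add: power_divide)
    define t where "t = 1 / 2 - s w"
    have t: "0 \<le> t" "t\<^sup>2 \<le> 1" unfolding t_def using s[OF w] by (auto intro!: unit_square_le)
    have "q w / 4 + 1 / 4 + r * (0 - (q w / 4 + 1 / 4)) = (1 + q w) / 4 - r * (1 + q w) / 4"
      by (simp add: algebra_simps add_divide_distrib)
    then have y: "q w / 4 - 1 / 4 = q w / 4 + 1 / 4 + r * (0 - (q w / 4 + 1 / 4))"
      unfolding r(2) by (simp add: add_divide_distrib)
    show "\<exists>r t. reaches 0 (q w / 4 + 1 / 4) (- q w) 0 (- s w) (q w / 4 - 1 / 4) r \<and>
        reaches (- (1 / 2)) (q w / 4 - 1 / 4) (1 / 2) (q w / 4 - 1 / 4) (- s w) (q w / 4 - 1 / 4) t"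
      unfolding reaches_def
      by (rule exI[of _ r], rule exI[of _ t], intro conjI r(1) r2 y)
        (use t r(3) in \<open>simp_all add: t_def\<close>)
  qed simp_all
  moreover have ns: "near (\<lambda>w. - s w) 0" by (rule near_zeroI) (use s in force)
  moreover have "near (\<lambda>w. q w / 4 - 1 / 4) (- (1 / 4))" using n(3) by (simp add: near_def)
  ultimately have "Col (\<lambda>w. - s w)" using Col_of_Pt by blast
  then have "Row (\<lambda>w. - s w)" by (rule Row_of_Col[OF _ ns])
  then have "Row (\<lambda>w. - s w + 1)" by (rule Row_shift[OF _ ns]) simp
  then have N: "Pt (\<lambda>_. 0) (\<lambda>w. 1 - s w)" by (simp add: Row_def)
  have O: "Point 0 0" and U: "Point 1 0" by (simp_all add: lattice)
  define a where "a = (\<lambda>w. 2 * sqrt (q w) / (1 + q w))"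
  have root: "0 \<le> sqrt (q w)" "sqrt (q w) \<le> 1 / 256" if "w \<in> V" for w
  proof -
    show "0 \<le> sqrt (q w)" using q'[OF that] by simp
    show "sqrt (q w) \<le> 1 / 256" by (rule real_le_lsqrt) (use q'[OF that] in \<open>simp_all add: power_divide\<close>)
  qed
  have a: "0 \<le> a w" "a w * (1 + q w) = 2 * sqrt (q w)" "a w \<le> 1 / 128" if "w \<in> V" for w
  proof -
    show a: "0 \<le> a w" "a w * (1 + q w) = 2 * sqrt (q w)" using q'[OF that] by (simp_all add: a_def)
    have "a w * 1 \<le> a w * (1 + q w)" by (rule mult_left_mono) (use q'[OF that] a in auto)
    then show "a w \<le> 1 / 128" using a root[OF that] by simp
  qed
  have a_circle: "(a w)\<^sup>2 + (1 - s w)\<^sup>2 = 1" if "w \<in> V" for w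
  proof -
    have "1 - s w = (1 - q w) / (1 + q w)" using q'[OF that] by (simp add: s_def field_simps)
    then have "(a w)\<^sup>2 + (1 - s w)\<^sup>2 = (4 * q w + (1 - q w)\<^sup>2) / (1 + q w)\<^sup>2"
      using q'[OF that] by (simp add: a_def power_divide power_mult_distrib add_divide_distrib)
    also have "4 * q w + (1 - q w)\<^sup>2 = (1 + q w)\<^sup>2" by (simp add: power2_eq_square algebra_simps)
    finally show ?thesis using q'[OF that] by simp
  qed
  have "Pt a (\<lambda>_. 0)"
  proof (rule Pt_ruler[OF N O U])
    fix w assume w: "w \<in> V"
    show "(a w - 0)\<^sup>2 + (0 - (1 - s w))\<^sup>2 = 1"
      using a_circle[OF w] by (simp add: power2_commute[of "1 :: real"])
    show "\<exists>r. only_hit 0 (1 - s w) 0 0 1 0 (a w) 0 r"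
      unfolding only_hit_def
      using a[OF w] by (intro exI[of _ "a w"]) auto
  qed simp
  moreover have na: "near a 0" by (rule near_zeroI) (use a in force)
  ultimately have "Col a" by (rule column) simp
  then have E: "Pt a (\<lambda>w. q w / 4)" by (rule Pt_of_Col_Row[OF _ na R0 n(3)])
  have C: "Point (- (1 / 2)) 0" and D: "Point (1 / 2) 0" by (simp_all add: lattice)
  \<comment> \<open>The height \<open>q / 4\<close> is \<open>1/4\<close> below the centre of the projection and the axis is \<open>(1 + q) / 4\<close> below it, so the offset is multiplied by \<open>1 + q\<close>.\<close>
  have "Pt (\<lambda>w. 2 * sqrt (q w)) (\<lambda>_. 0)"
  proof (rule Pt_cross[OF A E C D])
    fix w assume w: "w \<in> V"
    have len: "(a w - 0)\<^sup>2 + (q w / 4 - (q w / 4 + 1 / 4))\<^sup>2 = (a w)\<^sup>2 + 1 / 16"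
      by (simp add: power_divide)
    have a2: "(a w)\<^sup>2 \<le> (1 / 128)\<^sup>2" by (rule power_mono[OF a(3,1)[OF w]])
    then show "(a w - 0)\<^sup>2 + (q w / 4 - (q w / 4 + 1 / 4))\<^sup>2 \<le> 1"
      unfolding len by (simp add: power_divide)
    have "(1 + q w)\<^sup>2 \<le> 2\<^sup>2" by (rule power_mono) (use q'[OF w] in auto)
    then have "(1 + q w)\<^sup>2 * ((a w)\<^sup>2 + 1 / 16) \<le> 2\<^sup>2 * ((1 / 128)\<^sup>2 + 1 / 16)"
      by (rule mult_mono) (use a2 in auto)
    then have s2: "(1 + q w)\<^sup>2 * ((a w - 0)\<^sup>2 + (q w / 4 - (q w / 4 + 1 / 4))\<^sup>2) \<le> 1"
      unfolding len by (simp add: power_divide)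
    define t where "t = 2 * sqrt (q w) + 1 / 2"
    have t: "0 \<le> t" "t\<^sup>2 \<le> 1" unfolding t_def using root[OF w] by (auto intro!: unit_square_le)
    have y: "0 = q w / 4 + 1 / 4 + (1 + q w) * (q w / 4 - (q w / 4 + 1 / 4))"
      by (simp add: field_simps)
    show "\<exists>s t. reaches 0 (q w / 4 + 1 / 4) (a w) (q w / 4) (2 * sqrt (q w)) 0 s \<and>
        reaches (- (1 / 2)) 0 (1 / 2) 0 (2 * sqrt (q w)) 0 t"
      unfolding reaches_def
      by (rule exI[of _ "1 + q w"], rule exI[of _ t], intro conjI s2 y)
        (use t q'[OF w] a(2)[OF w] in \<open>simp_all add: t_def mult.commute\<close>)
  qed simp_all
  moreover have "near (\<lambda>w. 2 * sqrt (q w)) 0" by (rule near_zeroI) (use root in force)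
  ultimately show ?thesis by (rule column) simp
qed

end

section \<open>The equation for the intersection points\<close>

context grid
begin

lemma Col_halves:
  assumes "Col x" "near x 0" shows "Col (\<lambda>w. x w / 2 ^ N)" "near (\<lambda>w. x w / 2 ^ N) 0"
proof (induction N)
  case (Suc N)
  { case 1
    show ?case using Col_half[OF Suc] by (simp add: mult.commute) }
  { case 2
    have "\<bar>x w / 2 ^ Suc N\<bar> \<le> 1 / 128" if "w \<in> V" for w
      using near_zeroD[OF Suc(2) that] by simp
    then show ?case by (rule near_zeroI) }
qed (use assms in simp_all)

text \<open>All intermediate results are smaller than the last one, which alone has to be assumed small.\<close>

lemma Col_doubles:
  assumes "Col x" "near (\<lambda>w. 2 ^ N * x w) 0" shows "Col (\<lambda>w. 2 ^ N * x w)"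
proof -
  have "Col (\<lambda>w. 2 ^ n * x w)" if "n \<le> N" for n
    using that
  proof (induction n)
    case (Suc n)
    have "near (\<lambda>w. 2 * (2 ^ n * x w)) 0"
    proof (rule near_zeroI)
      fix w assume w: "w \<in> V"
      have "(2::real) ^ Suc n \<le> 2 ^ N" by (rule power_increasing) (use Suc.prems in auto)
      then have "2 ^ Suc n * \<bar>x w\<bar> \<le> 2 ^ N * \<bar>x w\<bar>" by (rule mult_right_mono) simp
      then show "\<bar>2 * (2 ^ n * x w)\<bar> \<le> 1 / 128"
        using near_zeroD[OF assms(2) w] by (simp add: abs_mult)
    qed
    from Col_double[OF _ this] Suc show ?case by (simp add: mult.assoc)
  qed (use assms(1) in simp)
  then show ?thesis by simp
qed

lemma near_sub: "near x l \<Longrightarrow> near (\<lambda>w. x w - l) 0"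
  by (simp add: near_def)

lemma Col_scale:
  assumes x: "Col x" "near x l" shows "Col (\<lambda>w. x w / 2 ^ N)"
proof -
  have l: "dyadic l" by (rule near_dyadic[OF x(2)])
  have "Col (\<lambda>w. x w - l)" using Col_shift[OF x, of "- l"] l by simp
  note halves = Col_halves[OF this near_sub[OF x(2)], of N]
  show ?thesis using Col_shift[OF halves, of "l / 2 ^ N"] l by (simp add: diff_divide_distrib)
qed

lemma Row_scale: "Row x \<Longrightarrow> near x l \<Longrightarrow> Row (\<lambda>w. x w / 2 ^ N)"
proof -
  interpret s: grid G V Or v u by (rule grid_swap)
  show "Row x \<Longrightarrow> near x l \<Longrightarrow> Row (\<lambda>w. x w / 2 ^ N)"
    using s.Col_scale[of x l N] by (simp add: swap_Col s.near_def near_def)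
qed

lemma small_scaled:
  assumes "near x l" "1024 * (\<bar>l\<bar> + 1) \<le> 2 ^ N" "w \<in> V"
  shows "\<bar>x w / 2 ^ N\<bar> \<le> 1 / 1024"
proof -
  have "\<bar>x w\<bar> \<le> \<bar>l\<bar> + 1" using near_bounds[OF assms(1,3)] by linarith
  then have "1024 * \<bar>x w\<bar> \<le> 1024 * (\<bar>l\<bar> + 1)" by simp
  also note assms(2)
  finally have "1024 * \<bar>x w\<bar> \<le> 2 ^ N" .
  then show ?thesis by (simp add: field_simps)
qed

text \<open>The scaled number determines an unbounded one. It is not doubled directly, since it would leave the
range of the arithmetic. Instead the scaled lattice point is subtracted first, so that the number that is
doubled is the offset from \<open>l\<close>.\<close>

lemma unscale:
  assumes x: "Col x" "near x 0" and l: "near (\<lambda>w. 2 ^ M * x w) l"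
  shows "Pt (\<lambda>w. 2 ^ M * x w) (\<lambda>_. 0)"
proof -
  have [simp]: "dyadic l" by (rule near_dyadic[OF l])
  have "Col (\<lambda>w. x w + - (l / 2 ^ M))" by (rule Col_shift[OF x]) simp
  then have C: "Col (\<lambda>w. x w - l / 2 ^ M)" by simp
  have eq: "2 ^ M * (x w - l / 2 ^ M) = 2 ^ M * x w - l" for w by (simp add: field_simps)
  have "Col (\<lambda>w. 2 ^ M * x w - l)" using Col_doubles[OF C, of M] near_sub[OF l] unfolding eq by blast
  from Col_shift[OF this near_sub[OF l], of l] show ?thesis by (simp add: Col_def)
qed

text \<open>The numbers to be squared are halved, because an average takes one line and a sum would take two; the
factors of \<open>2\<close> that accumulate are absorbed into the scale.\<close>

lemma discriminant:
  assumes Z: "Pt z1 z2" "near z1 l1" "near z2 l2" and S: "Pt s1 s2" "near s1 l3" "near s2 l4"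
    and N: "1024 * (\<bar>l1\<bar> + 1) \<le> 2 ^ N" "1024 * (\<bar>l2\<bar> + 1) \<le> 2 ^ N"
      "1024 * (\<bar>l3\<bar> + 1) \<le> 2 ^ N" "1024 * (\<bar>l4\<bar> + 1) \<le> 2 ^ N"
  shows "Col (\<lambda>w. ((s1 w - z1 w)\<^sup>2 + (s2 w - z2 w)\<^sup>2 - (z2 w)\<^sup>2) / (4 * 2 ^ N)\<^sup>2)"
    and "\<And>w. w \<in> V \<Longrightarrow> \<bar>((s1 w - z1 w)\<^sup>2 + (s2 w - z2 w)\<^sup>2 - (z2 w)\<^sup>2) / (4 * 2 ^ N)\<^sup>2\<bar> \<le> 1 / 65536"
proof -
  define a b c d where "a = (\<lambda>w. z1 w / 2 ^ N)" and "b = (\<lambda>w. z2 w / 2 ^ N)"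
    and "c = (\<lambda>w. s1 w / 2 ^ N)" and "d = (\<lambda>w. s2 w / 2 ^ N)"
  have small: "\<bar>a w\<bar> \<le> 1 / 1024" "\<bar>b w\<bar> \<le> 1 / 1024" "\<bar>c w\<bar> \<le> 1 / 1024" "\<bar>d w\<bar> \<le> 1 / 1024"
    if "w \<in> V" for w
    unfolding a_def b_def c_def d_def
    using small_scaled[OF Z(2) N(1) that] small_scaled[OF Z(3) N(2) that]
      small_scaled[OF S(2) N(3) that] small_scaled[OF S(3) N(4) that] .
  have na: "near a 0" "near b 0" "near c 0" "near d 0"
    by (rule near_zeroI; drule small; linarith)+
  have Ca: "Col a" and Cc: "Col c"
    unfolding a_def c_def
    by (rule Col_scale[OF Col_of_Pt[OF Z] Z(2)] Col_scale[OF Col_of_Pt[OF S] S(2)])+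
  have "Row b" "Row d"
    unfolding b_def d_def
    by (rule Row_scale[OF Row_of_Pt[OF Z] Z(3)] Row_scale[OF Row_of_Pt[OF S] S(3)])+
  then have Cb: "Col b" and Cd: "Col d" using Col_of_Row na by blast+
  define e f g where "e = (\<lambda>w. (c w + - a w) / 2)" and "f = (\<lambda>w. (d w + - b w) / 2)"
    and "g = (\<lambda>w. b w / 2)"
  have nm: "near (\<lambda>w. - a w) 0" "near (\<lambda>w. - b w) 0" using na by (simp_all add: near_def)
  have C: "Col e" "Col f" "Col g"
    unfolding e_def f_def g_def
    by (rule Col_average[OF Cc na(3) Col_minus[OF Ca na(1)] nm(1)]
        Col_average[OF Cd na(4) Col_minus[OF Cb na(2)] nm(2)] Col_half[OF Cb na(2)])+
  have s': "\<bar>e w\<bar> \<le> 1 / 256" "\<bar>f w\<bar> \<le> 1 / 256" "\<bar>g w\<bar> \<le> 1 / 256" if "w \<in> V" for w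
    using small[OF that] unfolding e_def f_def g_def abs_le_iff by (simp_all add: field_simps)
  have sq: "\<bar>x w * x w\<bar> \<le> 1 / 65536" if "\<bar>x w\<bar> \<le> 1 / 256" for x :: "'w \<Rightarrow> real" and w
    using mult_mono[OF that that] by (simp add: abs_mult)
  have Cp: "Col (\<lambda>w. e w * e w)" "Col (\<lambda>w. f w * f w)" "Col (\<lambda>w. - (g w * g w))"
    by (rule Col_product[OF C(1) _ C(1)] Col_product[OF C(2) _ C(2)] Col_minus_product[OF C(3) _ C(3)];
        use s' in blast)+
  have b: "\<bar>e w * e w\<bar> \<le> 1 / 65536" "\<bar>f w * f w\<bar> \<le> 1 / 65536" "\<bar>g w * g w\<bar> \<le> 1 / 65536" if "w \<in> V" for w
    using sq s'[OF that] by blast+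
  have np: "near (\<lambda>w. e w * e w) 0" "near (\<lambda>w. f w * f w) 0" "near (\<lambda>w. - (g w * g w)) 0"
    by (rule near_zeroI; drule b; linarith)+
  have Cr: "Col (\<lambda>w. (e w * e w + f w * f w) / 2)" by (rule Col_average[OF Cp(1) np(1) Cp(2) np(2)])
  have Ct: "Col (\<lambda>w. - (g w * g w) / 2)" by (rule Col_half[OF Cp(3) np(3)])
  have "\<bar>(e w * e w + f w * f w) / 2\<bar> \<le> 1 / 128" "\<bar>- (g w * g w) / 2\<bar> \<le> 1 / 128" if "w \<in> V" for w
    using b[OF that] unfolding abs_le_iff by (simp_all add: field_simps)
  then have nr: "near (\<lambda>w. (e w * e w + f w * f w) / 2) 0" "near (\<lambda>w. - (g w * g w) / 2) 0"
    by (auto intro: near_zeroI)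
  have "Col (\<lambda>w. ((e w * e w + f w * f w) / 2 + - (g w * g w) / 2) / 2)"
    by (rule Col_average[OF Cr nr(1) Ct nr(2)])
  moreover have eq: "((e w * e w + f w * f w) / 2 + - (g w * g w) / 2) / 2 =
      ((s1 w - z1 w)\<^sup>2 + (s2 w - z2 w)\<^sup>2 - (z2 w)\<^sup>2) / (4 * 2 ^ N)\<^sup>2" for w
  proof -
    have efg: "e w = (s1 w - z1 w) / (2 * 2 ^ N)" "f w = (s2 w - z2 w) / (2 * 2 ^ N)" "g w = z2 w / (2 * 2 ^ N)"
      by (simp_all add: e_def f_def g_def a_def b_def c_def d_def diff_divide_distrib mult.commute)
    have "((A / (2 * M) * (A / (2 * M)) + B / (2 * M) * (B / (2 * M))) / 2 +
        - (C / (2 * M) * (C / (2 * M))) / 2) / 2 = (A\<^sup>2 + B\<^sup>2 - C\<^sup>2) / (4 * M)\<^sup>2"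
      if "M \<noteq> 0" for A B C M :: real
      using that by (simp add: field_simps power2_eq_square)
    note generic = this
    show ?thesis unfolding efg by (rule generic) simp
  qed
  ultimately show "Col (\<lambda>w. ((s1 w - z1 w)\<^sup>2 + (s2 w - z2 w)\<^sup>2 - (z2 w)\<^sup>2) / (4 * 2 ^ N)\<^sup>2)"
    by (simp only: eq)
  show "\<bar>((s1 w - z1 w)\<^sup>2 + (s2 w - z2 w)\<^sup>2 - (z2 w)\<^sup>2) / (4 * 2 ^ N)\<^sup>2\<bar> \<le> 1 / 65536"
    if "w \<in> V" for w
    unfolding eq[symmetric] using b[OF that] unfolding abs_le_iff by (simp add: field_simps)
qed

text \<open>The solutions of \<open>(x - z)\<^sup>2 = D\<close>, scaled by a further factor \<open>4\<close> to match the root of the scaled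
discriminant.\<close>

lemma scaled_solutions:
  assumes z: "Col z" "near z l" and N: "1024 * (\<bar>l\<bar> + 1) \<le> 2 ^ N"
    and D: "Col (\<lambda>w. D w / (4 * 2 ^ N)\<^sup>2)" "\<And>w. w \<in> V \<Longrightarrow> 0 \<le> D w"
      "\<And>w. w \<in> V \<Longrightarrow> \<bar>D w / (4 * 2 ^ N)\<^sup>2\<bar> \<le> 1 / 65536"
  shows "Col (\<lambda>w. (z w + sqrt (D w)) / 2 ^ (N + 2))" "near (\<lambda>w. (z w + sqrt (D w)) / 2 ^ (N + 2)) 0"
    "Col (\<lambda>w. (z w - sqrt (D w)) / 2 ^ (N + 2))" "near (\<lambda>w. (z w - sqrt (D w)) / 2 ^ (N + 2)) 0"
proof -
  have root: "sqrt (D w / (4 * 2 ^ N)\<^sup>2) = sqrt (D w) / (4 * 2 ^ N)" for w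
    unfolding real_sqrt_divide real_sqrt_abs by simp
  define r where "r = (\<lambda>w. 2 * sqrt (D w / (4 * 2 ^ N)\<^sup>2))"
  have Cr: "Col r" unfolding r_def by (rule Col_sqrt[OF D(1)]) (use D in force)
  have r: "\<bar>r w\<bar> \<le> 1 / 128" if "w \<in> V" for w
  proof -
    have "sqrt (D w / (4 * 2 ^ N)\<^sup>2) \<le> 1 / 256"
      by (rule real_le_lsqrt) (use D(3)[OF that] in \<open>simp_all add: power_divide abs_le_iff\<close>)
    then show ?thesis using D(2)[OF that] by (simp add: r_def)
  qed
  define y where "y = (\<lambda>w. z w / 2 ^ N / 2)"
  have nz: "near (\<lambda>w. z w / 2 ^ N) 0"
    by (rule near_zeroI) (use small_scaled[OF z(2) N] in force)
  have Cy: "Col y" unfolding y_def by (rule Col_half[OF Col_scale[OF z] nz])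
  have y: "\<bar>y w\<bar> \<le> 1 / 1024" if "w \<in> V" for w
    using small_scaled[OF z(2) N that] by (simp add: y_def)
  have n: "near r 0" "near (\<lambda>w. - r w) 0" "near y 0"
    by (rule near_zeroI; use r y in force)+
  have eq: "(y w + r w) / 2 = (z w + sqrt (D w)) / 2 ^ (N + 2)"
    "(y w + - r w) / 2 = (z w - sqrt (D w)) / 2 ^ (N + 2)" for w
    unfolding y_def r_def root by (simp_all add: field_simps)
  have b: "\<bar>(y w + r w) / 2\<bar> \<le> 1 / 128" "\<bar>(y w + - r w) / 2\<bar> \<le> 1 / 128" if "w \<in> V" for w
    using r[OF that] y[OF that] unfolding abs_le_iff by (simp_all add: field_simps)
  show "Col (\<lambda>w. (z w + sqrt (D w)) / 2 ^ (N + 2))" "Col (\<lambda>w. (z w - sqrt (D w)) / 2 ^ (N + 2))"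
    unfolding eq[symmetric]
    by (rule Col_average[OF Cy n(3) Cr n(1)] Col_average[OF Cy n(3) Col_minus[OF Cr n(1)] n(2)])+
  show "near (\<lambda>w. (z w + sqrt (D w)) / 2 ^ (N + 2)) 0" "near (\<lambda>w. (z w - sqrt (D w)) / 2 ^ (N + 2)) 0"
    unfolding eq[symmetric] by (rule near_zeroI; use b in blast)+
qed

lemma can_Col_between:
  assumes x: "Col x" "near x 0" and c: "dyadic a" "\<bar>a\<bar> \<le> 1 / 2" "dyadic b" "\<bar>b\<bar> \<le> 1 / 2"
    and yes: "can G {w \<in> V. a \<le> x w \<and> x w \<le> b} Q" and no: "can G {w \<in> V. \<not> (a \<le> x w \<and> x w \<le> b)} Q"
  shows "can G V Q"
proof (rule can_Col_le[OF x c(3,4)])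
  show "can G {w \<in> V. x w > b} Q" by (rule can_subset[OF no]) auto
  interpret le: grid G "{w \<in> V. x w \<le> b}" Or u v by (rule grid_subset) auto
  have sub: "le.Pt X Y" if "Pt X Y" for X Y
    using that unfolding le.Pt_def Pt_def by (rule known_subset) auto
  have "le.Col (\<lambda>w. - x w)"
    using Col_minus[OF x] by (auto simp: le.Col_def Col_def intro: sub)
  moreover have "le.near (\<lambda>w. - x w) 0"
    using x(2) by (simp add: le.near_def near_def)
  ultimately show "can G {w \<in> V. x w \<le> b} Q"
  proof (rule le.can_Col_le[where c = "- a"])
    show "can G {w \<in> {w \<in> V. x w \<le> b}. - x w \<le> - a} Q" by (rule can_subset[OF yes]) auto
    show "can G {w \<in> {w \<in> V. x w \<le> b}. - x w > - a} Q" by (rule can_subset[OF no]) auto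
  qed (use c in simp_all)
qed

end

section \<open>Verifying a guess\<close>

text \<open>The centres of four unit discs whose intersection is a small neighbourhood of \<open>(l, m)\<close>: each disc
bounds one coordinate from one side. This is how a comparison with the unit locates a point whose
coordinates are unknown.\<close>

definition box_discs :: "real \<Rightarrow> real \<Rightarrow> (real \<times> real) list" where
  "box_discs l m = [(l - 127 / 128, m), (l + 127 / 128, m), (l, m - 127 / 128), (l, m + 127 / 128)]"

definition in_discs :: "(real \<times> real) list \<Rightarrow> real \<Rightarrow> real \<Rightarrow> bool" where
  "in_discs cs a b \<longleftrightarrow> (\<forall>(c, d)\<in>set cs. (a - c)\<^sup>2 + (b - d)\<^sup>2 \<le> 1)"

lemma sum_squares_le_1D: "x\<^sup>2 + y\<^sup>2 \<le> (1::real) \<Longrightarrow> \<bar>x\<bar> \<le> 1 \<and> \<bar>y\<bar> \<le> 1"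
proof -
  assume *: "x\<^sup>2 + y\<^sup>2 \<le> 1"
  then have "x\<^sup>2 \<le> 1" "y\<^sup>2 \<le> 1" using zero_le_power2[of x] zero_le_power2[of y] by linarith+
  then show ?thesis by (simp add: abs_square_le_1)
qed

lemma in_box_near:
  assumes "in_discs (box_discs l m) a b" shows "\<bar>a - l\<bar> \<le> 1 / 128" "\<bar>b - m\<bar> \<le> 1 / 128"
proof -
  have "(a - (l - 127 / 128))\<^sup>2 + (b - m)\<^sup>2 \<le> 1" "(a - (l + 127 / 128))\<^sup>2 + (b - m)\<^sup>2 \<le> 1"
    "(a - l)\<^sup>2 + (b - (m - 127 / 128))\<^sup>2 \<le> 1" "(a - l)\<^sup>2 + (b - (m + 127 / 128))\<^sup>2 \<le> 1"
    using assms by (simp_all add: in_discs_def box_discs_def)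
  from this[THEN sum_squares_le_1D] show "\<bar>a - l\<bar> \<le> 1 / 128" "\<bar>b - m\<bar> \<le> 1 / 128" unfolding abs_le_iff by simp_all
qed

lemma near_in_box:
  assumes "\<bar>a - l\<bar> \<le> 1 / 256" "\<bar>b - m\<bar> \<le> 1 / 256" shows "in_discs (box_discs l m) a b"
proof -
  have "\<bar>a - (l - 127 / 128)\<bar> \<le> 255 / 256" "\<bar>a - (l + 127 / 128)\<bar> \<le> 255 / 256"
    "\<bar>b - (m - 127 / 128)\<bar> \<le> 255 / 256" "\<bar>b - (m + 127 / 128)\<bar> \<le> 255 / 256"
    using assms unfolding abs_le_iff by simp_all
  from this[THEN abs_le_power2] have "(a - (l - 127 / 128))\<^sup>2 \<le> (255 / 256)\<^sup>2" "(a - (l + 127 / 128))\<^sup>2 \<le> (255 / 256)\<^sup>2"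
    "(b - (m - 127 / 128))\<^sup>2 \<le> (255 / 256)\<^sup>2" "(b - (m + 127 / 128))\<^sup>2 \<le> (255 / 256)\<^sup>2"
    .
  moreover have "(a - l)\<^sup>2 \<le> (1 / 256)\<^sup>2" "(b - m)\<^sup>2 \<le> (1 / 256)\<^sup>2"
    by (rule abs_le_power2, rule assms)+
  ultimately show ?thesis unfolding in_discs_def box_discs_def by (simp add: power_divide)
qed

text \<open>The guess consists of lattice points near the centre, near the given point and near the two
solutions, and of a scale that makes all of them small. The conditions on the solutions are
void if there are none, so that emptiness is recognised without a guess for
them.\<close>

definition admissible ::
  "real \<Rightarrow> real \<Rightarrow> real \<Rightarrow> real \<Rightarrow> real \<Rightarrow> real \<Rightarrow> nat \<Rightarrow> real \<Rightarrow> real \<Rightarrow> real \<Rightarrow> real \<Rightarrow> bool" where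
  "admissible l1 l2 l3 l4 l5 l6 N z1 z2 s1 s2 \<longleftrightarrow>
    (\<forall>l\<in>{l1, l2, l3, l4, l5, l6}. 1024 * (\<bar>l\<bar> + 1) \<le> 2 ^ N) \<and>
    in_discs (box_discs l1 l2) z1 z2 \<and> in_discs (box_discs l3 l4) s1 s2 \<and>
    (0 \<le> (s1 - z1)\<^sup>2 + (s2 - z2)\<^sup>2 - z2\<^sup>2 \<longrightarrow>
      \<bar>z1 + sqrt ((s1 - z1)\<^sup>2 + (s2 - z2)\<^sup>2 - z2\<^sup>2) - l5\<bar> \<le> 1 / 128 \<and>
      \<bar>z1 - sqrt ((s1 - z1)\<^sup>2 + (s2 - z2)\<^sup>2 - z2\<^sup>2) - l6\<bar> \<le> 1 / 128)"

lemma admissible_exists: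
  "\<exists>l1 l2 l3 l4 l5 l6 N. (\<forall>l\<in>{l1, l2, l3, l4, l5, l6}. dyadic l) \<and> admissible l1 l2 l3 l4 l5 l6 N z1 z2 s1 s2"
proof -
  define r where "r = sqrt ((s1 - z1)\<^sup>2 + (s2 - z2)\<^sup>2 - z2\<^sup>2)"
  have "\<exists>y. dyadic y \<and> \<bar>x - y\<bar> \<le> 1 / 256" for x by (rule dyadic_dense) simp
  then obtain f where f: "\<And>x. dyadic (f x)" "\<And>x. \<bar>x - f x\<bar> \<le> 1 / 256" by metis
  have f': "\<bar>x - f x\<bar> \<le> 1 / 128" for x using f(2)[of x] by simp
  define L where "L = {f z1, f z2, f s1, f s2, f (z1 + r), f (z1 - r)}"
  obtain N where N: "(\<Sum>l\<in>L. 1024 * (\<bar>l\<bar> + 1)) < 2 ^ N" using real_arch_pow[of 2] by auto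
  have "1024 * (\<bar>l\<bar> + 1) \<le> 2 ^ N" if "l \<in> L" for l
  proof -
    have "1024 * (\<bar>l\<bar> + 1) \<le> (\<Sum>l\<in>L. 1024 * (\<bar>l\<bar> + 1))"
      by (rule member_le_sum[OF that]) (simp_all add: L_def)
    with N show ?thesis by simp
  qed
  then have "admissible (f z1) (f z2) (f s1) (f s2) (f (z1 + r)) (f (z1 - r)) N z1 z2 s1 s2"
    unfolding admissible_def r_def[symmetric] L_def[symmetric]
    using near_in_box[OF f(2) f(2), of z1 z2] near_in_box[OF f(2) f(2), of s1 s2] f'[of "z1 + r"] f'[of "z1 - r"]
    by blast
  then show ?thesis using f(1) by blast
qed

lemma dyadic_box: "dyadic l \<Longrightarrow> dyadic m \<Longrightarrow> (c, d) \<in> set (box_discs l m) \<Longrightarrow> dyadic c \<and> dyadic d"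
  using dyadic_divide_power[of 127 7] by (auto simp: box_discs_def)

context frame
begin

lemma Pt_subset: "V' \<subseteq> V \<Longrightarrow> Pt x y \<Longrightarrow> frame.Pt G V' Or u v x y"
proof -
  assume V': "V' \<subseteq> V"
  interpret s: frame G V' Or u v by (rule frame_subset[OF V'])
  show "Pt x y \<Longrightarrow> s.Pt x y" unfolding Pt_def s.Pt_def by (rule known_subset[OF _ V'])
qed

end

context grid
begin

lemma Col_subset: "V' \<subseteq> V \<Longrightarrow> Col x \<Longrightarrow> grid.Col G V' Or u v x"
proof -
  assume V': "V' \<subseteq> V"
  interpret s: grid G V' Or u v by (rule grid_subset[OF V'])
  show "Col x \<Longrightarrow> s.Col x" unfolding Col_def s.Col_def using Pt_subset[OF V'] by blast
qed

lemma near_subset: "V' \<subseteq> V \<Longrightarrow> near x l \<Longrightarrow> grid.near V' x l"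
proof -
  assume V': "V' \<subseteq> V"
  interpret s: grid G V' Or u v by (rule grid_subset[OF V'])
  show "near x l \<Longrightarrow> s.near x l" unfolding near_def s.near_def using V' by blast
qed

lemma can_in_discs:
  assumes P: "Pt a b" and cs: "\<And>c d. (c, d) \<in> set cs \<Longrightarrow> dyadic c \<and> dyadic d" and V': "V' \<subseteq> V"
    and yes: "can G {w \<in> V'. in_discs cs (a w) (b w)} Q"
    and no: "can G {w \<in> V'. \<not> in_discs cs (a w) (b w)} Q"
  shows "can G V' Q"
  using cs V' yes no
proof (induction cs arbitrary: V')
  case Nil
  then show ?case by (simp add: in_discs_def)
next
  case (Cons p cs)
  obtain c d where p: "p = (c, d)" by (cases p)
  interpret s: grid G V' Or u v by (rule grid_subset[OF Cons.prems(2)])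
  have "s.Point c d" using Cons.prems(1)[of c d] by (simp add: p s.lattice)
  from Pt_subset[OF Cons.prems(2) P] this show ?case
  proof (rule s.Pt_compare)
    let ?V = "{w \<in> V'. (a w - c)\<^sup>2 + (b w - d)\<^sup>2 \<le> 1}"
    show "can G ?V Q"
    proof (rule Cons.IH)
      show "can G {w \<in> ?V. in_discs cs (a w) (b w)} Q"
        by (rule can_subset[OF Cons.prems(3)]) (auto simp: p in_discs_def)
      show "can G {w \<in> ?V. \<not> in_discs cs (a w) (b w)} Q"
        by (rule can_subset[OF Cons.prems(4)]) (auto simp: p in_discs_def)
    qed (use Cons.prems(1,2) in auto)
    show "can G {w \<in> V'. 1 < (a w - c)\<^sup>2 + (b w - d)\<^sup>2} Q"
      by (rule can_subset[OF Cons.prems(4)]) (auto simp: p in_discs_def)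
  qed
qed

text \<open>Each test is made as soon as the numbers it is about are available: the positions of the two points
come first because the arithmetic presupposes them, then the sign of the discriminant, and then
the positions of the scaled solutions. Only after that can the scaling be undone.\<close>

lemma can_answer_guess:
  fixes l1 l2 l3 l4 l5 l6 :: real and N :: nat
  assumes Z: "Pt z1 z2" and S: "Pt s1 s2"
    and dy: "dyadic l1" "dyadic l2" "dyadic l3" "dyadic l4" "dyadic l5" "dyadic l6"
  defines "D \<equiv> (\<lambda>w. (s1 w - z1 w)\<^sup>2 + (s2 w - z2 w)\<^sup>2 - (z2 w)\<^sup>2)"
  shows "can G V (answers (\<lambda>w. {F w x 0 | x. (x - z1 w)\<^sup>2 = D w})
    (\<lambda>w. admissible l1 l2 l3 l4 l5 l6 N (z1 w) (z2 w) (s1 w) (s2 w)))"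
proof -
  define scaled where "scaled \<longleftrightarrow> (\<forall>l\<in>{l1, l2, l3, l4, l5, l6}. 1024 * (\<bar>l\<bar> + 1) \<le> 2 ^ N)"
  define good where "good = (\<lambda>w. scaled \<and> in_discs (box_discs l1 l2) (z1 w) (z2 w) \<and>
    in_discs (box_discs l3 l4) (s1 w) (s2 w) \<and>
    (0 \<le> D w \<longrightarrow> \<bar>z1 w + sqrt (D w) - l5\<bar> \<le> 1 / 128 \<and> \<bar>z1 w - sqrt (D w) - l6\<bar> \<le> 1 / 128))"
  have "can G V (answers (\<lambda>w. {F w x 0 | x. (x - z1 w)\<^sup>2 = D w}) good)"
  proof (cases scaled)
  case False
  then show ?thesis by (intro can_give_up) (simp add: good_def)
next
  case True
  then have N: "1024 * (\<bar>l1\<bar> + 1) \<le> 2 ^ N" "1024 * (\<bar>l2\<bar> + 1) \<le> 2 ^ N" "1024 * (\<bar>l3\<bar> + 1) \<le> 2 ^ N"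
    "1024 * (\<bar>l4\<bar> + 1) \<le> 2 ^ N" "1024 * (\<bar>l5\<bar> + 1) \<le> 2 ^ N" "1024 * (\<bar>l6\<bar> + 1) \<le> 2 ^ N"
    by (simp_all add: scaled_def)
  let ?Q = "answers (\<lambda>w. {F w x 0 | x. (x - z1 w)\<^sup>2 = D w}) good"
  define V1 where "V1 = {w \<in> V. in_discs (box_discs l1 l2) (z1 w) (z2 w)}"
  define V2 where "V2 = {w \<in> V1. in_discs (box_discs l3 l4) (s1 w) (s2 w)}"
  define q where "q = (\<lambda>w. D w / (4 * 2 ^ N)\<^sup>2)"
  define V3 where "V3 = {w \<in> V2. - q w \<le> 0}"
  define M where "M = N + 2"
  define x y where "x = (\<lambda>w. (z1 w + sqrt (D w)) / 2 ^ M)" and "y = (\<lambda>w. (z1 w - sqrt (D w)) / 2 ^ M)"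
  define V4 where "V4 = {w \<in> V3. (l5 - 1 / 128) / 2 ^ M \<le> x w \<and> x w \<le> (l5 + 1 / 128) / 2 ^ M}"
  define V5 where "V5 = {w \<in> V4. (l6 - 1 / 128) / 2 ^ M \<le> y w \<and> y w \<le> (l6 + 1 / 128) / 2 ^ M}"
  have sub: "V1 \<subseteq> V" "V2 \<subseteq> V" "V3 \<subseteq> V2" "V3 \<subseteq> V" "V4 \<subseteq> V3" "V5 \<subseteq> V3"
    by (auto simp: V1_def V2_def V3_def V4_def V5_def)
  interpret g2: grid G V2 Or u v by (rule grid_subset[OF sub(2)])
  interpret g3: grid G V3 Or u v by (rule grid_subset[OF sub(4)])
  interpret g4: grid G V4 Or u v by (rule g3.grid_subset[OF sub(5)])
  interpret g5: grid G V5 Or u v by (rule g3.grid_subset[OF sub(6)])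
  have bounds: "\<bar>z1 w - l1\<bar> \<le> 1 / 128" "\<bar>z2 w - l2\<bar> \<le> 1 / 128"
    "\<bar>s1 w - l3\<bar> \<le> 1 / 128" "\<bar>s2 w - l4\<bar> \<le> 1 / 128" if "w \<in> V2" for w
    using that unfolding V1_def V2_def by (blast intro: in_box_near)+
  have near2: "g2.near z1 l1" "g2.near z2 l2" "g2.near s1 l3" "g2.near s2 l4"
    unfolding g2.near_def using dy bounds by blast+
  note near3 = near2[THEN g2.near_subset[OF sub(3)]]
  have q_sign: "0 \<le> q w \<longleftrightarrow> 0 \<le> D w" for w by (simp add: q_def zero_le_divide_iff)
  have unfold: "a / 2 ^ M \<le> b / 2 ^ M \<longleftrightarrow> a \<le> b" for a b :: real
    by (simp add: divide_le_cancel)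
  show ?thesis
  proof (rule can_in_discs[OF Z dyadic_box[OF dy(1,2)] subset_refl])
    show "can G {w \<in> V. \<not> in_discs (box_discs l1 l2) (z1 w) (z2 w)} ?Q"
      by (rule can_give_up) (simp add: good_def)
    have "can G V1 ?Q"
    proof (rule can_in_discs[OF S dyadic_box[OF dy(3,4)] sub(1)])
      show "can G {w \<in> V1. \<not> in_discs (box_discs l3 l4) (s1 w) (s2 w)} ?Q"
        by (rule can_give_up) (simp add: good_def)
      note disc2 = g2.discriminant[OF Pt_subset[OF sub(2) Z] near2(1,2) Pt_subset[OF sub(2) S] near2(3,4) N(1-4)]
      have q: "g2.Col q" and q_small: "\<And>w. w \<in> V2 \<Longrightarrow> \<bar>q w\<bar> \<le> 1 / 65536"
        unfolding q_def D_def by (rule disc2, erule disc2)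
      have nq: "g2.near q 0" "g2.near (\<lambda>w. - q w) 0"
        by (rule g2.near_zeroI; use q_small in force)+
      have "can G V2 ?Q"
      proof (rule g2.can_Col_le[OF g2.Col_minus[OF q nq(1)] nq(2), of 0])
        show "can G {w \<in> V2. - q w > 0} ?Q"
        proof (rule can_answer_empty)
          fix w assume "w \<in> {w \<in> V2. - q w > 0}"
          then have "D w < 0" using q_sign[of w] by auto
          then have "(x - z1 w)\<^sup>2 \<noteq> D w" for x using zero_le_power2[of "x - z1 w"] by linarith
          then show "{F w x 0 | x. (x - z1 w)\<^sup>2 = D w} = {}" by simp
        qed
        have D_nonneg: "0 \<le> D w" if "w \<in> V3" for w
          using that q_sign[of w] by (simp add: V3_def)
        note sol = g3.scaled_solutions[where D = D,
            OF g3.Col_of_Pt[OF Pt_subset[OF sub(4) Z] near3(1,2)] near3(1) N(1)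
            g2.Col_subset[OF sub(3) q, unfolded q_def] D_nonneg]
        have small3: "\<bar>D w / (4 * 2 ^ N)\<^sup>2\<bar> \<le> 1 / 65536" if "w \<in> V3" for w
          using q_small[of w] that sub(3) by (auto simp: q_def)
        have x: "g3.Col x" "g3.near x 0" and y: "g3.Col y" "g3.near y 0"
          unfolding x_def y_def M_def by (rule sol; use small3 in blast)+
        have dyM: "dyadic ((l - 1 / 128) / 2 ^ M)" "dyadic ((l + 1 / 128) / 2 ^ M)" if "dyadic l" for l
          using that dyadic_divide_power[of 1 7] by simp_all
        have bM: "\<bar>(l - 1 / 128) / 2 ^ M\<bar> \<le> 1 / 2" "\<bar>(l + 1 / 128) / 2 ^ M\<bar> \<le> 1 / 2"
          if l: "1024 * (\<bar>l\<bar> + 1) \<le> 2 ^ N" for l :: real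
        proof -
          have *: "2 * A \<le> 2 ^ M" if "A \<le> \<bar>l\<bar> + 1" for A
          proof -
            have "2 * A \<le> 2 * (\<bar>l\<bar> + 1)" using that by simp
            also have "\<dots> \<le> 1024 * (\<bar>l\<bar> + 1)" by (rule mult_right_mono) auto
            also note l
            also have "(2::real) ^ N \<le> 2 ^ M" by (simp add: M_def)
            finally show ?thesis .
          qed
          have "2 * \<bar>l - 1 / 128\<bar> \<le> 2 ^ M" "2 * \<bar>l + 1 / 128\<bar> \<le> 2 ^ M"
            by (rule *, simp add: abs_if)+
          then show "\<bar>(l - 1 / 128) / 2 ^ M\<bar> \<le> 1 / 2" "\<bar>(l + 1 / 128) / 2 ^ M\<bar> \<le> 1 / 2"
            by (simp_all add: field_simps)
        qed
        have "can G V3 ?Q"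
        proof (rule g3.can_Col_between[OF x dyM(1)[OF dy(5)] bM(1)[OF N(5)] dyM(2)[OF dy(5)] bM(2)[OF N(5)]])
          show "can G {w \<in> V3. \<not> ((l5 - 1 / 128) / 2 ^ M \<le> x w \<and> x w \<le> (l5 + 1 / 128) / 2 ^ M)} ?Q"
            by (rule can_give_up) (use D_nonneg in \<open>auto simp: good_def x_def unfold abs_le_iff\<close>)
          have "can G V4 ?Q"
          proof (rule g4.can_Col_between[OF g3.Col_subset[OF sub(5) y(1)] g3.near_subset[OF sub(5) y(2)]
                dyM(1)[OF dy(6)] bM(1)[OF N(6)] dyM(2)[OF dy(6)] bM(2)[OF N(6)]])
            show "can G {w \<in> V4. \<not> ((l6 - 1 / 128) / 2 ^ M \<le> y w \<and> y w \<le> (l6 + 1 / 128) / 2 ^ M)} ?Q"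
              by (rule can_give_up) (use D_nonneg sub(5) in \<open>auto simp: good_def y_def unfold abs_le_iff\<close>)
            have "\<bar>2 ^ M * x w - l5\<bar> \<le> 1 / 128" "\<bar>2 ^ M * y w - l6\<bar> \<le> 1 / 128" if "w \<in> V5" for w
              using that unfolding V5_def V4_def x_def y_def unfold abs_le_iff by auto
            then have nx: "g5.near (\<lambda>w. 2 ^ M * x w) l5" and ny: "g5.near (\<lambda>w. 2 ^ M * y w) l6"
              unfolding g5.near_def using dy by blast+
            have X: "g5.Pt (\<lambda>w. 2 ^ M * x w) (\<lambda>_. 0)"
              by (rule g5.unscale[OF g3.Col_subset[OF sub(6) x(1)] g3.near_subset[OF sub(6) x(2)] nx])
            have Y: "g5.Pt (\<lambda>w. 2 ^ M * y w) (\<lambda>_. 0)"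
              by (rule g5.unscale[OF g3.Col_subset[OF sub(6) y(1)] g3.near_subset[OF sub(6) y(2)] ny])
            have "can G V5 ?Q"
            proof (rule can_answer_two[OF X[unfolded g5.Pt_def] Y[unfolded g5.Pt_def]])
              fix w assume "w \<in> V5"
              then have D: "0 \<le> D w" using D_nonneg sub(6) by blast
              have "(t - z1 w)\<^sup>2 = D w \<longleftrightarrow> t = 2 ^ M * x w \<or> t = 2 ^ M * y w" for t
              proof -
                have "(t - z1 w)\<^sup>2 = D w \<longleftrightarrow> (t - z1 w)\<^sup>2 = (sqrt (D w))\<^sup>2" using D by simp
                also have "\<dots> \<longleftrightarrow> t - z1 w = sqrt (D w) \<or> t - z1 w = - sqrt (D w)"
                  by (rule power2_eq_iff)
                finally show ?thesis by (auto simp: x_def y_def)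
              qed
              then show "{F w t 0 | t. (t - z1 w)\<^sup>2 = D w} = {F w (2 ^ M * x w) 0, F w (2 ^ M * y w) 0}"
                by auto
            qed
            then show "can G {w \<in> V4. (l6 - 1 / 128) / 2 ^ M \<le> y w \<and> y w \<le> (l6 + 1 / 128) / 2 ^ M} ?Q"
              unfolding V5_def .
          qed
          then show "can G {w \<in> V3. (l5 - 1 / 128) / 2 ^ M \<le> x w \<and> x w \<le> (l5 + 1 / 128) / 2 ^ M} ?Q"
            unfolding V4_def .
        qed
        then show "can G {w \<in> V2. - q w \<le> 0} ?Q" unfolding V3_def .
      qed simp_all
      then show "can G {w \<in> V1. in_discs (box_discs l3 l4) (s1 w) (s2 w)} ?Q" unfolding V2_def .
    qed
    then show "can G {w \<in> V. in_discs (box_discs l1 l2) (z1 w) (z2 w)} ?Q" unfolding V1_def .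
  qed
qed
  then show ?thesis unfolding good_def scaled_def D_def admissible_def .
qed

end

section \<open>A right angle on the given line\<close>

definition turn :: "point \<Rightarrow> point" where
  "turn a = vector [- (a $ 2), a $ 1]"

lemma inner_point: "inner a b = a $ 1 * b $ 1 + a $ 2 * b $ 2" for a b :: point
  by (simp add: inner_vec_def sum_2)

lemma norm_turn: "norm (turn a) = norm a"
  by (simp add: norm_eq_sqrt_inner inner_point turn_def power2_eq_square add.commute)

lemma inner_turn: "inner a (turn a) = 0"
  by (simp add: inner_point turn_def)

text \<open>The frame is not assumed to have a particular orientation, since the construction does not control
it. The coefficients of \<open>u\<close> and \<open>v\<close> form an orthogonal matrix, whose rows are orthonormal because its
columns are.\<close>

lemma orthonormal_expansion:
  fixes p u v :: point
  assumes "norm u = 1" "norm v = 1" "inner u v = 0"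
  shows "p = inner p u *\<^sub>R u + inner p v *\<^sub>R v"
proof -
  define a b c d where "a = u $ 1" and "b = u $ 2" and "c = v $ 1" and "d = v $ 2"
  have *: "a * a + b * b = 1" "c * c + d * d = 1" "a * c + b * d = 0"
    using assms by (simp_all add: norm_eq_1 inner_point a_def b_def c_def d_def)
  have det: "(a * d - b * c)\<^sup>2 = 1"
  proof -
    have "(a * d - b * c)\<^sup>2 = (a * a + b * b) * (c * c + d * d) - (a * c + b * d)\<^sup>2"
      by (simp add: power2_eq_square algebra_simps)
    then show ?thesis unfolding * by simp
  qed
  have r: "a * a + c * c = 1" "b * b + d * d = 1" "a * b + c * d = 0"
  proof -
    have d: "d = (a * d - b * c) * a" "c = - (a * d - b * c) * b"
      using *(1,3) by algebra+
    have "c * c = (a * d - b * c)\<^sup>2 * (b * b)" "d * d = (a * d - b * c)\<^sup>2 * (a * a)"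
      "c * d = - ((a * d - b * c)\<^sup>2 * (a * b))"
      using d by algebra+
    then show "a * a + c * c = 1" "b * b + d * d = 1" "a * b + c * d = 0"
      using *(1) unfolding det by simp_all
  qed
  show ?thesis
    unfolding vec_eq_iff forall_2
  proof
    have "p $ 1 * (a * a + c * c) + p $ 2 * (a * b + c * d) = p $ 1" unfolding r by simp
    then show "p $ 1 = (inner p u *\<^sub>R u + inner p v *\<^sub>R v) $ 1"
      by (simp add: inner_point a_def b_def c_def d_def algebra_simps)
    have "p $ 1 * (a * b + c * d) + p $ 2 * (b * b + d * d) = p $ 2" unfolding r by simp
    then show "p $ 2 = (inner p u *\<^sub>R u + inner p v *\<^sub>R v) $ 2"
      by (simp add: inner_point a_def b_def c_def d_def algebra_simps)
  qed
qed

lemma can_empty: "can G {} Q"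
  by (simp add: can_def)

abbreviation lift_frame :: "('w \<Rightarrow> point) list \<Rightarrow> ('w \<times> point \<times> point \<times> point \<Rightarrow> point) list" where
  "lift_frame G \<equiv> (\<lambda>v. fst (snd v)) # (\<lambda>v. fst (snd (snd v))) # (\<lambda>v. snd (snd (snd v))) # lift G"

context frame
begin

lemma point_F: "w \<in> V \<Longrightarrow> \<exists>x y. p = F w x y"
proof -
  assume w: "w \<in> V"
  have "p = F w (inner (p - Or w) (u w)) (inner (p - Or w) (v w))"
    using orthonormal_expansion[OF norm_u[OF w] norm_v[OF w] orth[OF w], of "p - Or w"]
    unfolding F_def by (metis add.assoc add_diff_cancel_left' diff_add_cancel add.commute)
  then show ?thesis by blast
qed

text \<open>The possible results of constructing a right angle: its vertex lies anywhere on the line, its first leg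
points in one of the two directions of the line, its second leg to one of the two
sides.\<close>

definition frames :: "('w \<times> point \<times> point \<times> point) set" where
  "frames = {(w, a, b, c). w \<in> V \<and> (\<exists>t. a = F w t 0 \<and>
    (b = F w (t + 1) 0 \<or> b = F w (t - 1) 0) \<and> (c = F w t 1 \<or> c = F w t (-1)))}"

lemma Pt_cases_on_line:
  assumes a: "Pt a (\<lambda>_. 0)" and c: "Point c 0"
    and near: "frame.Pt G {w \<in> V. \<bar>a w - c\<bar> \<le> 1} Or u v x y"
    and far: "frame.Pt G {w \<in> V. \<bar>a w - c\<bar> > 1} Or u v x y"
  shows "Pt x y"
proof -
  interpret n: frame G "{w \<in> V. \<bar>a w - c\<bar> \<le> 1}" Or u v by (rule frame_subset) auto
  interpret f: frame G "{w \<in> V. \<bar>a w - c\<bar> > 1}" Or u v by (rule frame_subset) auto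
  have "{w \<in> V. dist (F w (a w) 0) (F w c 0) \<le> 1} = {w \<in> V. \<bar>a w - c\<bar> \<le> 1}"
    "{w \<in> V. dist (F w (a w) 0) (F w c 0) > 1} = {w \<in> V. \<bar>a w - c\<bar> > 1}"
    by (auto simp: dist_F)
  then show ?thesis
    using known_compare[OF a[unfolded Pt_def] c[unfolded Pt_def], of "\<lambda>w. F w (x w) (y w)"] near far
    by (simp add: n.Pt_def f.Pt_def Pt_def)
qed

lemma Pt_step_towards:
  assumes a: "Pt a (\<lambda>_. 0)" and c: "Point c 0"
    and "\<And>w. w \<in> V \<Longrightarrow> a w \<noteq> c \<and> \<bar>a w - c\<bar> \<le> 1 \<and> sgn (a w - c) = sgn (a w)"
  shows "Pt (\<lambda>w. a w - sgn (a w)) (\<lambda>_. 0)"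
proof (rule Pt_cong[OF Pt_lay[OF a c, of "\<lambda>w. \<bar>a w - c\<bar>"]])
  fix w assume w: "w \<in> V"
  show "0 < \<bar>a w - c\<bar> \<and> \<bar>a w - c\<bar> \<le> 1 \<and> (c - a w)\<^sup>2 + (0 - 0)\<^sup>2 = \<bar>a w - c\<bar>\<^sup>2"
    using assms(3)[OF w] by (simp add: power2_commute)
  have "(c - a w) / \<bar>a w - c\<bar> = - sgn (a w - c)"
    using assms(3)[OF w] by (cases "c < a w") (simp_all add: sgn_real_def field_simps)
  then show "a w + (c - a w) / \<bar>a w - c\<bar> = a w - sgn (a w) \<and> 0 + (0 - 0) / \<bar>a w - c\<bar> = (0::real)"
    using assms(3)[OF w] by simp
qed

text \<open>A stick along the line from a point at distance less than \<open>2\<close> from the origin, towards it. If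
the origin is too far away, one of its two neighbours at distance \<open>1\<close> shows the direction.\<close>

lemma unit_step_on_line:
  assumes P: "Point 0 0" "Point 1 0" "Point (-1) 0"
    and a: "Pt a (\<lambda>_. 0)" "\<And>w. w \<in> V \<Longrightarrow> a w \<noteq> 0 \<and> \<bar>a w\<bar> < 2"
  shows "Pt (\<lambda>w. a w - sgn (a w)) (\<lambda>_. 0)"
proof (rule Pt_cases_on_line[OF a(1) P(1)])
  let ?A = "{w \<in> V. \<bar>a w - 0\<bar> \<le> 1}" and ?B = "{w \<in> V. \<bar>a w - 0\<bar> > 1}"
  interpret A: frame G ?A Or u v by (rule frame_subset) auto
  interpret B: frame G ?B Or u v by (rule frame_subset) auto
  have sub: "?A \<subseteq> V" "?B \<subseteq> V" by auto
  show "A.Pt (\<lambda>w. a w - sgn (a w)) (\<lambda>_. 0)"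
    by (rule A.Pt_step_towards[OF Pt_subset[OF sub(1) a(1)] Pt_subset[OF sub(1) P(1)]]) (use a(2) in force)
  show "B.Pt (\<lambda>w. a w - sgn (a w)) (\<lambda>_. 0)"
  proof (rule B.Pt_cases_on_line[OF Pt_subset[OF sub(2) a(1)] Pt_subset[OF sub(2) P(2)]])
    let ?C = "{w \<in> ?B. \<bar>a w - 1\<bar> \<le> 1}" and ?D = "{w \<in> ?B. \<bar>a w - 1\<bar> > 1}"
    interpret C: frame G ?C Or u v by (rule frame_subset) auto
    interpret D: frame G ?D Or u v by (rule frame_subset) auto
    have sub: "?C \<subseteq> V" "?D \<subseteq> V" by auto
    \<comment> \<open>More than \<open>1\<close> from \<open>0\<close> and at most \<open>1\<close> from \<open>1\<close>: to the right of \<open>1\<close>.\<close>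
    have "a w \<noteq> 1 \<and> \<bar>a w - 1\<bar> \<le> 1 \<and> sgn (a w - 1) = sgn (a w)" if "w \<in> ?C" for w
    proof -
      have "1 < a w" using that by (auto simp: abs_if split: if_splits)
      then show ?thesis using that by simp
    qed
    then show "C.Pt (\<lambda>w. a w - sgn (a w)) (\<lambda>_. 0)"
      by (rule C.Pt_step_towards[OF Pt_subset[OF sub(1) a(1)] Pt_subset[OF sub(1) P(2)]])
    have "a w \<noteq> -1 \<and> \<bar>a w - -1\<bar> \<le> 1 \<and> sgn (a w - -1) = sgn (a w)" if "w \<in> ?D" for w
    proof -
      have "\<bar>a w\<bar> < 2" using that a(2) by blast
      then have "a w < -1" "-2 < a w" using that by (auto simp: abs_if split: if_splits)
      then show ?thesis by simp
    qed
    then show "D.Pt (\<lambda>w. a w - sgn (a w)) (\<lambda>_. 0)"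
      by (rule D.Pt_step_towards[OF Pt_subset[OF sub(2) a(1)] Pt_subset[OF sub(2) P(3)]])
  qed
qed

text \<open>Let \<open>c = sqrt (1 - y\<^sup>2)\<close>. The points of the line at distance \<open>1\<close> from \<open>(x, y)\<close> are \<open>(x + c, 0)\<close> and \<open>(x - c, 0)\<close>;
the reflection of one of them in \<open>(x, y)\<close> lies perpendicularly above or below the other, at
distance \<open>2 * \<bar>y\<bar>\<close>. A stick can be laid if this is at most \<open>1\<close>; the other case is left
open. The vertex of the right angle differs from the origin because \<open>(x, y)\<close> is at distance less than
\<open>1\<close> from it.\<close>

lemma can_perpendicular:
  assumes P: "Point 0 0" "Point 1 0"
    and X: "Pt x y" "\<And>w. w \<in> V \<Longrightarrow> y w \<noteq> 0 \<and> (x w)\<^sup>2 + (y w)\<^sup>2 < 1"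
    and low: "can (lift_frame G) frames (\<lambda>p. Q (fst p))"
    and high: "can G {w \<in> V. \<bar>y w\<bar> > 1 / 2} Q"
  shows "can G V Q"
proof -
  have I: "Point (of_int k) 0" for k
    using Pt_shift[of "\<lambda>_. 0" "\<lambda>_. 0" "\<lambda>_. 1" k] P by simp
  \<comment> \<open>Both points sought have an abscissa of absolute value less than \<open>2\<close>; four sticks cover this range.\<close>
  define prs where "prs = map (\<lambda>k. (\<lambda>w. F w (of_int k) 0, \<lambda>w. F w (of_int k + 1) 0)) [-2, -1, 0, 1]"
  define c where "c = (\<lambda>w. sqrt (1 - (y w)\<^sup>2))"
  have y1: "(y w)\<^sup>2 < 1" if "w \<in> V" for w
    using X(2)[OF that] zero_le_power2[of "x w"] by linarith
  have c: "(c w)\<^sup>2 + (y w)\<^sup>2 = 1" "0 < c w" "c w \<le> 1" "\<bar>x w\<bar> < 1" if "w \<in> V" for w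
  proof -
    show "(c w)\<^sup>2 + (y w)\<^sup>2 = 1" "0 < c w" "c w \<le> 1" using y1[OF that] by (simp_all add: c_def)
    have "(x w)\<^sup>2 < 1" using X(2)[OF that] zero_le_power2[of "y w"] by linarith
    then show "\<bar>x w\<bar> < 1" by (simp add: abs_square_less_1)
  qed
  define S where "S = (\<lambda>w. {p \<in> (\<Union>j<length prs. closed_segment (fst (prs ! j) w) (snd (prs ! j) w)).
    dist (F w (x w) (y w)) p = 1})"
  have on_line: "F w t 0 \<in> (\<Union>j<length prs. closed_segment (fst (prs ! j) w) (snd (prs ! j) w))"
    if t: "\<bar>t\<bar> \<le> 2" for w t
  proof -
    define j where "j = (if t < -1 then 0 else if t < 0 then 1 else if t < 1 then 2 else (3::nat))"
    have j: "j < length prs" by (simp add: j_def prs_def)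
    have "F w t 0 \<in> closed_segment (fst (prs ! j) w) (snd (prs ! j) w)"
      unfolding j_def prs_def using t
      by (auto simp: mem_segment_F abs_le_iff intro: exI[of _ "t + 2"] exI[of _ "t + 1"] exI[of _ t] exI[of _ "t - 1"])
    then show ?thesis using j by blast
  qed
  have line_only: "\<exists>t. p = F w t 0" if p: "p \<in> (\<Union>j<length prs. closed_segment (fst (prs ! j) w) (snd (prs ! j) w))" for p w
  proof -
    obtain j where "j < length prs" "p \<in> closed_segment (fst (prs ! j) w) (snd (prs ! j) w)" using p by blast
    then have "\<exists>A B. (A, B) \<in> set prs \<and> p \<in> closed_segment (A w) (B w)"
      by (metis nth_mem prod.collapse)
    then show ?thesis by (auto simp: prs_def mem_segment_F)
  qed
  have S: "S w = {F w (x w - c w) 0, F w (x w + c w) 0}" if w: "w \<in> V" for w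
  proof -
    have circle: "dist (F w (x w) (y w)) (F w t 0) = 1 \<longleftrightarrow> t = x w - c w \<or> t = x w + c w" for t
    proof -
      have "dist (F w (x w) (y w)) (F w t 0) = 1 \<longleftrightarrow> (t - x w)\<^sup>2 = (c w)\<^sup>2"
        using c(1)[OF w] by (auto simp: dist_F_1[OF w] power2_commute[of "x w"])
      also have "\<dots> \<longleftrightarrow> t - x w = c w \<or> t - x w = - c w" by (rule power2_eq_iff)
      finally show ?thesis by auto
    qed
    have bounds: "\<bar>x w - c w\<bar> \<le> 2" "\<bar>x w + c w\<bar> \<le> 2" using c(2-4)[OF w] unfolding abs_le_iff abs_less_iff by simp_all
    show ?thesis
    proof (intro set_eqI iffI)
      fix p assume "p \<in> S w"
      then have "p \<in> (\<Union>j<length prs. closed_segment (fst (prs ! j) w) (snd (prs ! j) w))"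
        "dist (F w (x w) (y w)) p = 1" by (simp_all add: S_def)
      with line_only obtain t where t: "p = F w t 0" "dist (F w (x w) (y w)) (F w t 0) = 1" by blast
      from t(2) have "t = x w - c w \<or> t = x w + c w" by (rule circle[THEN iffD1])
      then show "p \<in> {F w (x w - c w) 0, F w (x w + c w) 0}" unfolding t(1) by auto
    next
      fix p assume "p \<in> {F w (x w - c w) 0, F w (x w + c w) 0}"
      then obtain t where t: "p = F w t 0" "t = x w - c w \<or> t = x w + c w" by blast
      have "dist (F w (x w) (y w)) p = 1" unfolding t(1) using t(2) by (rule circle[THEN iffD2])
      moreover have "p \<in> (\<Union>j<length prs. closed_segment (fst (prs ! j) w) (snd (prs ! j) w))"
        unfolding t(1) by (rule on_line) (use t(2) bounds in auto)
      ultimately show "p \<in> S w" unfolding S_def by blast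
    qed
  qed
  define V' where "V' = {(w, a, b). w \<in> V \<and> a \<noteq> b \<and> S w = {a, b}}"
  define G' :: "('w \<times> point \<times> point \<Rightarrow> point) list"
    where "G' = (\<lambda>p. fst (snd p)) # (\<lambda>p. snd (snd p)) # lift G"
  \<comment> \<open>The sign \<open>s p\<close> records the order in which the ruler delivered the two points.\<close>
  have "\<exists>s. \<forall>p\<in>V'. (s p = 1 \<or> s p = -1) \<and> fst (snd p) = F (fst p) (x (fst p) + s p * c (fst p)) 0 \<and>
      snd (snd p) = F (fst p) (x (fst p) - s p * c (fst p)) 0"
  proof (rule bchoice, rule ballI)
    fix p assume "p \<in> V'"
    then obtain w a b where p: "p = (w, a, b)" "w \<in> V" "a \<noteq> b" "S w = {a, b}" by (auto simp: V'_def)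
    then have "{a, b} = {F w (x w - c w) 0, F w (x w + c w) 0}" using S by simp
    then have "a = F w (x w - c w) 0 \<and> b = F w (x w + c w) 0 \<or> a = F w (x w + c w) 0 \<and> b = F w (x w - c w) 0"
      unfolding doubleton_eq_iff by blast
    then show "\<exists>s. (s = 1 \<or> s = -1) \<and> fst (snd p) = F (fst p) (x (fst p) + s * c (fst p)) 0 \<and>
        snd (snd p) = F (fst p) (x (fst p) - s * c (fst p)) 0"
      by (elim disjE) (rule exI[of _ "-1"], simp add: p, rule exI[of _ 1], simp add: p)
  qed
  then obtain s where s: "\<And>p. p \<in> V' \<Longrightarrow> (s p = 1 \<or> s p = -1) \<and>
      fst (snd p) = F (fst p) (x (fst p) + s p * c (fst p)) 0 \<and>
      snd (snd p) = F (fst p) (x (fst p) - s p * c (fst p)) 0" by blast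
  have V'_V: "p \<in> V' \<Longrightarrow> fst p \<in> V" for p by (auto simp: V'_def)
  interpret E: frame G' V' "\<lambda>p. Or (fst p)" "\<lambda>p. u (fst p)" "\<lambda>p. v (fst p)"
    by unfold_locales (auto simp: V'_V norm_u norm_v orth)
  have E_F: "E.F p a b = F (fst p) a b" for p a b by (simp add: E.F_def F_def)
  have lift: "E.Pt (\<lambda>p. a (fst p)) (\<lambda>p. b (fst p))" if "Pt a b" for a b
    using that unfolding E.Pt_def Pt_def E_F
  proof (rule known_lift)
    show "set (lift G) \<subseteq> set G'" unfolding G'_def by auto
    show "fst ` V' \<subseteq> V" using V'_V by blast
  qed
  define \<alpha> \<beta> where "\<alpha> = (\<lambda>p. x (fst p) + s p * c (fst p))" and "\<beta> = (\<lambda>p. x (fst p) - s p * c (fst p))"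
  have A: "E.Pt \<alpha> (\<lambda>_. 0)"
    unfolding E.Pt_def
  proof (rule known_cong[OF known_mem[of "\<lambda>p. fst (snd p)"]])
    show "(\<lambda>p. fst (snd p)) \<in> set G'" by (simp add: G'_def)
    show "fst (snd p) = E.F p (\<alpha> p) 0" if "p \<in> V'" for p
      unfolding E_F \<alpha>_def using s[OF that] by blast
  qed
  have B: "E.Pt \<beta> (\<lambda>_. 0)"
    unfolding E.Pt_def
  proof (rule known_cong[OF known_mem[of "\<lambda>p. snd (snd p)"]])
    show "(\<lambda>p. snd (snd p)) \<in> set G'" by (simp add: G'_def)
    show "snd (snd p) = E.F p (\<beta> p) 0" if "p \<in> V'" for p
      unfolding E_F \<beta>_def using s[OF that] by blast
  qed
  have T: "E.Pt \<alpha> (\<lambda>p. 2 * y (fst p))"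
  proof (rule E.Pt_cong[OF E.Pt_extend[OF B lift[OF X(1)]]])
    fix p assume p: "p \<in> V'"
    have "(s p * c (fst p))\<^sup>2 = (c (fst p))\<^sup>2" using s[OF p] by auto
    then show "(\<beta> p - x (fst p))\<^sup>2 + (0 - y (fst p))\<^sup>2 = 1"
      using c(1)[OF V'_V[OF p]] by (simp add: \<beta>_def)
  qed (simp add: \<alpha>_def \<beta>_def)
  have \<alpha>: "\<alpha> p \<noteq> 0 \<and> \<bar>\<alpha> p\<bar> < 2" if p: "p \<in> V'" for p
  proof
    have sc: "(s p * c (fst p))\<^sup>2 = (c (fst p))\<^sup>2" "\<bar>s p * c (fst p)\<bar> \<le> 1"
      using s[OF p] c(2,3)[OF V'_V[OF p]] by auto
    show "\<alpha> p \<noteq> 0"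
    proof
      assume "\<alpha> p = 0"
      then have "x (fst p) = - (s p * c (fst p))" by (simp add: \<alpha>_def)
      then have "(x (fst p))\<^sup>2 = (c (fst p))\<^sup>2" using sc by simp
      then show False using c(1)[OF V'_V[OF p]] X(2)[OF V'_V[OF p]] by simp
    qed
    show "\<bar>\<alpha> p\<bar> < 2" using sc(2) c(4)[OF V'_V[OF p]] unfolding \<alpha>_def abs_less_iff abs_le_iff by simp
  qed
  have U: "E.Pt (\<lambda>p. \<alpha> p - sgn (\<alpha> p)) (\<lambda>_. 0)"
    by (rule E.unit_step_on_line[OF lift[OF P(1)] lift[OF P(2)] _ A \<alpha>])
      (use lift[OF I[of "-1"]] in simp)
  have main: "can G' V' (\<lambda>p. Q (fst p))"
  proof (rule E.Pt_compare[OF A T])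
    let ?low = "{p \<in> V'. (\<alpha> p - \<alpha> p)\<^sup>2 + (0 - 2 * y (fst p))\<^sup>2 \<le> 1}"
    let ?high = "{p \<in> V'. (\<alpha> p - \<alpha> p)\<^sup>2 + (0 - 2 * y (fst p))\<^sup>2 > 1}"
    have eq: "(\<alpha> p - \<alpha> p)\<^sup>2 + (0 - 2 * y (fst p))\<^sup>2 = \<bar>2 * y (fst p)\<bar>\<^sup>2" for p by simp
    show "can G' ?high (\<lambda>p. Q (fst p))"
    proof (rule can_reindex[OF high])
      fix p assume p: "p \<in> ?high"
      then have "1 < \<bar>2 * y (fst p)\<bar>\<^sup>2" unfolding eq by blast
      then have "1 < \<bar>2 * y (fst p)\<bar>" using power_le_one[of "\<bar>2 * y (fst p)\<bar>" 2] by force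
      then show "fst p \<in> {w \<in> V. \<bar>y w\<bar> > 1 / 2}" using p V'_V by simp
    qed (auto simp: G'_def)
    interpret L: frame G' ?low "\<lambda>p. Or (fst p)" "\<lambda>p. u (fst p)" "\<lambda>p. v (fst p)"
      by (rule E.frame_subset) auto
    have sub: "?low \<subseteq> V'" by auto
    have W: "L.Pt \<alpha> (\<lambda>p. sgn (y (fst p)))"
    proof (rule L.Pt_cong[OF L.Pt_lay[OF E.Pt_subset[OF sub A] E.Pt_subset[OF sub T], of "\<lambda>p. \<bar>2 * y (fst p)\<bar>"]])
      fix p assume p: "p \<in> ?low"
      then have "\<bar>2 * y (fst p)\<bar>\<^sup>2 \<le> 1" unfolding eq by blast
      then have le: "\<bar>2 * y (fst p)\<bar> \<le> 1" by (simp only: abs_square_le_1 power2_abs)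
      have ne: "y (fst p) \<noteq> 0" using X(2) V'_V p by blast
      show "0 < \<bar>2 * y (fst p)\<bar> \<and> \<bar>2 * y (fst p)\<bar> \<le> 1 \<and>
          (\<alpha> p - \<alpha> p)\<^sup>2 + (2 * y (fst p) - 0)\<^sup>2 = \<bar>2 * y (fst p)\<bar>\<^sup>2" using le ne by simp
      show "\<alpha> p + (\<alpha> p - \<alpha> p) / \<bar>2 * y (fst p)\<bar> = \<alpha> p \<and>
          0 + (2 * y (fst p) - 0) / \<bar>2 * y (fst p)\<bar> = sgn (y (fst p))"
        using ne by (simp add: sgn_real_def abs_if)
    qed
    define g where "g = (\<lambda>p. (fst p, F (fst p) (\<alpha> p) 0, F (fst p) (\<alpha> p - sgn (\<alpha> p)) 0,
      F (fst p) (\<alpha> p) (sgn (y (fst p)))))"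
    have "can G' ?low (\<lambda>p. Q (fst (g p)))"
    proof (rule can_subst[OF low])
      fix p assume p: "p \<in> ?low"
      then have "\<alpha> p \<noteq> 0" "y (fst p) \<noteq> 0" "fst p \<in> V" using \<alpha> X(2) V'_V by blast+
      then show "g p \<in> frames"
        by (auto simp: g_def frames_def sgn_real_def)
    next
      fix f assume "f \<in> set (lift_frame G)"
      then consider "f = (\<lambda>v. fst (snd v))" | "f = (\<lambda>v. fst (snd (snd v)))" | "f = (\<lambda>v. snd (snd (snd v)))"
        | f' where "f' \<in> set G" "f = (\<lambda>v. f' (fst v))" by auto
      then show "known G' ?low (\<lambda>p. f (g p))"
      proof cases
        case 1
        show ?thesis using E.Pt_subset[OF sub A] unfolding L.Pt_def E_F 1 g_def by (simp only: fst_conv snd_conv)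
      next
        case 2
        show ?thesis using E.Pt_subset[OF sub U] unfolding L.Pt_def E_F 2 g_def by (simp only: fst_conv snd_conv)
      next
        case 3
        show ?thesis using W unfolding L.Pt_def E_F 3 g_def by (simp only: fst_conv snd_conv)
      next
        case 4
        then show ?thesis by (auto simp: g_def G'_def intro!: known_mem)
      qed
    qed
    then show "can G' ?low (\<lambda>p. Q (fst p))" by (simp add: g_def)
  qed
  show ?thesis
  proof (rule can_ruler_two[OF X(1)[unfolded Pt_def], of prs])
    show "known G V A \<and> known G V B" if "(A, B) \<in> set prs" for A B
      using that I[of "-2"] I[of "-1"] I[of 0] I[of 1] I[of 2] by (auto simp: prs_def Pt_def)
    show "dist (A w) (B w) = 1" if "(A, B) \<in> set prs" "w \<in> V" for A B w
      using that by (auto simp: prs_def dist_F)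
    show "\<exists>a b. a \<noteq> b \<and> {p \<in> \<Union>j<length prs. closed_segment (fst (prs ! j) w) (snd (prs ! j) w).
        dist (F w (x w) (y w)) p = 1} = {a, b}" if w: "w \<in> V" for w
    proof -
      have "F w (x w - c w) 0 \<noteq> F w (x w + c w) 0" using c(2)[OF w] by (simp add: F_inj[OF w])
      then show ?thesis using S[OF w] unfolding S_def by blast
    qed
    show "can ((\<lambda>v. fst (snd v)) # (\<lambda>v. snd (snd v)) # lift G)
      {(w, a, b). w \<in> V \<and> a \<noteq> b \<and> {p \<in> \<Union>j<length prs. closed_segment (fst (prs ! j) w) (snd (prs ! j) w).
        dist (F w (x w) (y w)) p = 1} = {a, b}} (\<lambda>v. Q (fst v))"
      using main unfolding G'_def V'_def S_def .
  qed
qed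

text \<open>An arbitrary point of a unit stick from the origin is at some distance \<open>t\<close> from it. This point, and the
point of the same line at distance \<open>1 - t\<close> on the opposite side of the origin, have distances from the
given line that add up to at most \<open>1\<close>, so at least one of them is close enough.\<close>

lemma can_frames:
  assumes P: "Point 0 0" "Point 1 0"
    and frames: "can (lift_frame G) frames (\<lambda>p. Q (fst p))"
  shows "can G V Q"
proof -
  have P': "Point (-1) 0"
    by (rule Pt_cong[OF Pt_extend[OF P(2,1)]]) simp_all
  \<comment> \<open>Without the stick on the opposite side, the chosen point could lie on the line.\<close>
  define prs where "prs = [(\<lambda>w. F w 0 0, \<lambda>w. F w 1 0), (\<lambda>w. F w 0 0, \<lambda>w. F w (-1) 0)]"
  define S where "S = (\<lambda>w. \<Union>j<length prs. closed_segment (fst (prs ! j) w) (snd (prs ! j) w))"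
  have S: "S w = closed_segment (F w 0 0) (F w 1 0) \<union> closed_segment (F w 0 0) (F w (-1) 0)" for w
    by (auto simp: S_def prs_def numeral_2_eq_2 lessThan_Suc)
  define V1 where "V1 = {(w, r). w \<in> V \<and> dist (F w 0 0) r = 1 \<and> r \<notin> S w}"
  define G1 :: "('w \<times> point \<Rightarrow> point) list" where "G1 = snd # lift G"
  have V1_V: "p \<in> V1 \<Longrightarrow> fst p \<in> V" for p by (auto simp: V1_def)
  interpret E1: frame G1 V1 "\<lambda>p. Or (fst p)" "\<lambda>p. u (fst p)" "\<lambda>p. v (fst p)"
    by unfold_locales (auto simp: V1_def norm_u norm_v orth)
  have E1_F: "E1.F p a b = F (fst p) a b" for p a b by (simp add: E1.F_def F_def)
  have "\<exists>d. \<forall>p\<in>V1. snd p = F (fst p) (fst (d p)) (snd (d p)) \<and> (fst (d p))\<^sup>2 + (snd (d p))\<^sup>2 = 1 \<and> snd (d p) \<noteq> 0"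
  proof (rule bchoice, rule ballI)
    fix p assume "p \<in> V1"
    then obtain w r where p: "p = (w, r)" "w \<in> V" "dist (F w 0 0) r = 1" "r \<notin> S w" by (auto simp: V1_def)
    obtain c s where r: "r = F w c s" using point_F[OF p(2)] by blast
    have cs: "c\<^sup>2 + s\<^sup>2 = 1" using p(3) unfolding r dist_F_1[OF p(2)] by simp
    have "s \<noteq> 0"
    proof
      assume s: "s = 0"
      then have "c = 1 \<or> c = -1" using cs by (simp add: power2_eq_1_iff)
      then have "r \<in> S w" unfolding S r s by auto
      then show False using p(4) by blast
    qed
    then show "\<exists>d. snd p = F (fst p) (fst d) (snd d) \<and> (fst d)\<^sup>2 + (snd d)\<^sup>2 = 1 \<and> snd d \<noteq> 0"
      using cs r by (intro exI[of _ "(c, s)"]) (simp add: p(1))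
  qed
  then obtain d where d: "\<And>p. p \<in> V1 \<Longrightarrow> snd p = F (fst p) (fst (d p)) (snd (d p)) \<and>
      (fst (d p))\<^sup>2 + (snd (d p))\<^sup>2 = 1 \<and> snd (d p) \<noteq> 0" by blast
  define c s where "c = (\<lambda>p. fst (d p))" and "s = (\<lambda>p. snd (d p))"
  have R: "E1.Pt c s"
    unfolding E1.Pt_def
  proof (rule known_cong[OF known_mem[of snd]])
    show "snd \<in> set G1" by (simp add: G1_def)
    show "snd p = E1.F p (c p) (s p)" if "p \<in> V1" for p
      unfolding E1_F c_def s_def using d[OF that] by blast
  qed
  have lift1: "E1.Point a b" if "Point a b" for a b
    using that unfolding E1.Pt_def Pt_def E1_F
  proof (rule known_lift)
    show "set (lift G) \<subseteq> set G1" unfolding G1_def by auto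
    show "fst ` V1 \<subseteq> V" using V1_V by blast
  qed
  note O1 = lift1[OF P(1)] and U1 = lift1[OF P(2)]
  define V2 where "V2 = {(p, m). p \<in> V1 \<and> m \<in> open_segment (E1.F p 0 0) (E1.F p (c p) (s p))}"
  define G2 :: "(('w \<times> point) \<times> point \<Rightarrow> point) list" where "G2 = snd # lift G1"
  have V2_V1: "q \<in> V2 \<Longrightarrow> fst q \<in> V1" for q by (auto simp: V2_def)
  interpret E2: frame G2 V2 "\<lambda>q. Or (fst (fst q))" "\<lambda>q. u (fst (fst q))" "\<lambda>q. v (fst (fst q))"
    by unfold_locales (use V2_V1 V1_V in \<open>blast intro: norm_u norm_v orth\<close>)+
  have E2_F: "E2.F q a b = E1.F (fst q) a b" for q a b by (simp add: E1.F_def E2.F_def)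
  have E2_F': "E2.F q a b = F (fst (fst q)) a b" for q a b by (simp add: F_def E2.F_def)
  have "\<exists>t. \<forall>q\<in>V2. 0 < t q \<and> t q < 1 \<and> snd q = E1.F (fst q) (t q * c (fst q)) (t q * s (fst q))"
  proof (rule bchoice, rule ballI)
    fix q assume "q \<in> V2"
    then have "snd q \<in> open_segment (E1.F (fst q) 0 0) (E1.F (fst q) (c (fst q)) (s (fst q)))"
      by (auto simp: V2_def)
    then obtain t where "0 < t" "t < 1"
      "snd q = (1 - t) *\<^sub>R E1.F (fst q) 0 0 + t *\<^sub>R E1.F (fst q) (c (fst q)) (s (fst q))"
      by (auto simp: in_segment)
    then show "\<exists>t. 0 < t \<and> t < 1 \<and> snd q = E1.F (fst q) (t * c (fst q)) (t * s (fst q))"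
      by (intro exI[of _ t]) (simp add: E1.F_def algebra_simps)
  qed
  then obtain t where t: "\<And>q. q \<in> V2 \<Longrightarrow> 0 < t q \<and> t q < 1 \<and>
      snd q = E1.F (fst q) (t q * c (fst q)) (t q * s (fst q))" by blast
  have cs: "(c (fst q))\<^sup>2 + (s (fst q))\<^sup>2 = 1" "s (fst q) \<noteq> 0" if "q \<in> V2" for q
    using d[OF V2_V1[OF that]] by (simp_all add: c_def s_def)
  have M: "E2.Pt (\<lambda>q. t q * c (fst q)) (\<lambda>q. t q * s (fst q))"
    unfolding E2.Pt_def
  proof (rule known_cong[OF known_mem[of snd]])
    show "snd \<in> set G2" by (simp add: G2_def)
    show "snd q = E2.F q (t q * c (fst q)) (t q * s (fst q))" if "q \<in> V2" for q
      unfolding E2_F using t[OF that] by blast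
  qed
  have lift2: "E2.Point a b" if "E1.Point a b" for a b
    using that unfolding E2.Pt_def E1.Pt_def E2_F
  proof (rule known_lift)
    show "set (lift G1) \<subseteq> set G2" unfolding G2_def by auto
    show "fst ` V2 \<subseteq> V1" using V2_V1 by blast
  qed
  note O2 = lift2[OF O1] and U2 = lift2[OF U1]
  have len: "(a * c (fst q))\<^sup>2 + (a * s (fst q))\<^sup>2 = a\<^sup>2" if "q \<in> V2" for a q
    using cs(1)[OF that] by (simp add: power_mult_distrib flip: distrib_left)
  \<comment> \<open>The stick laid from the chosen point back through the origin ends at the complementary point.\<close>
  have M': "E2.Pt (\<lambda>q. (t q - 1) * c (fst q)) (\<lambda>q. (t q - 1) * s (fst q))"
  proof (rule E2.Pt_cong[OF E2.Pt_lay[OF M O2, of t]])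
    fix q assume q: "q \<in> V2"
    show "0 < t q \<and> t q \<le> 1 \<and> (0 - t q * c (fst q))\<^sup>2 + (0 - t q * s (fst q))\<^sup>2 = (t q)\<^sup>2"
      using t[OF q] len[OF q, of "t q"] by simp
    show "t q * c (fst q) + (0 - t q * c (fst q)) / t q = (t q - 1) * c (fst q) \<and>
        t q * s (fst q) + (0 - t q * s (fst q)) / t q = (t q - 1) * s (fst q)"
      using t[OF q] by (simp add: left_diff_distrib)
  qed
  have frames2: "can (lift_frame G2) E2.frames (\<lambda>p. Q (fst (fst (fst p))))"
  proof -
    have "can (lift_frame G2) E2.frames (\<lambda>p. Q (fst (fst (fst (fst p)), snd p)))"
    proof (rule can_reindex[OF frames])
      show "(fst (fst (fst p)), snd p) \<in> frames" if "p \<in> E2.frames" for p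
        using that V2_V1 V1_V unfolding E2.frames_def frames_def E2_F' by force
      show "set (map (\<lambda>f p. f (fst (fst (fst p)), snd p)) (lift_frame G)) \<subseteq> set (lift_frame G2)"
        unfolding G2_def G1_def by (auto simp: image_iff)
    qed
    then show ?thesis by simp
  qed
  have "can G2 V2 (\<lambda>q. Q (fst (fst q)))"
  proof (rule E2.can_perpendicular[OF O2 U2 M _ frames2])
    show "t q * s (fst q) \<noteq> 0 \<and> (t q * c (fst q))\<^sup>2 + (t q * s (fst q))\<^sup>2 < 1" if "q \<in> V2" for q
      using t[OF that] cs(2)[OF that] unfolding len[OF that] by (simp add: power_less_one_iff)
    let ?V3 = "{q \<in> V2. 1 / 2 < \<bar>t q * s (fst q)\<bar>}"
    interpret E3: frame G2 ?V3 "\<lambda>q. Or (fst (fst q))" "\<lambda>q. u (fst (fst q))" "\<lambda>q. v (fst (fst q))"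
      by (rule E2.frame_subset) auto
    have sub: "?V3 \<subseteq> V2" by auto
    have "E3.frames \<subseteq> E2.frames" unfolding E3.frames_def E2.frames_def by auto
    note frames3 = can_subset[OF frames2 this]
    show "can G2 ?V3 (\<lambda>q. Q (fst (fst q)))"
    proof (rule E3.can_perpendicular[OF E2.Pt_subset[OF sub O2] E2.Pt_subset[OF sub U2] E2.Pt_subset[OF sub M'] _ frames3])
      show "(t q - 1) * s (fst q) \<noteq> 0 \<and> ((t q - 1) * c (fst q))\<^sup>2 + ((t q - 1) * s (fst q))\<^sup>2 < 1" if "q \<in> ?V3" for q
      proof -
        have q: "q \<in> V2" using that by blast
        have "\<bar>t q - 1\<bar> < 1" using t[OF q] by (simp add: abs_if)
        then show ?thesis using t[OF q] cs(2)[OF q] unfolding len[OF q] by (simp add: abs_square_less_1)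
      qed
      have empty: "{q \<in> ?V3. 1 / 2 < \<bar>(t q - 1) * s (fst q)\<bar>} = {}"
      proof -
        have False if q: "q \<in> V2" and 1: "1 / 2 < \<bar>t q * s (fst q)\<bar>" and 2: "1 / 2 < \<bar>(t q - 1) * s (fst q)\<bar>" for q
        proof -
          have "(s (fst q))\<^sup>2 \<le> 1" using cs(1)[OF q] zero_le_power2[of "c (fst q)"] by linarith
          then have s: "\<bar>s (fst q)\<bar> \<le> 1" by (simp add: abs_square_le_1)
          have "\<bar>t q * s (fst q)\<bar> = t q * \<bar>s (fst q)\<bar>" "\<bar>(t q - 1) * s (fst q)\<bar> = (1 - t q) * \<bar>s (fst q)\<bar>"
            using t[OF q] by (simp_all add: abs_mult)
          then have "\<bar>t q * s (fst q)\<bar> + \<bar>(t q - 1) * s (fst q)\<bar> = \<bar>s (fst q)\<bar>"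
            by (simp add: left_diff_distrib)
          then show False using 1 2 s by simp
        qed
        then show ?thesis by blast
      qed
      show "can G2 {q \<in> ?V3. 1 / 2 < \<bar>(t q - 1) * s (fst q)\<bar>} (\<lambda>q. Q (fst (fst q)))"
        unfolding empty by (rule can_empty)
    qed
  qed
  then have "can G1 V1 (\<lambda>p. Q (fst p))"
    unfolding G2_def V2_def
    by (rule can_choose[OF O1[unfolded E1.Pt_def] R[unfolded E1.Pt_def], rotated])
      (use d in \<open>simp add: E1.dist_F c_def s_def\<close>)
  then have main: "can (snd # lift G) {(w, r). w \<in> V \<and> dist (F w 0 0) r = 1 \<and>
      r \<notin> (\<Union>j<length prs. closed_segment (fst (prs ! j) w) (snd (prs ! j) w))} (\<lambda>p. Q (fst p))"
    unfolding G1_def V1_def S_def .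
  show ?thesis
  proof (rule can_ruler_off[OF P(1)[unfolded Pt_def], of prs, OF _ _ _ main])
    show "known G V A \<and> known G V B" if "(A, B) \<in> set prs" for A B
      using that P P' by (auto simp: prs_def Pt_def)
    show "dist (A w) (B w) = 1" if "(A, B) \<in> set prs" "w \<in> V" for A B w
      using that by (auto simp: prs_def dist_F)
    show "\<exists>r. dist (F w 0 0) r = 1 \<and>
        r \<notin> (\<Union>j<length prs. closed_segment (fst (prs ! j) w) (snd (prs ! j) w))" if w: "w \<in> V" for w
    proof -
      have "F w 0 1 \<notin> S w" unfolding S mem_segment_F Un_iff by (simp add: F_inj[OF w])
      moreover have "dist (F w 0 0) (F w 0 1) = 1" by (simp add: dist_F[OF w])
      ultimately show ?thesis unfolding S_def by blast
    qed
  qed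
qed

end

section \<open>The intersection of the line and the circle\<close>

lemma line_through_stick:
  fixes A B P Q :: point
  assumes "A \<noteq> B" "P \<noteq> Q" "closed_segment P Q \<subseteq> affine hull {A, B}"
  shows "affine hull {A, B} = {P + t *\<^sub>R (Q - P) | t. True}"
proof -
  have hull: "affine hull {A, B} = {A + t *\<^sub>R (B - A) | t. True}"
    unfolding affine_hull_2_alt by auto
  have "P \<in> affine hull {A, B}" "Q \<in> affine hull {A, B}" using assms(3) by auto
  then obtain p q where pq: "P = A + p *\<^sub>R (B - A)" "Q = A + q *\<^sub>R (B - A)" unfolding hull by blast
  have ne: "q - p \<noteq> 0" using assms(2) pq by auto
  have PQ: "P + t *\<^sub>R (Q - P) = A + (p + t * (q - p)) *\<^sub>R (B - A)" for t
    unfolding pq by (simp add: algebra_simps)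
  have "A + r *\<^sub>R (B - A) = P + ((r - p) / (q - p)) *\<^sub>R (Q - P)" for r
    unfolding PQ using ne by simp
  then show ?thesis unfolding hull using PQ by blast
qed

lemma can_cong: "can G V Q \<Longrightarrow> (\<And>w. w \<in> V \<Longrightarrow> Q w = Q' w) \<Longrightarrow> can G V Q'"
  unfolding can_def by simp

lemma answers_cong: "T w = T' w \<Longrightarrow> answers T good w = answers T' good w"
  by (simp add: answers_def fun_eq_iff split: sum.split)

text \<open>Dyadic numbers are enumerated by natural numbers, hence guesses by finite lists of natural
numbers.\<close>

lemma (in grid) can_intersect:
  assumes Z: "Pt z1 z2" and S: "Pt s1 s2" and ne: "G \<noteq> []"
  shows "can G V (\<lambda>w K c. constructs {F w x 0 | x. dist (F w (z1 w) (z2 w)) (F w x 0) =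
    dist (F w (z1 w) (z2 w)) (F w (s1 w) (s2 w))} K c)"
proof -
  obtain f :: "nat \<Rightarrow> real" where f: "range f = {x. dyadic x}" using countable_dyadic by blast
  have dy: "dyadic (f n)" for n using f by blast
  define guess :: "nat \<Rightarrow> nat list" where "guess = from_nat"
  define good where "good n w \<longleftrightarrow> (let g = guess n in
    admissible (f (g ! 0)) (f (g ! 1)) (f (g ! 2)) (f (g ! 3)) (f (g ! 4)) (f (g ! 5)) (g ! 6)
      (z1 w) (z2 w) (s1 w) (s2 w))" for n w
  let ?T = "\<lambda>w. {F w x 0 | x. dist (F w (z1 w) (z2 w)) (F w x 0) =
    dist (F w (z1 w) (z2 w)) (F w (s1 w) (s2 w))}"
  have T: "{F w x 0 | x. (x - z1 w)\<^sup>2 = (s1 w - z1 w)\<^sup>2 + (s2 w - z2 w)\<^sup>2 - (z2 w)\<^sup>2} = ?T w"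
    if w: "w \<in> V" for w
  proof -
    have "(x - z1 w)\<^sup>2 = (s1 w - z1 w)\<^sup>2 + (s2 w - z2 w)\<^sup>2 - (z2 w)\<^sup>2 \<longleftrightarrow>
        dist (F w (z1 w) (z2 w)) (F w x 0) = dist (F w (z1 w) (z2 w)) (F w (s1 w) (s2 w))" for x
      unfolding dist_F[OF w] real_sqrt_eq_iff
      by (auto simp: power2_commute[of "z1 w"] power2_commute[of "z2 w" "s2 w"])
    then show ?thesis by simp
  qed
  show ?thesis
  proof (rule can_search[where good = good])
    show "can G V (answers ?T (good n))" for n
      unfolding good_def Let_def
      by (rule can_cong[OF can_answer_guess[OF Z S]], (rule dy)+) (rule answers_cong, rule T)
    show "\<exists>n. good n w" if "w \<in> V" for w
    proof -
      obtain l1 l2 l3 l4 l5 l6 N where l: "\<forall>l\<in>{l1, l2, l3, l4, l5, l6}. dyadic l"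
        and adm: "admissible l1 l2 l3 l4 l5 l6 N (z1 w) (z2 w) (s1 w) (s2 w)"
        using admissible_exists[of "z1 w" "z2 w" "s1 w" "s2 w"] by (elim exE conjE) (rule that)
      have "l \<in> range f" if "dyadic l" for l using that f by simp
    then have surj: "\<exists>n. l = f n" if "dyadic l" for l using that by blast
    have "dyadic l1" "dyadic l2" "dyadic l3" "dyadic l4" "dyadic l5" "dyadic l6" using l by simp_all
    note this[THEN surj]
    then obtain n1 n2 n3 n4 n5 n6 where "l1 = f n1" "l2 = f n2" "l3 = f n3" "l4 = f n4" "l5 = f n5" "l6 = f n6"
      by (elim exE) (rule that)
    then have "good (to_nat [n1, n2, n3, n4, n5, n6, N]) w"
        using adm by (simp add: good_def guess_def)
      then show ?thesis by blast
    qed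
  qed (rule ne)
qed

text \<open>The set to be constructed depends on the frame only through the line that carries its first axis.\<close>

lemma can_intersect_from_frame:
  fixes G :: "('w \<Rightarrow> point) list" and Or U W Z S :: "'w \<Rightarrow> point"
  assumes known: "{Or, U, W, Z, S} \<subseteq> set G"
    and norms: "\<And>w. w \<in> V \<Longrightarrow> norm (U w - Or w) = 1" "\<And>w. w \<in> V \<Longrightarrow> norm (W w - Or w) = 1"
      "\<And>w. w \<in> V \<Longrightarrow> inner (U w - Or w) (W w - Or w) = 0"
  shows "can G V (\<lambda>w K c.
    constructs {p. \<exists>x. p = Or w + x *\<^sub>R (U w - Or w) \<and> dist (Z w) p = dist (Z w) (S w)} K c)"
proof -
  interpret f: frame G V Or "\<lambda>w. U w - Or w" "\<lambda>w. W w - Or w"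
    by unfold_locales (rule norms, assumption)+
  have *: "known G V Or" "known G V U" "known G V W" "known G V Z" "known G V S"
    using known by (auto intro: known_mem)
  have "f.Point 0 0" "f.Point 1 0" "f.Point 0 1"
    unfolding f.Pt_def f.F_def using * by simp_all
  then interpret g: grid G V Or "\<lambda>w. U w - Or w" "\<lambda>w. W w - Or w"
    by unfold_locales (rule f.dyadic_lattice)
  have coordinates: "\<exists>x y. \<forall>w\<in>V. X w = f.F w (x w) (y w)" for X :: "'w \<Rightarrow> point"
  proof -
    have "\<forall>w. \<exists>x y. w \<in> V \<longrightarrow> X w = f.F w x y" using f.point_F by blast
    then show ?thesis by metis
  qed
  obtain z1 z2 where Z: "\<And>w. w \<in> V \<Longrightarrow> Z w = f.F w (z1 w) (z2 w)" using coordinates[of Z] by blast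
  obtain s1 s2 where S: "\<And>w. w \<in> V \<Longrightarrow> S w = f.F w (s1 w) (s2 w)" using coordinates[of S] by blast
  have PZ: "f.Pt z1 z2" unfolding f.Pt_def by (rule known_cong[OF *(4) Z])
  have PS: "f.Pt s1 s2" unfolding f.Pt_def by (rule known_cong[OF *(5) S])
  have ne: "G \<noteq> []" using known by auto
  have T: "{f.F w x 0 | x. dist (f.F w (z1 w) (z2 w)) (f.F w x 0) =
      dist (f.F w (z1 w) (z2 w)) (f.F w (s1 w) (s2 w))} =
      {p. \<exists>x. p = Or w + x *\<^sub>R (U w - Or w) \<and> dist (Z w) p = dist (Z w) (S w)}" if "w \<in> V" for w
    unfolding Z[OF that, symmetric] S[OF that, symmetric] by (auto simp: f.F_def)
  show ?thesis
    by (rule can_cong[OF g.can_intersect[OF PZ PS ne]]) (simp only: T)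
qed

theorem proposition7:
  "\<exists>K :: construction. \<forall>A B P Q Z S :: point.
     A \<noteq> B \<longrightarrow> dist P Q = 1 \<longrightarrow> closed_segment P Q \<subseteq> affine hull {A, B} \<longrightarrow> S \<noteq> Z \<longrightarrow>
     constructs (affine hull {A, B} \<inter> sphere Z (dist Z S)) K
       \<lparr>points = [A, B, P, Q, Z, S], sticks = [(P, Q)]\<rparr>"
proof -
  define V :: "(point \<times> point \<times> point \<times> point \<times> point \<times> point) set" where
    "V = {(A, B, P, Q, Z, S). A \<noteq> B \<and> dist P Q = 1 \<and> closed_segment P Q \<subseteq> affine hull {A, B}}"
  define A B P Q Z S :: "point \<times> point \<times> point \<times> point \<times> point \<times> point \<Rightarrow> point"
    where "A = (\<lambda>(a, b, p, q, z, s). a)" and "B = (\<lambda>(a, b, p, q, z, s). b)"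
      and "P = (\<lambda>(a, b, p, q, z, s). p)" and "Q = (\<lambda>(a, b, p, q, z, s). q)"
      and "Z = (\<lambda>(a, b, p, q, z, s). z)" and "S = (\<lambda>(a, b, p, q, z, s). s)"
  define G where "G = [A, B, P, Q, Z, S]"
  have V: "A w \<noteq> B w" "dist (P w) (Q w) = 1" "closed_segment (P w) (Q w) \<subseteq> affine hull {A w, B w}"
    if "w \<in> V" for w
    using that by (auto simp: V_def A_def B_def P_def Q_def)
  define T where "T = (\<lambda>w. affine hull {A w, B w} \<inter> sphere (Z w) (dist (Z w) (S w)))"
  interpret b: frame G V P "\<lambda>w. Q w - P w" "\<lambda>w. turn (Q w - P w)"
    by unfold_locales (use V(2) in \<open>simp_all add: norm_turn inner_turn dist_norm norm_minus_commute\<close>)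
  have b0: "b.Point 0 0" "b.Point 1 0"
    unfolding b.Pt_def b.F_def by (simp_all add: G_def known_mem)
  have hull: "affine hull {A w, B w} = {b.F w t 0 | t. True}" if "w \<in> V" for w
  proof -
    have "P w \<noteq> Q w" using V(2)[OF that] by auto
    from line_through_stick[OF V(1)[OF that] this V(3)[OF that]] show ?thesis by (simp add: b.F_def)
  qed
  define O' U W :: "(point \<times> point \<times> point \<times> point \<times> point \<times> point) \<times> point \<times> point \<times> point \<Rightarrow> point"
    where "O' = (\<lambda>v. fst (snd v))" and "U = (\<lambda>v. fst (snd (snd v)))" and "W = (\<lambda>v. snd (snd (snd v)))"
  have axes: "fst p \<in> V \<and> (\<exists>t \<sigma> \<tau>. (\<sigma> = 1 \<or> \<sigma> = -1) \<and> (\<tau> = 1 \<or> \<tau> = -1) \<and> O' p = b.F (fst p) t 0 \<and>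
      U p - O' p = \<sigma> *\<^sub>R (Q (fst p) - P (fst p)) \<and> W p - O' p = \<tau> *\<^sub>R turn (Q (fst p) - P (fst p)))"
    if "p \<in> b.frames" for p
  proof -
    obtain w o' u' w' where p: "p = (w, o', u', w')" by (cases p)
    obtain t where w: "w \<in> V" and t: "o' = b.F w t 0" "u' = b.F w (t + 1) 0 \<or> u' = b.F w (t - 1) 0"
      "w' = b.F w t 1 \<or> w' = b.F w t (-1)"
      using \<open>p \<in> b.frames\<close> unfolding p b.frames_def by blast
    have "\<exists>\<sigma>. (\<sigma> = 1 \<or> \<sigma> = -1) \<and> u' - o' = \<sigma> *\<^sub>R (Q w - P w)"
      using t(2) by (elim disjE) (rule exI[of _ 1], simp add: t(1) b.F_def algebra_simps,
        rule exI[of _ "-1"], simp add: t(1) b.F_def algebra_simps)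
    moreover have "\<exists>\<tau>. (\<tau> = 1 \<or> \<tau> = -1) \<and> w' - o' = \<tau> *\<^sub>R turn (Q w - P w)"
      using t(3) by (elim disjE) (rule exI[of _ 1], simp add: t(1) b.F_def,
        rule exI[of _ "-1"], simp add: t(1) b.F_def)
    ultimately show ?thesis using w t(1) unfolding p O'_def U_def W_def fst_conv snd_conv by blast
  qed
  have main: "can (lift_frame G) b.frames (\<lambda>p K c. constructs
      {x. \<exists>t. x = O' p + t *\<^sub>R (U p - O' p) \<and> dist (Z (fst p)) x = dist (Z (fst p)) (S (fst p))} K c)"
  proof (rule can_intersect_from_frame)
    show "{O', U, W, \<lambda>p. Z (fst p), \<lambda>p. S (fst p)} \<subseteq> set (lift_frame G)"
      by (simp add: O'_def U_def W_def G_def)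
    fix p assume p: "p \<in> b.frames"
    obtain \<sigma> \<tau> :: real where st: "\<sigma> = 1 \<or> \<sigma> = -1" "\<tau> = 1 \<or> \<tau> = -1" and w: "fst p \<in> V"
      and eq: "U p - O' p = \<sigma> *\<^sub>R (Q (fst p) - P (fst p))" "W p - O' p = \<tau> *\<^sub>R turn (Q (fst p) - P (fst p))"
      using axes[OF p] by blast
    show "norm (U p - O' p) = 1" "norm (W p - O' p) = 1" "inner (U p - O' p) (W p - O' p) = 0"
      unfolding eq norm_scaleR inner_scaleR_left inner_scaleR_right b.norm_u[OF w] b.norm_v[OF w] b.orth[OF w]
      using st by auto
  qed
  have target: "{x. \<exists>t. x = O' p + t *\<^sub>R (U p - O' p) \<and> dist (Z (fst p)) x = dist (Z (fst p)) (S (fst p))} =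
      T (fst p)" if p: "p \<in> b.frames" for p
  proof -
    obtain t \<sigma> \<tau> where w: "fst p \<in> V" and \<sigma>: "\<sigma> = 1 \<or> \<sigma> = -1" and O: "O' p = b.F (fst p) t 0"
      and U: "U p - O' p = \<sigma> *\<^sub>R (Q (fst p) - P (fst p))"
      using axes[OF p] by blast
    have line: "O' p + r *\<^sub>R (U p - O' p) = b.F (fst p) (t + r * \<sigma>) 0" for r
      unfolding U unfolding O by (simp add: b.F_def algebra_simps)
    have "b.F (fst p) r 0 = O' p + ((r - t) * \<sigma>) *\<^sub>R (U p - O' p)" for r
      unfolding line using \<sigma> by auto
    then have "affine hull {A (fst p), B (fst p)} = {x. \<exists>r. x = O' p + r *\<^sub>R (U p - O' p)}"
      unfolding hull[OF w] using line by blast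
    then show ?thesis by (auto simp: T_def)
  qed
  have "can (lift_frame G) b.frames (\<lambda>p K c. constructs (T (fst p)) K c)"
    by (rule can_cong[OF main]) (simp only: target)
  from b.can_frames[OF b0, where Q = "\<lambda>w K c. constructs (T w) K c", OF this]
  have "can G V (\<lambda>w K c. constructs (T w) K c)" .
  then obtain t where t: "\<And>w c. w \<in> V \<Longrightarrow> has_size 6 1 c \<Longrightarrow> holds [0, 1, 2, 3, 4, 5] G w c \<Longrightarrow>
      run t (\<lambda>K c. constructs (T w) K c) c"
    unfolding can_def by meson
  show ?thesis
  proof (intro exI[of _ "glue t"] allI impI)
    fix a b p q z s :: point
    assume *: "a \<noteq> b" "dist p q = 1" "closed_segment p q \<subseteq> affine hull {a, b}"
    let ?w = "(a, b, p, q, z, s)" and ?c = "\<lparr>points = [a, b, p, q, z, s], sticks = [(p, q)]\<rparr>"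
    have "run t (\<lambda>K c. constructs (T ?w) K c) ?c"
    proof (rule t)
      show "?w \<in> V" using * by (simp add: V_def)
      show "has_size 6 1 ?c" by (simp add: has_size_def)
      show "holds [0, 1, 2, 3, 4, 5] G ?w ?c"
        by (simp add: holds_def G_def A_def B_def P_def Q_def Z_def S_def)
    qed
    then have "constructs (T ?w) (glue t) ?c" by (rule constructs_glue)
    then show "constructs (affine hull {a, b} \<inter> sphere z (dist z s)) (glue t) ?c"
      by (simp add: T_def A_def B_def Z_def S_def)
  qed
qed

end
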